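(* Let $\Omega \subset \mathbb{R}^n$ be a bounded domain and let $f : \Omega \times \mathbb{R} \times \mathbb{R}^n \to \mathbb{R}$ be a measurable function satisfying the following two conditions. (H1) For a.e. $x \in \Omega$ the map $f(x,\cdot,\cdot)$ is lower semicontinuous on $\mathbb{R} \times \mathbb{R}^n$, and for all $(x,s) \in \Omega \times \mathbb{R}$ the map $f(x,s,\cdot)$ is quasiconvex on $\mathbb{R}^n$, i.e. $f(x,s,tp+(1-t)q) \leq \max\{ f(x,s,p), f(x,s,q)\}$ for all $p,q \in \mathbb{R}^n$ and $0 \leq t \leq 1$. (H2) For all $c \in \mathbb{R}$ there is $R \geq 0$ such that for every $(x,s) \in \Omega \times \mathbb{R}$ one has $\{ p \in \mathbb{R}^n \mid f(x,s,p) \leq c \} \subset B(0,R)$. Then for any $g \in W^{1,\infty}(\Omega)$ the functional $$F(u,V) = \underset{x \in V}{\operatorname{ess\,sup}}\, f(x,u(x),Du(x))$$ has at least one absolute minimizer in $W_g^{1,\infty}(\Omega)$.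
   Context: $W_g^{1,\infty}(\Omega)$ denotes the set of functions $u$ on $\Omega$ such that $u - g \in W^{1,\infty}(\Omega) \cap C_0(\Omega)$. Here $C_0(\Omega)$ denotes continuous functions vanishing on $\partial\Omega$, and functions in $W^{1,\infty}_{loc}$ are identified with their locally Lipschitz representatives. For an open set $V$, $V \subset\subset \Omega$ means that $\overline{V}$ is a compact subset of $\Omega$. A function $u \in W^{1,\infty}_{loc}(\Omega)$ is an absolute superminimizer (respectively absolute subminimizer) of $F$ in $\Omega$ if for all $V \subset\subset \Omega$ and all $v \in W^{1,\infty}(V) \cap C(\overline{V})$ such that $v > u$ (respectively $v < u$) in $V$ and $v = u$ on $\partial V$, it holds that $F(v,V) \geq F(u,V)$. A function is an absolute minimizer of $F$ if it is both an absolute superminimizer and an absolute subminimizer. Equivalently, $u \in W^{1,\infty}_{loc}(\Omega)$ is an absolute minimizer if for all $V \subset\subset \Omega$ one has $F(v,V) \geq F(u,V)$ whenever $v \in W^{1,\infty}(V)\cap C(\overline{V})$ and $v = u$ on $\partial V$.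
   Formalization: The formal theorem additionally assumes that some w in W_g^{1,∞}(Ω) has F(w,Ω) < ∞; without this the claim fails, e.g. Ω=(0,1), g=0, f(x,s,p)=|p−x^{-1/2}|+x^{-1/2}. "Measurable" is read as Lebesgue in x times Borel in (s,p). *)

theory Defs
  imports "HOL-Analysis.Analysis" "HOL-Probability.Essential_Supremum"
begin

section \<open>Sobolev functions of class $W^{1,\infty}$\<close>

text \<open>A function on a set \<open>\<Omega>\<close> is represented by a total function whose values
  outside \<open>\<Omega>\<close> are never used.\<close>

definition compactly_inside :: "'a::topological_space set \<Rightarrow> 'a set \<Rightarrow> bool"
    (infix "\<subset>\<subset>" 50)
  where "V \<subset>\<subset> \<Omega> \<longleftrightarrow> open V \<and> compact (closure V) \<and> closure V \<subseteq> \<Omega>"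

text \<open>\<open>\<phi>\<close> is a $C^1_c$ function in \<open>\<Omega>\<close> with gradient \<open>D\<phi>\<close>.\<close>

definition test_function ::
  "(real ^ 'n) set \<Rightarrow> (real ^ 'n \<Rightarrow> real) \<Rightarrow> (real ^ 'n \<Rightarrow> real ^ 'n) \<Rightarrow> bool"
  where "test_function \<Omega> \<phi> D\<phi> \<longleftrightarrow>
    (\<forall>x. (\<phi> has_derivative (\<lambda>h. D\<phi> x \<bullet> h)) (at x)) \<and> continuous_on UNIV D\<phi> \<and>
    compact (closure {x. \<phi> x \<noteq> 0}) \<and> closure {x. \<phi> x \<noteq> 0} \<subseteq> \<Omega>"

definition locally_integrable ::
  "'a::euclidean_space set \<Rightarrow> ('a \<Rightarrow> 'b::{banach,second_countable_topology}) \<Rightarrow> bool"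
  where "locally_integrable \<Omega> h \<longleftrightarrow>
    (\<forall>K. compact K \<and> K \<subseteq> \<Omega> \<longrightarrow> set_integrable lebesgue K h)"

text \<open>The distributional gradient, as a vector-valued integration by parts formula. First-order
  weak derivatives are tested against $C^1_c$ functions, as in Gilbarg and Trudinger.\<close>

definition has_weak_gradient ::
  "(real ^ 'n \<Rightarrow> real) \<Rightarrow> (real ^ 'n \<Rightarrow> real ^ 'n) \<Rightarrow> (real ^ 'n) set \<Rightarrow> bool"
  where "has_weak_gradient u G \<Omega> \<longleftrightarrow>
    locally_integrable \<Omega> u \<and> locally_integrable \<Omega> G \<and>
    (\<forall>\<phi> D\<phi>. test_function \<Omega> \<phi> D\<phi> \<longrightarrow>
       (LINT x|lebesgue_on \<Omega>. u x *\<^sub>R D\<phi> x) = - (LINT x|lebesgue_on \<Omega>. \<phi> x *\<^sub>R G x))"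

text \<open>A weak gradient is unique only up to null sets; \<open>weak_grad \<Omega> u\<close> is a fixed representative.\<close>

definition weak_grad ::
  "(real ^ 'n) set \<Rightarrow> (real ^ 'n \<Rightarrow> real) \<Rightarrow> real ^ 'n \<Rightarrow> real ^ 'n"
  where "weak_grad \<Omega> u = (SOME G. has_weak_gradient u G \<Omega>)"

definition Linf :: "'a::euclidean_space set \<Rightarrow> ('a \<Rightarrow> 'b::real_normed_vector) set"
  where "Linf \<Omega> = {h \<in> borel_measurable (lebesgue_on \<Omega>).
    \<exists>C. AE x in lebesgue_on \<Omega>. norm (h x) \<le> C}"

definition locally_Lipschitz_on :: "'a::metric_space set \<Rightarrow> ('a \<Rightarrow> 'b::metric_space) \<Rightarrow> bool"
  where "locally_Lipschitz_on \<Omega> u \<longleftrightarrow>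
    (\<forall>x\<in>\<Omega>. \<exists>r>0. \<exists>L. lipschitz_on L (cball x r \<inter> \<Omega>) u)"

text \<open>Sobolev functions are identified with their locally Lipschitz representatives, so membership
  below is a property of the function itself and not of its class modulo null sets.\<close>

definition W1inf :: "(real ^ 'n) set \<Rightarrow> (real ^ 'n \<Rightarrow> real) set"
  where "W1inf \<Omega> = {u. locally_Lipschitz_on \<Omega> u \<and> u \<in> Linf \<Omega> \<and>
    (\<exists>G. has_weak_gradient u G \<Omega> \<and> G \<in> Linf \<Omega>)}"

definition W1inf_loc :: "(real ^ 'n) set \<Rightarrow> (real ^ 'n \<Rightarrow> real) set"
  where "W1inf_loc \<Omega> = {u. locally_Lipschitz_on \<Omega> u \<and> (\<forall>V. V \<subset>\<subset> \<Omega> \<longrightarrow> u \<in> W1inf V)}"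

text \<open>Continuous functions on \<open>\<Omega>\<close> vanishing on its boundary: the extension by zero is continuous
  on the closure. Extending explicitly matters because the values of \<open>w\<close> outside \<open>\<Omega>\<close> are
  meaningless.\<close>

definition C0 :: "'a::topological_space set \<Rightarrow> ('a \<Rightarrow> real) set"
  where "C0 \<Omega> = {w. continuous_on (closure \<Omega>) (\<lambda>x. if x \<in> \<Omega> then w x else 0)}"

definition W1inf_bdry ::
  "(real ^ 'n) set \<Rightarrow> (real ^ 'n \<Rightarrow> real) \<Rightarrow> (real ^ 'n \<Rightarrow> real) set"
  where "W1inf_bdry \<Omega> g = {u. (\<lambda>x. u x - g x) \<in> W1inf \<Omega> \<inter> C0 \<Omega>}"

section \<open>Supremal functionals and absolute minimizers\<close>

definition supremal_functional ::
  "(real ^ 'n \<Rightarrow> real \<Rightarrow> real ^ 'n \<Rightarrow> real) \<Rightarrow> (real ^ 'n \<Rightarrow> real) \<Rightarrow> (real ^ 'n) set \<Rightarrow> ereal"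
  where "supremal_functional f u V =
    esssup (lebesgue_on V) (\<lambda>x. ereal (f x (u x) (weak_grad V u x)))"

definition absolute_superminimizer ::
  "((real ^ 'n \<Rightarrow> real) \<Rightarrow> (real ^ 'n) set \<Rightarrow> ereal) \<Rightarrow> (real ^ 'n) set \<Rightarrow> (real ^ 'n \<Rightarrow> real) \<Rightarrow> bool"
  where "absolute_superminimizer F \<Omega> u \<longleftrightarrow> u \<in> W1inf_loc \<Omega> \<and>
    (\<forall>V v. V \<subset>\<subset> \<Omega> \<and> v \<in> W1inf V \<and> continuous_on (closure V) v \<and>
       (\<forall>x\<in>V. v x > u x) \<and> (\<forall>x\<in>frontier V. v x = u x) \<longrightarrow> F v V \<ge> F u V)"

definition absolute_subminimizer ::
  "((real ^ 'n \<Rightarrow> real) \<Rightarrow> (real ^ 'n) set \<Rightarrow> ereal) \<Rightarrow> (real ^ 'n) set \<Rightarrow> (real ^ 'n \<Rightarrow> real) \<Rightarrow> bool"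
  where "absolute_subminimizer F \<Omega> u \<longleftrightarrow> u \<in> W1inf_loc \<Omega> \<and>
    (\<forall>V v. V \<subset>\<subset> \<Omega> \<and> v \<in> W1inf V \<and> continuous_on (closure V) v \<and>
       (\<forall>x\<in>V. v x < u x) \<and> (\<forall>x\<in>frontier V. v x = u x) \<longrightarrow> F v V \<ge> F u V)"

definition absolute_minimizer ::
  "((real ^ 'n \<Rightarrow> real) \<Rightarrow> (real ^ 'n) set \<Rightarrow> ereal) \<Rightarrow> (real ^ 'n) set \<Rightarrow> (real ^ 'n \<Rightarrow> real) \<Rightarrow> bool"
  where "absolute_minimizer F \<Omega> u \<longleftrightarrow>
    absolute_superminimizer F \<Omega> u \<and> absolute_subminimizer F \<Omega> u"

section \<open>Structural conditions on the supremand\<close>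

definition lower_semicont :: "('a::topological_space \<Rightarrow> real) \<Rightarrow> bool"
  where "lower_semicont h \<longleftrightarrow> (\<forall>z y. y < h z \<longrightarrow> eventually (\<lambda>w. y < h w) (nhds z))"

definition quasiconvex :: "('a::real_vector \<Rightarrow> real) \<Rightarrow> bool"
  where "quasiconvex h \<longleftrightarrow>
    (\<forall>p q t. 0 \<le> t \<and> t \<le> 1 \<longrightarrow> h (t *\<^sub>R p + (1 - t) *\<^sub>R q) \<le> max (h p) (h q))"

text \<open>Measurability is with respect to the product of the Lebesgue sets of \<open>\<Omega>\<close> and the Borel sets
  in the remaining variables. This includes every Borel function, and it makes
  $x \mapsto f(x,u(x),Du(x))$ measurable, which measurability with respect to the Lebesgue sets
  of the product space does not.\<close>

definition measurable_supremand ::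
  "(real ^ 'n) set \<Rightarrow> (real ^ 'n \<Rightarrow> real \<Rightarrow> real ^ 'n \<Rightarrow> real) \<Rightarrow> bool"
  where "measurable_supremand \<Omega> f \<longleftrightarrow>
    (\<lambda>(x, s, p). f x s p) \<in>
      borel_measurable (lebesgue_on \<Omega> \<Otimes>\<^sub>M (borel :: (real \<times> (real ^ 'n)) measure))"

definition H1 :: "(real ^ 'n) set \<Rightarrow> (real ^ 'n \<Rightarrow> real \<Rightarrow> real ^ 'n \<Rightarrow> real) \<Rightarrow> bool"
  where "H1 \<Omega> f \<longleftrightarrow>
    (AE x in lebesgue_on \<Omega>. lower_semicont (\<lambda>(s, p). f x s p)) \<and>
    (\<forall>x\<in>\<Omega>. \<forall>s. quasiconvex (f x s))"

definition H2 :: "(real ^ 'n) set \<Rightarrow> (real ^ 'n \<Rightarrow> real \<Rightarrow> real ^ 'n \<Rightarrow> real) \<Rightarrow> bool"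
  where "H2 \<Omega> f \<longleftrightarrow> (\<forall>c. \<exists>R\<ge>0. \<forall>x\<in>\<Omega>. \<forall>s. {p. f x s p \<le> c} \<subseteq> ball 0 R)"

end

theory Submission
  imports Defs
begin

text \<open>
  The functional sees a competitor only through inequalities \<open>f x (u x) (Du x) \<le> c\<close> that hold almost
  everywhere. The whole proof works with such inequalities, so the weak gradient is first turned
  into a pointwise object. For a locally Lipschitz function the forward difference quotients with
  steps \<open>1 / k\<close> converge almost everywhere, and their limit \<open>pgrad u\<close> is the weak gradient
  (\<open>locally_Lipschitz_has_weak_gradient\<close>, \<open>weak_grad_eq_pgrad\<close>). This limit depends only on \<open>u\<close> near
  the point, and two functions have equal gradients at almost every point where they coincide
  (\<open>pgrad_eq_on_coincidence_set\<close>). Hence \<open>F(u,V) \<le> c\<close> is a pointwise condition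
  (\<open>supremal_functional_le_iff\<close>, written \<open>energy_le\<close> below), and for maxima, minima and functions
  glued along a boundary it can be checked piece by piece.

  Two consequences of the structural conditions make a Perron argument possible. By \<open>H2\<close>, finite
  energy bounds the gradient; competitors with the same boundary values therefore become
  equi-Lipschitz on the whole space once the datum is subtracted and the difference is extended by
  zero (\<open>lipschitz_extension_by_zero\<close>, \<open>competitors_equi_lipschitz\<close>). By \<open>H1\<close>, an energy bound
  survives pointwise convergence of such functions (\<open>energy_le_pointwise_limit\<close>): the gradients of the limit lie in the closed convex hull
  of the limit points of the gradients, and sublevel sets of \<open>f x s\<close> are closed and convex. So a
  family of competitors that is closed under maxima and increasing limits has a greatest element,
  and similarly for least elements.

  Fix \<open>c\<close> such that some function with boundary values \<open>g\<close> has energy at most \<open>c\<close>. The least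
  function with these boundary values and energy at most \<open>c\<close> is an absolute subminimizer: a smaller
  function with less energy on some \<open>V\<close> could be glued in and would contradict leastness. Let \<open>s\<close> be
  the greatest absolute subminimizer with boundary values \<open>g\<close> and energy at most \<open>c\<close>. It is also an
  absolute superminimizer. Indeed, let \<open>v \<ge> s\<close> have energy at most \<open>d\<close> on \<open>V = {v > s}\<close>, where
  \<open>d < c\<close> since otherwise \<open>s\<close> already has energy at most \<open>d\<close> on \<open>V\<close>, and let \<open>b\<close> be
  the least function with \<open>b \<ge> s\<close>, with \<open>b = s\<close> off \<open>V\<close>, and with energy at most \<open>d\<close> on \<open>V\<close>.
  Leastness makes \<open>b\<close> again an absolute subminimizer, so \<open>b \<le> s\<close> by the choice of \<open>s\<close>; therefore
  \<open>b = s\<close>, and \<open>s\<close> itself has energy at most \<open>d\<close> on \<open>V\<close>.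
\<close>

section \<open>Lipschitz functions of one variable\<close>

lemma AE_lborel_const [simp]: "(AE x in (lborel :: 'a::euclidean_space measure). c) \<longleftrightarrow> c"
proof (cases c)
  case False
  have "\<not> (AE x in (lborel :: 'a measure). False)"
    using ae_filter_eq_bot_iff[of "lborel :: 'a measure"] emeasure_lborel_UNIV[where 'a='a]
    by (simp add: trivial_limit_def[symmetric] trivial_limit_eq)
  with False show ?thesis by simp
qed simp

text \<open>Adding \<open>L x\<close> makes an \<open>L\<close>-Lipschitz function nondecreasing, so it has a Stieltjes measure. The
  Stieltjes measures of \<open>L x + \<phi> x\<close> and of \<open>L x - \<phi> x\<close> add up to \<open>2 L\<close> times Lebesgue measure, hence
  each of them is dominated by it.\<close>

lemma lipschitz_interval_measure_absolutely_continuous: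
  fixes \<phi> :: "real \<Rightarrow> real"
  assumes "L-lipschitz_on UNIV \<phi>"
  defines "F \<equiv> \<lambda>x. \<phi> x + L * x"
  shows "absolutely_continuous lborel (interval_measure F)"
proof -
  define K where "K = (\<lambda>x. L * x - \<phi> x)"
  have L0: "0 \<le> L" using assms(1) lipschitz_on_nonneg by blast
  have lip: "\<bar>\<phi> x - \<phi> y\<bar> \<le> L * \<bar>x - y\<bar>" for x y
    using lipschitz_onD[OF assms(1), of x y] by (simp add: dist_real_def)
  have c\<phi>: "isCont \<phi> x" for x
    using lipschitz_on_continuous_on[OF assms(1)] by (simp add: continuous_on_eq_continuous_at)
  have monoF: "F x \<le> F y" and monoK: "K x \<le> K y" if "x \<le> y" for x y
    using lip[of x y] that by (auto simp: F_def K_def abs_le_iff algebra_simps)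
  have rF: "continuous (at_right a) F" and rK: "continuous (at_right a) K" for a
    unfolding F_def K_def using c\<phi>[of a]
    by (auto intro!: continuous_intros simp: continuous_at_imp_continuous_at_within)
  \<comment> \<open>The sum of the two Stieltjes measures, identified on half-open intervals.\<close>
  define N where "N = measure_of UNIV (sets borel)
    (\<lambda>A. emeasure (interval_measure F) A + emeasure (interval_measure K) A)"
  have setsN: "sets N = sets borel"
    unfolding N_def using sets.sigma_sets_eq[of "borel :: real measure"] by (simp add: sets_measure_of)
  have emN: "emeasure N A = emeasure (interval_measure F) A + emeasure (interval_measure K) A"
    if "A \<in> sets borel" for A
  proof (rule emeasure_measure_of[OF N_def])
    show "countably_additive (sets N) (\<lambda>A. emeasure (interval_measure F) A + emeasure (interval_measure K) A)"
      unfolding countably_additive_def setsN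
    proof safe
      fix B :: "nat \<Rightarrow> real set"
      assume B: "range B \<subseteq> sets borel" "disjoint_family B"
      show "(\<Sum>i. emeasure (interval_measure F) (B i) + emeasure (interval_measure K) (B i)) =
        emeasure (interval_measure F) (\<Union>(range B)) + emeasure (interval_measure K) (\<Union>(range B))"
        using suminf_emeasure[of B "interval_measure F"] suminf_emeasure[of B "interval_measure K"] B
        by (subst suminf_add[symmetric]) auto
    qed
    show "A \<in> sets N" using that setsN by simp
  qed (auto simp: positive_def)
  have "N = density lborel (\<lambda>_. ennreal (2 * L))"
  proof (rule measure_eqI_generator_eq[where E = "range (\<lambda>(a, b). {a<..b::real})" and \<Omega> = UNIV
        and A = "\<lambda>i::nat. {-real i<..real i}"])
    show "Int_stable (range (\<lambda>(a, b). {a<..b::real}))"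
      by (auto simp: Int_stable_def image_iff)
    show "emeasure N X = emeasure (density lborel (\<lambda>_. ennreal (2 * L))) X"
      if "X \<in> range (\<lambda>(a, b). {a<..b::real})" for X
    proof -
      obtain a b where X: "X = {a<..b}" using \<open>X \<in> _\<close> by auto
      show ?thesis
      proof (cases "a \<le> b")
        case True
        have "emeasure N X = ennreal (F b - F a) + ennreal (K b - K a)"
          unfolding X using True
          by (simp add: emN emeasure_interval_measure_Ioc monoF monoK rF rK)
        also have "\<dots> = ennreal (2 * L * (b - a))"
          using monoF[OF True] monoK[OF True]
          by (subst ennreal_plus[symmetric]) (auto simp: F_def K_def algebra_simps)
        also have "\<dots> = emeasure (density lborel (\<lambda>_. ennreal (2 * L))) X"
          unfolding X using True L0 by (simp add: emeasure_density_const ennreal_mult)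
        finally show ?thesis .
      qed (simp add: X)
    qed
    show "sets N = sigma_sets UNIV (range (\<lambda>(a, b). {a<..b::real}))"
      by (simp add: setsN borel_sigma_sets_Ioc)
    show "sets (density lborel (\<lambda>_. ennreal (2 * L))) = sigma_sets UNIV (range (\<lambda>(a, b). {a<..b::real}))"
      by (simp add: borel_sigma_sets_Ioc)
    show "range (\<lambda>i::nat. {- real i<..real i}) \<subseteq> range (\<lambda>(a, b). {a<..b})" by auto
    show "(\<Union>i. {- real i<..real i}) = UNIV"
    proof safe
      fix x :: real
      obtain n :: nat where "\<bar>x\<bar> < real n" using reals_Archimedean2 by blast
      then show "x \<in> (\<Union>i. {- real i<..real i})" by (intro UN_I[of n]) auto
    qed auto
    show "emeasure N {- real i<..real i} \<noteq> \<infinity>" for i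
      by (simp add: emN emeasure_interval_measure_Ioc monoF monoK rF rK)
  qed auto
  then have eq: "emeasure (interval_measure F) A + emeasure (interval_measure K) A
      = ennreal (2 * L) * emeasure lborel A" if "A \<in> sets borel" for A
    using emN[OF that] that by (simp add: emeasure_density_const)
  show ?thesis
    unfolding absolutely_continuous_def null_sets_def
  proof safe
    fix A :: "real set"
    assume A: "A \<in> sets lborel" "emeasure lborel A = 0"
    with eq[of A] show "emeasure (interval_measure F) A = 0" by simp
    show "A \<in> sets (interval_measure F)" using A by simp
  qed
qed

text \<open>The density is the Radon--Nikodym derivative of the Stieltjes measure of \<open>\<phi> x + L x\<close>, minus \<open>L\<close>.\<close>

lemma lipschitz_indefinite_integral:
  fixes \<phi> :: "real \<Rightarrow> real"
  assumes "L-lipschitz_on UNIV \<phi>"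
  obtains h where "h \<in> borel_measurable borel"
    and "\<And>a b. a \<le> b \<Longrightarrow> (h has_integral \<phi> b - \<phi> a) {a..b}"
proof -
  define F where "F = (\<lambda>x. \<phi> x + L * x)"
  have lip: "\<bar>\<phi> x - \<phi> y\<bar> \<le> L * \<bar>x - y\<bar>" for x y
    using lipschitz_onD[OF assms(1), of x y] by (simp add: dist_real_def)
  have c\<phi>: "isCont \<phi> x" for x
    using lipschitz_on_continuous_on[OF assms(1)] by (simp add: continuous_on_eq_continuous_at)
  have mono: "F x \<le> F y" if "x \<le> y" for x y
    using lip[of x y] that by (auto simp: F_def abs_le_iff algebra_simps)
  have cont: "continuous_on UNIV F"
    unfolding F_def using c\<phi> by (auto intro!: continuous_intros simp: continuous_at_imp_continuous_on)
  have rc: "continuous (at_right a) F" for a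
    using cont by (auto simp: continuous_on_eq_continuous_at continuous_at_imp_continuous_at_within)
  let ?\<mu> = "interval_measure F"
  have ac: "absolutely_continuous lborel ?\<mu>"
    using lipschitz_interval_measure_absolutely_continuous[OF assms(1)] by (simp add: F_def)
  have sf: "sigma_finite_measure ?\<mu>"
    by (rule sigma_finite_interval_measure[OF mono rc])
  define r where "r = RN_deriv lborel ?\<mu>"
  have rm[measurable]: "r \<in> borel_measurable borel"
    unfolding r_def using borel_measurable_RN_deriv[of lborel] by simp
  have dens: "density lborel r = ?\<mu>"
    unfolding r_def by (rule sigma_finite_measure.density_RN_deriv[OF sigma_finite_lborel ac]) simp
  have fin: "AE x in lborel. r x \<noteq> \<infinity>"
    unfolding r_def by (rule sigma_finite_measure.RN_deriv_finite[OF sigma_finite_lborel sf ac]) simp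
  define e where "e = (\<lambda>x. enn2real (r x))"
  have em[measurable]: "e \<in> borel_measurable borel" unfolding e_def by measurable
  have e0: "e x \<ge> 0" for x by (simp add: e_def)
  have re: "AE x in lborel. r x = ennreal (e x)"
    using fin by eventually_elim (simp add: e_def top.not_eq_extremum)
  have eint: "(e has_integral F b - F a) {a..b}" if "a \<le> b" for a b
  proof -
    have "(\<integral>\<^sup>+x. ennreal (e x * indicator {a..b} x) \<partial>lborel) = (\<integral>\<^sup>+x. r x * indicator {a..b} x \<partial>lborel)"
      by (rule nn_integral_cong_AE) (use re in eventually_elim, auto simp: indicator_def)
    also have "\<dots> = emeasure ?\<mu> {a..b}"
      by (subst dens[symmetric]) (simp add: emeasure_density)
    also have "\<dots> = ennreal (F b - F a)"
      by (rule emeasure_interval_measure_Icc[OF that mono cont])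
    finally have "((\<lambda>x. e x * indicator {a..b} x) has_integral F b - F a) UNIV"
      using mono[OF that] e0 by (intro nn_integral_has_integral) auto
    then show ?thesis
      by (subst has_integral_restrict_UNIV[symmetric]) (simp add: indicator_def of_bool_def if_distrib cong: if_cong)
  qed
  show ?thesis
  proof
    show "(\<lambda>x. e x - L) \<in> borel_measurable borel" by measurable
    show "((\<lambda>x. e x - L) has_integral \<phi> b - \<phi> a) {a..b}" if "a \<le> b" for a b
      using has_integral_diff[OF eint[OF that] has_integral_const_real[of L a b]] that
      by (simp add: F_def algebra_simps)
  qed
qed

abbreviation right_quotient :: "(real \<Rightarrow> real) \<Rightarrow> nat \<Rightarrow> real \<Rightarrow> real"
  where "right_quotient \<phi> k t \<equiv> real (Suc k) * (\<phi> (t + 1 / real (Suc k)) - \<phi> t)"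

text \<open>The difference quotients are averages of the density over \<open>[t, t + 1 / k]\<close>, and these converge at
  almost every \<open>t\<close>. The steps \<open>1 / k\<close> are chosen because a sequential limit of Borel functions is a Borel
  function.\<close>

lemma lipschitz_quotients_converge_AE:
  fixes \<phi> :: "real \<Rightarrow> real"
  assumes "L-lipschitz_on UNIV \<phi>"
  obtains h where "h \<in> borel_measurable borel"
    and "\<And>a b. a \<le> b \<Longrightarrow> (h has_integral \<phi> b - \<phi> a) {a..b}"
    and "AE t in lborel. (\<lambda>k. right_quotient \<phi> k t) \<longlonglongrightarrow> h t"
proof -
  obtain h where hm: "h \<in> borel_measurable borel"
    and h: "\<And>a b. a \<le> b \<Longrightarrow> (h has_integral \<phi> b - \<phi> a) {a..b}"
    using lipschitz_indefinite_integral[OF assms] by blast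
  have "h integrable_on cbox a b" for a b
    using h[of a b] by (cases "a \<le> b") (auto simp: integrable_on_def)
  then obtain N where N: "negligible N"
    and lim: "\<And>x e. \<lbrakk>x \<notin> N; 0 < e\<rbrakk> \<Longrightarrow> \<exists>d>0. \<forall>r. 0 < r \<and> r < d \<longrightarrow>
        norm (integral (cbox x (x + r *\<^sub>R One)) h /\<^sub>R r ^ DIM(real) - h x) < e"
    using integrable_ccontinuous_explicit[of h] by blast
  have conv: "(\<lambda>k. right_quotient \<phi> k t) \<longlonglongrightarrow> h t" if t: "t \<notin> N" for t
  proof (rule LIMSEQ_I)
    fix e :: real assume "0 < e"
    then obtain d where d: "d > 0" "\<And>r. 0 < r \<Longrightarrow> r < d \<Longrightarrow>
        norm (integral (cbox t (t + r *\<^sub>R One)) h /\<^sub>R r ^ DIM(real) - h t) < e"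
      using lim[OF t \<open>0 < e\<close>] by blast
    obtain n :: nat where n: "1 / d < real n" using reals_Archimedean2 by blast
    show "\<exists>no. \<forall>k\<ge>no. norm (right_quotient \<phi> k t - h t) < e"
    proof (intro exI[of _ n] allI impI)
      fix k assume "n \<le> k"
      have "1 / d < real (Suc k)" using n \<open>n \<le> k\<close> by linarith
      then have r: "0 < 1 / real (Suc k)" "1 / real (Suc k) < d"
        using d(1) by (simp_all add: field_simps)
      have i: "integral {t..t + 1 / real (Suc k)} h = \<phi> (t + 1 / real (Suc k)) - \<phi> t"
        using h[of t "t + 1 / real (Suc k)"] by (intro integral_unique) simp
      show "norm (right_quotient \<phi> k t - h t) < e"
        using d(2)[OF r] i by (simp add: divide_inverse mult.commute)
    qed
  qed
  have "AE t in lebesgue. t \<notin> N"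
    using N by (simp add: AE_not_in negligible_iff_null_sets)
  then have "AE t in lborel. t \<notin> N" by (simp add: AE_completion_iff)
  then have "AE t in lborel. (\<lambda>k. right_quotient \<phi> k t) \<longlonglongrightarrow> h t"
    by eventually_elim (rule conv)
  with hm h show ?thesis using that by blast
qed

text \<open>A bound on the derivative almost everywhere improves the Lipschitz constant, because the
  increments are integrals of the derivative.\<close>

lemma lipschitz_increment_bound:
  fixes \<phi> :: "real \<Rightarrow> real"
  assumes "L-lipschitz_on UNIV \<phi>"
    and bnd: "AE t in lborel. \<bar>lim (\<lambda>k. right_quotient \<phi> k t)\<bar> \<le> B"
    and "a \<le> b"
  shows "\<bar>\<phi> b - \<phi> a\<bar> \<le> B * (b - a)"
proof -
  have "\<exists>h. (h has_integral \<phi> b - \<phi> a) {a..b} \<and>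
    (AE t in lborel. (\<lambda>k. right_quotient \<phi> k t) \<longlonglongrightarrow> h t)"
    by (rule lipschitz_quotients_converge_AE[OF assms(1)]) (use \<open>a \<le> b\<close> in blast)
  then obtain h where h: "(h has_integral \<phi> b - \<phi> a) {a..b}"
    and conv: "AE t in lborel. (\<lambda>k. right_quotient \<phi> k t) \<longlonglongrightarrow> h t"
    by blast
  have hB: "AE t in lborel. \<bar>h t\<bar> \<le> B"
    using bnd conv by eventually_elim (auto dest: limI)
  have B0: "B \<ge> 0"
  proof (rule ccontr)
    assume "\<not> B \<ge> 0"
    then have "AE t in lborel::real measure. False"
      by (intro eventually_mono[OF hB]) auto
    then show False by simp
  qed
  \<comment> \<open>Clipping turns a bound almost everywhere into a bound everywhere.\<close>
  define h' where "h' = (\<lambda>t. max (-B) (min B (h t)))"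
  have hh': "AE t in lborel. t \<in> {a..b} \<longrightarrow> h t = h' t"
    using hB by eventually_elim (auto simp: h'_def)
  have "(h' has_integral \<phi> b - \<phi> a) {a..b}"
    using h has_integral_AE[OF hh'] by simp
  then have "norm (\<phi> b - \<phi> a) \<le> B * measure lborel {a..b}"
    by (rule has_integral_bound_real[OF B0 finite.emptyI]) (use B0 in \<open>auto simp: h'_def\<close>)
  then show ?thesis using \<open>a \<le> b\<close> by simp
qed

section \<open>Gradients as limits of difference quotients\<close>

lemma AE_lborel_translate:
  fixes a :: "'a::euclidean_space"
  assumes "{x. P x} \<in> sets borel"
  shows "(AE x in lborel. P (x + a)) \<longleftrightarrow> (AE x in lborel. P x)"
proof -
  have "(AE x in lborel. P x) \<longleftrightarrow> (AE x in distr lborel borel ((+) a). P x)"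
    by (subst lborel_distr_plus) (rule refl)
  also have "\<dots> \<longleftrightarrow> (AE x in lborel. P (x + a))"
    using assms by (subst AE_distr_iff) (auto simp: add.commute)
  finally show ?thesis ..
qed

text \<open>Fubini along the lines of direction \<open>e\<close>, with translation invariance in place of a choice of
  coordinates: for each \<open>t\<close>, the condition at \<open>x + t e\<close> for almost every \<open>x\<close> is the condition at
  almost every \<open>x\<close>.\<close>

lemma AE_lborel_iff_AE_lines:
  fixes e :: "'a::euclidean_space"
  assumes P: "{x. P x} \<in> sets borel"
  shows "(AE x in lborel. P x) \<longleftrightarrow> (AE x in lborel. AE t in lborel. P (x + t *\<^sub>R e))"
proof -
  have psf: "pair_sigma_finite (lborel :: 'a measure) (lborel :: real measure)"
    by (intro pair_sigma_finite.intro sigma_finite_lborel)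
  have [measurable]: "Measurable.pred borel P" using P by (simp add: pred_def)
  have "(AE x in lborel. AE t in lborel. P (x + t *\<^sub>R e)) \<longleftrightarrow>
    (AE t in lborel. AE x in lborel. P (x + t *\<^sub>R e))"
    by (rule pair_sigma_finite.AE_commute[OF psf]) measurable
  also have "\<dots> \<longleftrightarrow> (AE t in lborel :: real measure. AE x in lborel. P x)"
    by (simp add: AE_lborel_translate[OF P])
  also have "\<dots> \<longleftrightarrow> (AE x in lborel. P x)"
    by simp
  finally show ?thesis ..
qed

definition difference_quotient :: "'n \<Rightarrow> (real ^ 'n \<Rightarrow> real) \<Rightarrow> nat \<Rightarrow> real ^ 'n \<Rightarrow> real"
  where "difference_quotient i u k x = real (Suc k) * (u (x + (1 / real (Suc k)) *\<^sub>R axis i 1) - u x)"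

text \<open>The limit is taken along the steps \<open>1 / k\<close>; where it fails to exist the value is arbitrary. For a
  locally Lipschitz function this is the weak gradient, by \<open>weak_grad_eq_pgrad\<close>.\<close>

definition pgrad :: "(real ^ 'n \<Rightarrow> real) \<Rightarrow> real ^ 'n \<Rightarrow> real ^ 'n"
  where "pgrad u x = (\<chi> i. lim (\<lambda>k. difference_quotient i u k x))"

definition quotients_converge :: "(real ^ 'n \<Rightarrow> real) \<Rightarrow> real ^ 'n \<Rightarrow> bool"
  where "quotients_converge u x \<longleftrightarrow> (\<forall>i. convergent (\<lambda>k. difference_quotient i u k x))"

lemma difference_quotient_tendsto_pgrad:
  "quotients_converge u x \<Longrightarrow> (\<lambda>k. difference_quotient i u k x) \<longlonglongrightarrow> pgrad u x $ i"
  by (simp add: quotients_converge_def pgrad_def convergent_LIMSEQ_iff)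

lemma pgradI:
  "(\<And>i. (\<lambda>k. difference_quotient i u k x) \<longlonglongrightarrow> p $ i) \<Longrightarrow> quotients_converge u x \<and> pgrad u x = p"
  by (auto simp: quotients_converge_def pgrad_def vec_eq_iff convergent_def dest: limI)

lemma borel_measurable_difference_quotient [measurable]:
  assumes [measurable]: "u \<in> borel_measurable borel"
  shows "difference_quotient i u k \<in> borel_measurable borel"
  unfolding difference_quotient_def by measurable

lemma borel_measurable_pgrad [measurable]:
  fixes u :: "real ^ 'n \<Rightarrow> real"
  assumes [measurable]: "u \<in> borel_measurable borel"
  shows "pgrad u \<in> borel_measurable borel"
proof -
  have "(\<lambda>x. lim (\<lambda>k. difference_quotient i u k x)) \<in> borel_measurable borel" for i
    by (rule borel_measurable_lim_metric) measurable
  then show ?thesis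
    unfolding pgrad_def by (subst borel_measurable_euclidean_space) (auto simp: Basis_vec_def inner_axis)
qed

lemma lipschitz_borel_measurable:
  fixes u :: "'a::metric_space \<Rightarrow> real"
  shows "L-lipschitz_on UNIV u \<Longrightarrow> u \<in> borel_measurable borel"
  by (intro borel_measurable_continuous_onI lipschitz_on_continuous_on)

lemma lipschitz_on_line:
  fixes u :: "real ^ 'n \<Rightarrow> real"
  assumes "L-lipschitz_on UNIV u"
  shows "L-lipschitz_on UNIV (\<lambda>t. u (x + t *\<^sub>R axis i 1))"
proof (rule lipschitz_onI)
  show "0 \<le> L" using assms lipschitz_on_nonneg by blast
  fix s t :: real
  have "dist (u (x + s *\<^sub>R axis i 1)) (u (x + t *\<^sub>R axis i 1)) \<le> L * dist (x + s *\<^sub>R axis i 1) (x + t *\<^sub>R axis i 1)"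
    by (rule lipschitz_onD[OF assms]) auto
  also have "dist (x + s *\<^sub>R axis i 1) (x + t *\<^sub>R axis i (1::real)) = dist s t"
    by (simp add: dist_norm flip: scaleR_diff_left)
  finally show "dist (u (x + s *\<^sub>R axis i 1)) (u (x + t *\<^sub>R axis i 1)) \<le> L * dist s t" .
qed

lemma difference_quotient_on_line:
  "difference_quotient i u k (x + t *\<^sub>R axis i 1) =
    real (Suc k) * (u (x + (t + 1 / real (Suc k)) *\<^sub>R axis i 1) - u (x + t *\<^sub>R axis i 1))"
  by (simp add: difference_quotient_def algebra_simps)

text \<open>On each line parallel to an axis this is the statement for functions of one variable.\<close>

lemma lipschitz_quotients_converge:
  fixes u :: "real ^ 'n \<Rightarrow> real"
  assumes u: "L-lipschitz_on UNIV u"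
  shows "AE x in lborel. quotients_converge u x"
proof -
  have [measurable]: "u \<in> borel_measurable borel" by (rule lipschitz_borel_measurable[OF u])
  have "AE x in lborel. convergent (\<lambda>k. difference_quotient i u k x)" for i
  proof -
    have m: "{x. convergent (\<lambda>k. difference_quotient i u k x)} \<in> sets borel"
      using sets_Collect_Cauchy[of "\<lambda>k. difference_quotient i u k" borel]
      by (auto simp: Cauchy_convergent_iff)
    have "AE t in lborel. convergent (\<lambda>k. difference_quotient i u k (x + t *\<^sub>R axis i 1))" for x
    proof -
      obtain h where "AE t in lborel. (\<lambda>k. real (Suc k) * (u (x + (t + 1 / real (Suc k)) *\<^sub>R axis i 1) - u (x + t *\<^sub>R axis i 1))) \<longlonglongrightarrow> h t"
        by (rule lipschitz_quotients_converge_AE[OF lipschitz_on_line[OF u]])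
      then show ?thesis
        by eventually_elim (auto simp: difference_quotient_on_line convergent_def)
    qed
    then show ?thesis
      by (subst AE_lborel_iff_AE_lines[OF m, where e = "axis i 1"]) simp
  qed
  then show ?thesis
    unfolding quotients_converge_def by (rule eventually_all_finite)
qed

text \<open>On almost every line the bound holds at almost every point, so the estimate holds for almost
  every \<open>x\<close>; it extends to all \<open>x\<close> by continuity.\<close>

lemma lipschitz_increment_bound_axis:
  fixes u :: "real ^ 'n \<Rightarrow> real"
  assumes u: "L-lipschitz_on UNIV u" and bnd: "AE x in lborel. \<bar>pgrad u x $ i\<bar> \<le> B"
  shows "\<bar>u (x + t *\<^sub>R axis i 1) - u x\<bar> \<le> B * \<bar>t\<bar>"
proof -
  have [measurable]: "u \<in> borel_measurable borel" by (rule lipschitz_borel_measurable[OF u])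
  have cu: "continuous_on UNIV u" using u lipschitz_on_continuous_on by blast
  have "{x. \<bar>pgrad u x $ i\<bar> \<le> B} \<in> sets borel" by measurable
  note AE_lborel_iff_AE_lines[OF this, where e = "axis i 1"]
  then have lines: "AE x in lborel. AE t in lborel. \<bar>pgrad u (x + t *\<^sub>R axis i 1) $ i\<bar> \<le> B"
    using bnd by simp
  have pos: "\<bar>u (x + t *\<^sub>R axis i 1) - u x\<bar> \<le> B * t" if "t \<ge> 0" for x t
  proof -
    have "AE x in lborel. x \<in> {x. \<bar>u (x + t *\<^sub>R axis i 1) - u x\<bar> \<le> B * t}"
      using lines
    proof eventually_elim
      case (elim x)
      then have "AE t in lborel. \<bar>lim (\<lambda>k. real (Suc k) * (u (x + (t + 1 / real (Suc k)) *\<^sub>R axis i 1) - u (x + t *\<^sub>R axis i 1)))\<bar> \<le> B"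
        by eventually_elim (simp add: pgrad_def difference_quotient_on_line)
      from lipschitz_increment_bound[OF lipschitz_on_line[OF u] this \<open>t \<ge> 0\<close>]
      show ?case by simp
    qed
    moreover have "closed {x. \<bar>u (x + t *\<^sub>R axis i 1) - u x\<bar> \<le> B * t}"
      by (intro closed_Collect_le continuous_intros continuous_on_compose2[OF cu]) auto
    ultimately show ?thesis
      using mem_closed_if_AE_lebesgue[of "{x. \<bar>u (x + t *\<^sub>R axis i 1) - u x\<bar> \<le> B * t}" x]
      by (simp add: AE_completion_iff)
  qed
  show ?thesis
  proof (cases "t \<ge> 0")
    case False
    with pos[of "-t" "x + t *\<^sub>R axis i 1"] show ?thesis by (simp add: abs_minus_commute)
  qed (use pos in auto)
qed

text \<open>Two points are joined by a path of segments parallel to the axes. The dimensional factor is the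
  price of this path; any constant that does not depend on \<open>u\<close> would do.\<close>

lemma lipschitz_from_pgrad_bound:
  fixes u :: "real ^ 'n \<Rightarrow> real"
  assumes u: "L-lipschitz_on UNIV u" and bnd: "AE x in lborel. norm (pgrad u x) \<le> B" and "B \<ge> 0"
  shows "(B * CARD('n))-lipschitz_on UNIV u"
proof (rule lipschitz_onI)
  show "0 \<le> B * real CARD('n)" using \<open>B \<ge> 0\<close> by simp
  have axis: "\<bar>u (x + t *\<^sub>R axis i 1) - u x\<bar> \<le> B * \<bar>t\<bar>" for x t i
  proof (rule lipschitz_increment_bound_axis[OF u])
    show "AE x in lborel. \<bar>pgrad u x $ i\<bar> \<le> B"
      using bnd by eventually_elim (meson component_le_norm_cart order_trans)
  qed
  fix x y :: "real ^ 'n"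
  have sum: "\<bar>u (x + (\<Sum>i\<in>S. (y - x) $ i *\<^sub>R axis i 1)) - u x\<bar> \<le> B * (\<Sum>i\<in>S. \<bar>(y - x) $ i\<bar>)"
    if "finite S" for S
    using that
  proof (induction S)
    case (insert j S)
    let ?z = "x + (\<Sum>i\<in>S. (y - x) $ i *\<^sub>R axis i 1)"
    have "\<bar>u (?z + (y - x) $ j *\<^sub>R axis j 1) - u ?z\<bar> \<le> B * \<bar>(y - x) $ j\<bar>" by (rule axis)
    moreover have "x + (\<Sum>i\<in>insert j S. (y - x) $ i *\<^sub>R axis i 1) = ?z + (y - x) $ j *\<^sub>R axis j 1"
      using insert by (simp add: algebra_simps)
    moreover have "(\<Sum>i\<in>insert j S. \<bar>(y - x) $ i\<bar>) = \<bar>(y - x) $ j\<bar> + (\<Sum>i\<in>S. \<bar>(y - x) $ i\<bar>)"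
      using insert by simp
    ultimately show ?case using insert.IH by (simp only: distrib_left)
  qed simp
  have "x + (\<Sum>i\<in>UNIV. (y - x) $ i *\<^sub>R axis i 1) = y"
    using basis_expansion[of "y - x"] by (simp add: scalar_mult_eq_scaleR)
  then have "\<bar>u y - u x\<bar> \<le> B * (\<Sum>i\<in>UNIV. \<bar>(y - x) $ i\<bar>)"
    using sum[of UNIV] by simp
  also have "\<dots> \<le> B * (\<Sum>i\<in>(UNIV::'n set). norm (y - x))"
    using \<open>B \<ge> 0\<close> by (intro mult_left_mono sum_mono component_le_norm_cart)
  also have "\<dots> = B * real CARD('n) * dist x y" by (simp add: dist_norm norm_minus_commute)
  finally show "dist (u x) (u y) \<le> B * real CARD('n) * dist x y"
    by (simp add: dist_real_def abs_minus_commute)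
qed

section \<open>Locally Lipschitz functions\<close>

text \<open>The extension is the largest one, \<open>w x = inf (u y + L |x - y|)\<close> over \<open>y \<in> K\<close>.\<close>

lemma mcshane_extension:
  fixes u :: "'a::metric_space \<Rightarrow> real"
  assumes u: "L-lipschitz_on K u"
  obtains w where "L-lipschitz_on UNIV w" "\<And>x. x \<in> K \<Longrightarrow> w x = u x"
proof (cases "K = {}")
  case True
  have "L-lipschitz_on UNIV (\<lambda>_. 0)"
    using lipschitz_on_nonneg[OF u] by (auto simp: lipschitz_on_def)
  then show ?thesis using True that by blast
next
  case False
  have L0: "L \<ge> 0" using u by (rule lipschitz_on_nonneg)
  define w where "w = (\<lambda>x. INF y\<in>K. u y + L * dist x y)"
  have lip: "u z \<le> u y + L * dist z y" if "z \<in> K" "y \<in> K" for z y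
    using lipschitz_onD[OF u that] by (auto simp: dist_real_def)
  obtain y0 where y0: "y0 \<in> K" using False by blast
  have bdd: "bdd_below ((\<lambda>y. u y + L * dist x y) ` K)" for x
  proof (rule bdd_belowI2)
    fix y assume y: "y \<in> K"
    have "u y0 \<le> u y + L * dist y0 y" by (rule lip[OF y0 y])
    also have "L * dist y0 y \<le> L * (dist x y0 + dist x y)"
      using L0 dist_triangle3[of y0 y x] by (intro mult_left_mono) auto
    finally show "u y0 - L * dist x y0 \<le> u y + L * dist x y" by (simp add: algebra_simps)
  qed
  have mono: "w x \<le> w x' + L * dist x x'" for x x'
  proof -
    have "w x - L * dist x x' \<le> u y + L * dist x' y" if "y \<in> K" for y
    proof -
      have "w x \<le> u y + L * dist x y" unfolding w_def by (rule cINF_lower[OF bdd that])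
      also have "L * dist x y \<le> L * (dist x x' + dist x' y)"
        using L0 by (intro mult_left_mono dist_triangle)
      finally show ?thesis by (simp add: algebra_simps)
    qed
    then have "w x - L * dist x x' \<le> w x'"
      unfolding w_def by (intro cINF_greatest False)
    then show ?thesis by simp
  qed
  show ?thesis
  proof
    show "L-lipschitz_on UNIV w"
    proof (rule lipschitz_onI[OF _ L0])
      fix x x' show "dist (w x) (w x') \<le> L * dist x x'"
        using mono[of x x'] mono[of x' x] by (simp add: dist_real_def abs_le_iff dist_commute)
    qed
    show "w x = u x" if "x \<in> K" for x
    proof (rule antisym)
      show "w x \<le> u x" unfolding w_def using cINF_lower[OF bdd that, of x] by simp
      show "u x \<le> w x" unfolding w_def using lip[OF that] by (intro cINF_greatest False)
    qed
  qed
qed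

lemma borel_measurable_vec_nth [measurable (raw)]:
  fixes f :: "'a \<Rightarrow> real ^ 'n"
  assumes "f \<in> borel_measurable M"
  shows "(\<lambda>x. f x $ i) \<in> borel_measurable M"
  by (rule borel_measurable_continuous_on[OF _ assms]) (intro continuous_intros)

lemma locally_Lipschitz_on_subset:
  "locally_Lipschitz_on \<Omega> u \<Longrightarrow> V \<subseteq> \<Omega> \<Longrightarrow> locally_Lipschitz_on V u"
  unfolding locally_Lipschitz_on_def
  by (blast intro: lipschitz_on_subset)

lemma locally_Lipschitz_on_compact:
  assumes u: "locally_Lipschitz_on \<Omega> u" and K: "compact K" "K \<subseteq> \<Omega>"
  obtains L where "L-lipschitz_on K u"
proof -
  have "local_lipschitz {0::real} K (\<lambda>_. u)"
  proof (rule local_lipschitzI)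
    fix x and t :: real assume x: "x \<in> K"
    obtain r L where r: "r > 0" "L-lipschitz_on (cball x r \<inter> \<Omega>) u"
      using u x K(2) unfolding locally_Lipschitz_on_def by blast
    then have "L-lipschitz_on (cball x r \<inter> K) u"
      using K(2) by (auto intro: lipschitz_on_subset)
    then show "\<exists>r>0. \<exists>L. \<forall>t\<in>cball t r \<inter> {0}. L-lipschitz_on (cball x r \<inter> K) u"
      using r(1) by blast
  qed
  then have "\<exists>L. L-lipschitz_on K u"
    by (rule local_lipschitz_compact_implies_lipschitz[OF _ K(1) compact_sing continuous_on_const]) auto
  then show ?thesis using that by blast
qed

text \<open>This reduces local statements about a locally Lipschitz function to globally Lipschitz functions:
  the function is Lipschitz on a compact neighbourhood of \<open>K\<close> and extends from there.\<close>

lemma locally_Lipschitz_on_near_compact: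
  fixes u :: "'a::heine_borel \<Rightarrow> real"
  assumes "open \<Omega>" "locally_Lipschitz_on \<Omega> u" "compact K" "K \<subseteq> \<Omega>"
  obtains L w U where "L-lipschitz_on UNIV w" "open U" "K \<subseteq> U" "U \<subseteq> \<Omega>" "\<And>x. x \<in> U \<Longrightarrow> w x = u x"
proof (cases "K = {}")
  case True
  show ?thesis
    by (rule that[of 0 "\<lambda>_. 0" "{}"]) (auto simp: True lipschitz_on_def)
next
  case False
  obtain e where e: "e > 0" "{x. infdist x K \<le> e} \<subseteq> \<Omega>"
    using compact_in_open_separated[OF False assms(3,1,4)] by blast
  have "compact {x. infdist x K \<le> e}"
    by (rule compact_infdist_le[OF False assms(3) e(1)])
  then obtain L where "L-lipschitz_on {x. infdist x K \<le> e} u"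
    using locally_Lipschitz_on_compact[OF assms(2) _ e(2)] by blast
  then have "\<exists>w. L-lipschitz_on UNIV w \<and> (\<forall>x. infdist x K \<le> e \<longrightarrow> w x = u x)"
    by (rule mcshane_extension) auto
  then obtain w where w: "L-lipschitz_on UNIV w" "\<And>x. infdist x K \<le> e \<Longrightarrow> w x = u x"
    by blast
  show ?thesis
  proof
    show "L-lipschitz_on UNIV w" by fact
    show "open {x. infdist x K < e}"
      by (intro open_Collect_less continuous_intros)
    show "K \<subseteq> {x. infdist x K < e}" using e(1) by auto
    show "{x. infdist x K < e} \<subseteq> \<Omega>" using e(2) by auto
    show "w x = u x" if "x \<in> {x. infdist x K < e}" for x using w(2) that by simp
  qed
qed

lemma difference_quotient_eventually_cong:
  assumes "open U" "x \<in> U" "\<And>y. y \<in> U \<Longrightarrow> u y = v y"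
  shows "\<forall>\<^sub>F k in sequentially. difference_quotient i u k x = difference_quotient i v k x"
proof -
  have "(\<lambda>k. x + (1 / real (Suc k)) *\<^sub>R axis i 1) \<longlonglongrightarrow> x + 0 *\<^sub>R axis i (1::real)"
    by (intro tendsto_intros LIMSEQ_Suc lim_1_over_n)
  then have "\<forall>\<^sub>F k in sequentially. x + (1 / real (Suc k)) *\<^sub>R axis i 1 \<in> U"
    using assms(1,2) by (intro topological_tendstoD[where l = x]) simp_all
  then show ?thesis
    by eventually_elim (simp add: difference_quotient_def assms)
qed

text \<open>The gradient is local, because only small steps matter in the limit.\<close>

lemma pgrad_cong_open:
  assumes "open U" "x \<in> U" "\<And>y. y \<in> U \<Longrightarrow> u y = v y"
  shows "pgrad u x = pgrad v x" "quotients_converge u x \<longleftrightarrow> quotients_converge v x"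
proof -
  have iff: "(\<lambda>k. difference_quotient i u k x) \<longlonglongrightarrow> l \<longleftrightarrow> (\<lambda>k. difference_quotient i v k x) \<longlonglongrightarrow> l" for i l
    by (rule tendsto_cong[OF difference_quotient_eventually_cong[OF assms]])
  show "pgrad u x = pgrad v x" unfolding pgrad_def lim_def iff ..
  show "quotients_converge u x \<longleftrightarrow> quotients_converge v x"
    unfolding quotients_converge_def convergent_def iff ..
qed

lemma difference_quotient_bound:
  assumes "L-lipschitz_on UNIV u"
  shows "\<bar>difference_quotient i u k x\<bar> \<le> L"
proof -
  have "\<bar>u (x + (1 / real (Suc k)) *\<^sub>R axis i 1) - u x\<bar> \<le> L * (1 / real (Suc k))"
    using lipschitz_onD[OF assms, of "x + (1 / real (Suc k)) *\<^sub>R axis i 1" x]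
    by (simp add: dist_norm)
  then have "real (Suc k) * \<bar>u (x + (1 / real (Suc k)) *\<^sub>R axis i 1) - u x\<bar> \<le> real (Suc k) * (L * (1 / real (Suc k)))"
    by (intro mult_left_mono) auto
  then show ?thesis by (simp add: difference_quotient_def abs_mult)
qed

lemma norm_pgrad_bound:
  fixes u :: "real ^ 'n \<Rightarrow> real"
  assumes "L-lipschitz_on UNIV u" "quotients_converge u x"
  shows "\<bar>pgrad u x $ i\<bar> \<le> L" "norm (pgrad u x) \<le> L * CARD('n)"
proof -
  show c: "\<bar>pgrad u x $ i\<bar> \<le> L" for i
    by (rule LIMSEQ_le_const2[OF tendsto_rabs[OF difference_quotient_tendsto_pgrad[OF assms(2), of i]]])
      (use difference_quotient_bound[OF assms(1)] in auto)
  have "norm (pgrad u x) \<le> (\<Sum>i\<in>UNIV. \<bar>pgrad u x $ i\<bar>)" by (rule norm_le_l1_cart)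
  also have "\<dots> \<le> (\<Sum>i\<in>(UNIV::'n set). L)" by (intro sum_mono c)
  finally show "norm (pgrad u x) \<le> L * CARD('n)" by (simp add: mult.commute)
qed

section \<open>Integration by parts\<close>

lemma compact_norm_bound:
  assumes "compact A" "continuous_on A f"
  shows "\<exists>B\<ge>0. \<forall>x\<in>A. norm (f x) \<le> B"
  by (rule continuous_on_compact_bound[OF assms]) blast

text \<open>Outside the closed support the function vanishes on an open set, so its gradient vanishes as well;
  boundedness then follows from compactness of the support.\<close>

lemma test_function_facts:
  fixes \<phi> :: "real ^ 'n \<Rightarrow> real"
  assumes "test_function \<Omega> \<phi> D\<phi>"
  shows test_function_continuous: "continuous_on UNIV \<phi>"
    and test_function_gradient_continuous: "continuous_on UNIV D\<phi>"
    and test_function_zero: "x \<notin> closure {x. \<phi> x \<noteq> 0} \<Longrightarrow> \<phi> x = 0"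
    and test_function_gradient_zero: "x \<notin> closure {x. \<phi> x \<noteq> 0} \<Longrightarrow> D\<phi> x = 0"
    and test_function_gradient_bounded: "\<exists>M. \<forall>x. norm (D\<phi> x) \<le> M"
    and test_function_bounded: "\<exists>M. \<forall>x. \<bar>\<phi> x\<bar> \<le> M"
    and test_function_mono: "test_function UNIV \<phi> D\<phi>"
proof -
  let ?S = "closure {x. \<phi> x \<noteq> 0}"
  have d: "(\<phi> has_derivative (\<lambda>h. D\<phi> x \<bullet> h)) (at x)" for x
    using assms by (simp add: test_function_def)
  show c: "continuous_on UNIV \<phi>"
    by (intro continuous_at_imp_continuous_on ballI has_derivative_continuous[OF d])
  show cD: "continuous_on UNIV D\<phi>" using assms by (simp add: test_function_def)
  have comp: "compact ?S" using assms by (simp add: test_function_def)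
  show z: "\<phi> x = 0" if "x \<notin> ?S" for x
  proof (rule ccontr)
    assume "\<phi> x \<noteq> 0"
    then have "x \<in> {x. \<phi> x \<noteq> 0}" by simp
    then have "x \<in> ?S" by (rule closure_subset[THEN subsetD])
    with that show False by simp
  qed
  show zD: "D\<phi> x = 0" if "x \<notin> ?S" for x
  proof -
    have "((\<lambda>_. 0) has_derivative (\<lambda>h. D\<phi> x \<bullet> h)) (at x)"
    proof (rule has_derivative_transform_within_open[OF d])
      show "open (- ?S)" "x \<in> - ?S" using that by auto
      show "\<phi> y = 0" if "y \<in> - ?S" for y using that by (intro z) simp
    qed
    then have "(\<lambda>h. D\<phi> x \<bullet> h) = (\<lambda>h. 0)"
      by (rule has_derivative_unique) (rule has_derivative_const)
    then have "D\<phi> x \<bullet> D\<phi> x = 0" by metis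
    then show ?thesis by simp
  qed
  obtain M where M: "M \<ge> 0" "\<And>x. x \<in> ?S \<Longrightarrow> norm (D\<phi> x) \<le> M"
    using compact_norm_bound[OF comp continuous_on_subset[OF cD subset_UNIV]] by blast
  have "norm (D\<phi> x) \<le> M" for x
    using M zD[of x] by (cases "x \<in> ?S") auto
  then show "\<exists>M. \<forall>x. norm (D\<phi> x) \<le> M" by blast
  obtain M where M: "M \<ge> 0" "\<And>x. x \<in> ?S \<Longrightarrow> norm (\<phi> x) \<le> M"
    using compact_norm_bound[OF comp continuous_on_subset[OF c subset_UNIV]] by blast
  have "\<bar>\<phi> x\<bar> \<le> M" for x
    using M z[of x] by (cases "x \<in> ?S") auto
  then show "\<exists>M. \<forall>x. \<bar>\<phi> x\<bar> \<le> M" by blast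
  show "test_function UNIV \<phi> D\<phi>" using assms by (simp add: test_function_def)
qed

lemma test_function_lipschitz:
  fixes \<phi> :: "real ^ 'n \<Rightarrow> real"
  assumes "test_function \<Omega> \<phi> D\<phi>"
  obtains M where "M-lipschitz_on UNIV \<phi>"
proof -
  obtain M where M: "\<And>x. norm (D\<phi> x) \<le> M" using test_function_gradient_bounded[OF assms] by blast
  have M0: "M \<ge> 0" using M[of 0] norm_ge_zero order_trans by blast
  have "M-lipschitz_on UNIV \<phi>"
  proof (rule bounded_derivative_imp_lipschitz[OF _ _ _ M0])
    show "(\<phi> has_derivative (\<lambda>h. D\<phi> x \<bullet> h)) (at x within UNIV)" for x
      using assms by (simp add: test_function_def)
    show "onorm (\<lambda>h. D\<phi> x \<bullet> h) \<le> M" for x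
    proof (rule onorm_le)
      fix h
      have "\<bar>D\<phi> x \<bullet> h\<bar> \<le> norm (D\<phi> x) * norm h" by (rule Cauchy_Schwarz_ineq2)
      also have "\<dots> \<le> M * norm h" by (intro mult_right_mono M) simp
      finally show "norm (D\<phi> x \<bullet> h) \<le> M * norm h" by simp
    qed
  qed auto
  then show ?thesis using that by blast
qed

lemma lborel_integral_translate:
  fixes f :: "'a::euclidean_space \<Rightarrow> real"
  assumes [measurable]: "f \<in> borel_measurable borel"
  shows "(LINT x|lborel. f (x + a)) = (LINT x|lborel. f x)"
proof -
  have "(LINT x|lborel. f x) = (LINT x|distr lborel borel ((+) a). f x)"
    by (subst lborel_distr_plus) (rule refl)
  also have "\<dots> = (LINT x|lborel. f (a + x))"
    by (rule integral_distr) measurable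
  finally show ?thesis by (simp add: add.commute)
qed

lemma integrable_compact_support:
  fixes f :: "'a::euclidean_space \<Rightarrow> 'b::{banach, second_countable_topology}"
  assumes m: "f \<in> borel_measurable borel" and S: "compact S"
    and z: "\<And>x. x \<notin> S \<Longrightarrow> f x = 0" and b: "AE x in lborel. x \<in> S \<longrightarrow> norm (f x) \<le> M"
  shows "integrable lborel f"
proof (rule Bochner_Integration.integrable_bound)
  show "integrable lborel (\<lambda>x. M * indicator S x :: real)"
    using S emeasure_compact_finite[OF S] by (intro integrable_mult_right) (simp add: integrable_indicator_iff borel_compact)
  show "AE x in lborel. norm (f x) \<le> norm (M * indicator S x)"
    using b by eventually_elim (auto simp: indicator_def z)
qed (use m in simp)

lemma integrable_continuous_compact_support:
  fixes f :: "'a::euclidean_space \<Rightarrow> real"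
  assumes "continuous_on UNIV f" "compact S" "\<And>x. x \<notin> S \<Longrightarrow> f x = 0"
  shows "integrable lborel f"
proof -
  have "(\<lambda>x. indicator S x *\<^sub>R f x) = f" using assms(3) by (auto simp: indicator_def fun_eq_iff)
  then show ?thesis
    using borel_integrable_compact[OF assms(2) continuous_on_subset[OF assms(1) subset_UNIV]] by simp
qed

lemma test_function_quotient:
  fixes \<phi> :: "real ^ 'n \<Rightarrow> real"
  assumes "test_function \<Omega> \<phi> D\<phi>"
  shows "(\<lambda>k. real (Suc k) * (\<phi> (x - (1 / real (Suc k)) *\<^sub>R axis i 1) - \<phi> x)) \<longlonglongrightarrow> - D\<phi> x $ i"
proof -
  define g where "g = (\<lambda>t. \<phi> (x - t *\<^sub>R axis i 1))"
  have "(\<phi> has_derivative (\<lambda>h. D\<phi> x \<bullet> h)) (at (x - 0 *\<^sub>R axis i 1))"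
    using assms by (simp add: test_function_def)
  then have "(g has_derivative (\<lambda>t. D\<phi> x \<bullet> (- (t *\<^sub>R axis i 1)))) (at 0)"
    unfolding g_def
    by (rule has_derivative_compose[rotated]) (auto intro!: derivative_eq_intros)
  then have "DERIV g 0 :> - D\<phi> x $ i"
    by (rule has_derivative_imp_has_field_derivative) (simp add: inner_axis mult.commute)
  then have "(\<lambda>h. (g (0 + h) - g 0) / h) \<midarrow>0\<rightarrow> - D\<phi> x $ i" by (simp add: DERIV_def)
  moreover have "filterlim (\<lambda>k. 1 / real (Suc k)) (at 0) sequentially"
    unfolding filterlim_at
    by (intro conjI LIMSEQ_Suc[OF lim_1_over_n]) auto
  ultimately have "(\<lambda>k. (g (0 + 1 / real (Suc k)) - g 0) / (1 / real (Suc k))) \<longlonglongrightarrow> - D\<phi> x $ i"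
    by (rule filterlim_compose)
  then show ?thesis by (simp add: g_def mult.commute)
qed

text \<open>Discrete integration by parts: the forward quotient of \<open>u\<close> tested against \<open>\<phi>\<close> is \<open>u\<close> tested against
  the backward quotient of \<open>\<phi>\<close>. Both sides converge by dominated convergence, since the quotients of
  Lipschitz functions are bounded by the Lipschitz constants.\<close>

lemma lipschitz_integration_by_parts:
  fixes u \<phi> :: "real ^ 'n \<Rightarrow> real"
  assumes u: "L-lipschitz_on UNIV u" and \<phi>: "test_function \<Omega> \<phi> D\<phi>"
  shows "integrable lborel (\<lambda>x. u x * D\<phi> x $ i)" "integrable lborel (\<lambda>x. \<phi> x * pgrad u x $ i)"
    "(LINT x|lborel. u x * D\<phi> x $ i) = - (LINT x|lborel. \<phi> x * pgrad u x $ i)"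
proof -
  let ?S = "closure {x. \<phi> x \<noteq> 0}" and ?e = "axis i 1 :: real ^ 'n"
  let ?h = "\<lambda>k. (1 / real (Suc k)) *\<^sub>R ?e"
  have S: "compact ?S" using \<phi> by (simp add: test_function_def)
  have cu: "continuous_on UNIV u" using u lipschitz_on_continuous_on by blast
  note c\<phi> = test_function_continuous[OF \<phi>] and cD = test_function_gradient_continuous[OF \<phi>]
  note z = test_function_zero[OF \<phi>] and zD = test_function_gradient_zero[OF \<phi>]
  have [measurable]: "u \<in> borel_measurable borel" "\<phi> \<in> borel_measurable borel" "D\<phi> \<in> borel_measurable borel"
    using cu c\<phi> cD by (auto intro: borel_measurable_continuous_onI)
  obtain B where B: "\<And>x. \<bar>\<phi> x\<bar> \<le> B" using test_function_bounded[OF \<phi>] by blast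
  obtain M where M: "M-lipschitz_on UNIV \<phi>" using test_function_lipschitz[OF \<phi>] by blast
  obtain r where r: "\<And>x. x \<in> ?S \<Longrightarrow> norm x \<le> r" using compact_imp_bounded[OF S] by (auto simp: bounded_iff)
  let ?C = "cball 0 (r + 1) :: (real ^ 'n) set"
  obtain U where U0: "0 \<le> U" and "\<And>x. x \<in> ?C \<Longrightarrow> norm (u x) \<le> U"
    using compact_norm_bound[OF compact_cball continuous_on_subset[OF cu subset_UNIV]] by blast
  then have U: "\<bar>u x\<bar> \<le> U" if "x \<in> ?C" for x using that by simp
  have fC: "emeasure lborel ?C < \<infinity>" by (rule emeasure_compact_finite) simp
  have SC: "?S \<subseteq> ?C" using r by force
  have outC: "\<phi> x = 0" "\<phi> (x - ?h k) = 0" if "x \<notin> ?C" for x k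
  proof -
    show "\<phi> x = 0" by (rule z) (use that SC in blast)
    have "norm x \<le> norm (x - ?h k) + norm (?h k)"
      using norm_triangle_ineq[of "x - ?h k" "?h k"] by simp
    moreover have "norm (?h k) \<le> 1" by simp
    moreover have "\<not> norm x \<le> r + 1" using that by simp
    ultimately have "\<not> norm (x - ?h k) \<le> r" by linarith
    then show "\<phi> (x - ?h k) = 0" by (intro z) (use r in blast)
  qed
  show "integrable lborel (\<lambda>x. u x * D\<phi> x $ i)"
    by (rule integrable_continuous_compact_support[OF _ S]) (auto intro!: continuous_intros cu cD simp: zD)
  have conv: "AE x in lborel. quotients_converge u x" by (rule lipschitz_quotients_converge[OF u])
  show "integrable lborel (\<lambda>x. \<phi> x * pgrad u x $ i)"
  proof (rule integrable_compact_support[where S = "?C" and M = "B * L"])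
    show "AE x in lborel. x \<in> ?C \<longrightarrow> norm (\<phi> x * pgrad u x $ i) \<le> B * L"
      using conv
    proof eventually_elim
      case (elim x)
      then show ?case
        unfolding real_norm_def abs_mult using norm_pgrad_bound(1)[OF u elim] B[of x]
        by (intro impI mult_mono) auto
    qed
    show "\<phi> x * pgrad u x $ i = 0" if "x \<notin> ?C" for x using outC(1) that by auto
  qed (auto intro: compact_cball)
  have int_u: "integrable lborel (\<lambda>x. u x * \<phi> (x - t *\<^sub>R ?e))" for t
  proof (rule integrable_continuous_compact_support)
    show "continuous_on UNIV (\<lambda>x. u x * \<phi> (x - t *\<^sub>R ?e))"
      by (intro continuous_intros cu continuous_on_compose2[OF c\<phi>]) auto
    show "compact ((\<lambda>x. t *\<^sub>R ?e + x) ` ?S)" by (rule compact_translation[OF S])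
    show "u x * \<phi> (x - t *\<^sub>R ?e) = 0" if "x \<notin> (\<lambda>x. t *\<^sub>R ?e + x) ` ?S" for x
    proof -
      have "x - t *\<^sub>R ?e \<notin> ?S" using that by (auto simp: image_iff)
      then have "\<phi> (x - t *\<^sub>R ?e) = 0" by (rule z)
      then show ?thesis by simp
    qed
  qed
  define A where "A = (\<lambda>k. LINT x|lborel. \<phi> x * difference_quotient i u k x)"
  have A_eq: "A k = (LINT x|lborel. u x * (real (Suc k) * (\<phi> (x - ?h k) - \<phi> x)))" for k
  proof -
    have i0: "integrable lborel (\<lambda>x. u x * \<phi> x)" using int_u[of 0] by simp
    have tr: "(LINT x|lborel. u (x + ?h k) * \<phi> x) = (LINT x|lborel. u x * \<phi> (x - ?h k))"
      using lborel_integral_translate[of "\<lambda>x. u x * \<phi> (x - ?h k)" "?h k"] by simp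
    have i2: "integrable lborel (\<lambda>x. u (x + ?h k) * \<phi> x)"
    proof -
      have "integrable (distr lborel borel ((+) (?h k))) (\<lambda>x. u x * \<phi> (x - ?h k))"
        using int_u[of "1 / real (Suc k)"] by (subst lborel_distr_plus)
      then show ?thesis by (subst (asm) integrable_distr_eq) (auto simp: add.commute)
    qed
    have "A k = (LINT x|lborel. real (Suc k) * (u (x + ?h k) * \<phi> x - u x * \<phi> x))"
      unfolding A_def difference_quotient_def by (intro Bochner_Integration.integral_cong) (auto simp: algebra_simps)
    also have "\<dots> = real (Suc k) * ((LINT x|lborel. u (x + ?h k) * \<phi> x) - (LINT x|lborel. u x * \<phi> x))"
      using i2 i0 by simp
    also have "\<dots> = real (Suc k) * ((LINT x|lborel. u x * \<phi> (x - ?h k)) - (LINT x|lborel. u x * \<phi> x))"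
      by (simp only: tr)
    also have "\<dots> = (LINT x|lborel. real (Suc k) * (u x * \<phi> (x - ?h k) - u x * \<phi> x))"
      using int_u i0 by simp
    also have "\<dots> = (LINT x|lborel. u x * (real (Suc k) * (\<phi> (x - ?h k) - \<phi> x)))"
      by (intro Bochner_Integration.integral_cong) (auto simp: algebra_simps)
    finally show ?thesis .
  qed
  have lim1: "A \<longlonglongrightarrow> (LINT x|lborel. \<phi> x * pgrad u x $ i)"
    unfolding A_def
  proof (rule integral_dominated_convergence[where w = "\<lambda>x. L * (B * indicator ?C x)"])
    show "integrable lborel (\<lambda>x. L * (B * indicator ?C x :: real))"
      using fC by (intro integrable_mult_right) (simp add: integrable_indicator_iff)
    show "AE x in lborel. (\<lambda>k. \<phi> x * difference_quotient i u k x) \<longlonglongrightarrow> \<phi> x * pgrad u x $ i"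
      using conv by eventually_elim (intro tendsto_intros difference_quotient_tendsto_pgrad)
    show "AE x in lborel. norm (\<phi> x * difference_quotient i u k x) \<le> L * (B * indicator ?C x)" for k
    proof (rule AE_I2)
      fix x
      show "norm (\<phi> x * difference_quotient i u k x) \<le> L * (B * indicator ?C x)"
      proof (cases "x \<in> ?C")
        case True
        have "\<bar>\<phi> x\<bar> * \<bar>difference_quotient i u k x\<bar> \<le> B * L"
          by (intro mult_mono B difference_quotient_bound[OF u]) (use B[of x] in auto)
        then show ?thesis using True by (simp add: abs_mult mult.commute)
      qed (simp add: outC)
    qed
  qed auto
  have lim2: "(\<lambda>k. LINT x|lborel. u x * (real (Suc k) * (\<phi> (x - ?h k) - \<phi> x)))
      \<longlonglongrightarrow> (LINT x|lborel. u x * (- D\<phi> x $ i))"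
  proof (rule integral_dominated_convergence[where w = "\<lambda>x. U * (M * indicator ?C x)"])
    show "integrable lborel (\<lambda>x. U * (M * indicator ?C x :: real))"
      using fC by (intro integrable_mult_right) (simp add: integrable_indicator_iff)
    show "AE x in lborel. (\<lambda>k. u x * (real (Suc k) * (\<phi> (x - ?h k) - \<phi> x)))
      \<longlonglongrightarrow> u x * (- D\<phi> x $ i)"
      by (intro AE_I2 tendsto_intros test_function_quotient[OF \<phi>])
    show "AE x in lborel. norm (u x * (real (Suc k) * (\<phi> (x - ?h k) - \<phi> x)))
        \<le> U * (M * indicator ?C x)" for k
    proof (rule AE_I2)
      fix x
      show "norm (u x * (real (Suc k) * (\<phi> (x - ?h k) - \<phi> x))) \<le> U * (M * indicator ?C x)"
      proof (cases "x \<in> ?C")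
        case True
        have "\<bar>difference_quotient i \<phi> k (x - ?h k)\<bar> \<le> M"
          by (rule difference_quotient_bound[OF M])
        then have "\<bar>real (Suc k) * (\<phi> (x - ?h k) - \<phi> x)\<bar> \<le> M"
          by (simp add: difference_quotient_def abs_mult abs_minus_commute)
        then have "\<bar>u x\<bar> * \<bar>real (Suc k) * (\<phi> (x - ?h k) - \<phi> x)\<bar> \<le> U * M"
          by (intro mult_mono U True) (use U0 in auto)
        then show ?thesis using True by (simp add: abs_mult)
      next
        case False
        then show ?thesis using outC(1)[OF False] outC(2)[OF False, of k] by (simp del: of_nat_Suc)
      qed
    qed
  qed auto
  have "A \<longlonglongrightarrow> (LINT x|lborel. u x * (- D\<phi> x $ i))"
    unfolding A_eq[THEN ext] by (rule lim2)
  from LIMSEQ_unique[OF lim1 this]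
  show "(LINT x|lborel. u x * D\<phi> x $ i) = - (LINT x|lborel. \<phi> x * pgrad u x $ i)" by simp
qed

lemma integral_vec_nth:
  fixes F :: "'a \<Rightarrow> real ^ 'n"
  assumes "\<And>i. integrable M (\<lambda>x. F x $ i)"
  shows "integrable M F" and "(LINT x|M. F x) $ i = (LINT x|M. F x $ i)"
proof -
  have "(\<lambda>x. \<Sum>i\<in>UNIV. F x $ i *\<^sub>R axis i 1) = F"
    by (rule ext) (simp add: basis_expansion flip: scalar_mult_eq_scaleR)
  moreover have "integrable M (\<lambda>x. \<Sum>i\<in>UNIV. F x $ i *\<^sub>R (axis i 1 :: real ^ 'n))"
    by (intro Bochner_Integration.integrable_sum integrable_scaleR_left assms)
  ultimately show *: "integrable M F" by simp
  show "(LINT x|M. F x) $ i = (LINT x|M. F x $ i)"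
    using integral_bounded_linear[OF bounded_linear_vec_nth *, of i] by simp
qed

lemma locally_integrable_locally_Lipschitz:
  fixes u :: "real ^ 'n \<Rightarrow> real"
  assumes "open \<Omega>" "locally_Lipschitz_on \<Omega> u"
  shows "locally_integrable \<Omega> u" "locally_integrable \<Omega> (pgrad u)"
  unfolding locally_integrable_def
proof safe
  fix K assume K: "compact K" "K \<subseteq> \<Omega>"
  obtain L w U where w: "L-lipschitz_on UNIV w" "open U" "K \<subseteq> U" "\<And>x. x \<in> U \<Longrightarrow> w x = u x"
    using locally_Lipschitz_on_near_compact[OF assms K] by metis
  have [measurable]: "w \<in> borel_measurable borel" "K \<in> sets borel"
    using lipschitz_borel_measurable[OF w(1)] K(1) by (auto intro: borel_compact)
  have 1: "(\<lambda>x. indicator K x *\<^sub>R u x) = (\<lambda>x. indicator K x *\<^sub>R w x)"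
    using w(3,4) by (auto simp: indicator_def fun_eq_iff)
  have "integrable lborel (\<lambda>x. indicator K x *\<^sub>R w x)"
    by (intro borel_integrable_compact K(1) continuous_on_subset[OF lipschitz_on_continuous_on[OF w(1)]]) simp
  then show "set_integrable lebesgue K u"
    unfolding set_integrable_def 1 by (subst integrable_completion) auto
  have 2: "(\<lambda>x. indicator K x *\<^sub>R pgrad u x) = (\<lambda>x. indicator K x *\<^sub>R pgrad w x)"
    using w(3,4) pgrad_cong_open(1)[OF w(2), of _ w u] by (auto simp: indicator_def fun_eq_iff)
  have "AE x in lborel. x \<in> K \<longrightarrow> norm (indicator K x *\<^sub>R pgrad w x) \<le> L * CARD('n)"
    using lipschitz_quotients_converge[OF w(1)]
    by eventually_elim (simp add: norm_pgrad_bound[OF w(1)])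
  then have "integrable lborel (\<lambda>x. indicator K x *\<^sub>R pgrad w x)"
    by (intro integrable_compact_support[OF _ K(1)]) auto
  then show "set_integrable lebesgue K (pgrad u)"
    unfolding set_integrable_def 2 by (subst integrable_completion) auto
qed

text \<open>Near the support of a test function \<open>u\<close> agrees with a globally Lipschitz function, for which
  integration by parts is available.\<close>

lemma locally_Lipschitz_has_weak_gradient:
  fixes u :: "real ^ 'n \<Rightarrow> real"
  assumes "open \<Omega>" "locally_Lipschitz_on \<Omega> u"
  shows "has_weak_gradient u (pgrad u) \<Omega>"
  unfolding has_weak_gradient_def
proof (intro conjI allI impI locally_integrable_locally_Lipschitz assms)
  fix \<phi> D\<phi> assume \<phi>: "test_function \<Omega> \<phi> D\<phi>"
  let ?K = "closure {x. \<phi> x \<noteq> 0}"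
  have K: "compact ?K" "?K \<subseteq> \<Omega>" using \<phi> by (auto simp: test_function_def)
  obtain L w U where w: "L-lipschitz_on UNIV w" "open U" "?K \<subseteq> U" "\<And>x. x \<in> U \<Longrightarrow> w x = u x"
    using locally_Lipschitz_on_near_compact[OF assms K] by metis
  have [measurable]: "w \<in> borel_measurable borel" "\<phi> \<in> borel_measurable borel" "D\<phi> \<in> borel_measurable borel"
    using lipschitz_borel_measurable[OF w(1)] test_function_continuous[OF \<phi>] test_function_gradient_continuous[OF \<phi>]
    by (auto intro: borel_measurable_continuous_onI)
  have \<Omega>: "\<Omega> \<inter> space lebesgue \<in> sets lebesgue" using assms(1) by simp
  have 1: "indicator \<Omega> x *\<^sub>R (u x *\<^sub>R D\<phi> x) = w x *\<^sub>R D\<phi> x" for x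
  proof (cases "x \<in> ?K")
    case True
    then have "w x = u x" "x \<in> \<Omega>" using w(3,4) K(2) by blast+
    then show ?thesis by simp
  qed (simp add: test_function_gradient_zero[OF \<phi>])
  have 2: "indicator \<Omega> x *\<^sub>R (\<phi> x *\<^sub>R pgrad u x) = \<phi> x *\<^sub>R pgrad w x" for x
  proof (cases "x \<in> ?K")
    case True
    then have "x \<in> U" "x \<in> \<Omega>" using w(3) K(2) by blast+
    then show ?thesis using pgrad_cong_open(1)[OF w(2) \<open>x \<in> U\<close> w(4)] by simp
  next
    case False
    have "\<phi> x = 0" by (rule test_function_zero[OF \<phi> False])
    then show ?thesis by simp
  qed
  note ibp = lipschitz_integration_by_parts[OF w(1) \<phi>]
  have "(LINT x|lebesgue_on \<Omega>. u x *\<^sub>R D\<phi> x) = (LINT x|lborel. w x *\<^sub>R D\<phi> x)"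
    by (subst integral_restrict_space[OF \<Omega>], subst 1, rule integral_completion) measurable
  also have "\<dots> = - (LINT x|lborel. \<phi> x *\<^sub>R pgrad w x)"
    unfolding vec_eq_iff using ibp by (simp add: integral_vec_nth(2))
  also have "(LINT x|lborel. \<phi> x *\<^sub>R pgrad w x) = (LINT x|lebesgue_on \<Omega>. \<phi> x *\<^sub>R pgrad u x)"
    by (subst integral_restrict_space[OF \<Omega>], subst 2, rule integral_completion[symmetric]) measurable
  finally show "(LINT x|lebesgue_on \<Omega>. u x *\<^sub>R D\<phi> x) = - (LINT x|lebesgue_on \<Omega>. \<phi> x *\<^sub>R pgrad u x)" .
qed

section \<open>The fundamental lemma and uniqueness of weak gradients\<close>

lemma DERIV_pos_part_square:
  "((\<lambda>s::real. (max 0 s)\<^sup>2) has_real_derivative 2 * max 0 s) (at s)"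
proof -
  consider "s > 0" | "s < 0" | "s = 0" by linarith
  then show ?thesis
  proof cases
    case 1
    have "((\<lambda>s::real. s\<^sup>2) has_real_derivative 2 * max 0 s) (at s)"
      using 1 by (auto intro!: derivative_eq_intros)
    then show ?thesis
      by (rule has_field_derivative_transform_within_open[of _ _ _ "{0<..}"]) (use 1 in auto)
  next
    case 2
    have "((\<lambda>s::real. 0) has_real_derivative 2 * max 0 s) (at s)"
      using 2 by (auto intro!: derivative_eq_intros)
    then show ?thesis
      by (rule has_field_derivative_transform_within_open[of _ _ _ "{..<0}"]) (use 2 in auto)
  next
    case 3
    have "(\<lambda>h::real. (max 0 h)\<^sup>2 / h) \<midarrow>0\<rightarrow> 0"
    proof (rule Lim_null_comparison)
      show "\<forall>\<^sub>F h::real in at 0. norm ((max 0 h)\<^sup>2 / h) \<le> \<bar>h\<bar>"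
        by (auto simp: power2_eq_square max_def intro!: always_eventually)
      show "((\<lambda>h::real. \<bar>h\<bar>) \<longlongrightarrow> 0) (at 0)" by (auto intro!: tendsto_eq_intros)
    qed
    then show ?thesis using 3 by (simp add: DERIV_def)
  qed
qed

text \<open>The function \<open>\<psi>\<close>, a product of squared positive parts, is of class C1 and positive exactly on the
  open box. The saturations \<open>j \<psi> / (1 + j \<psi>)\<close> keep these properties and increase to the indicator.\<close>

lemma test_functions_approximating_box:
  fixes a b :: "real ^ 'n"
  obtains \<phi> :: "nat \<Rightarrow> real ^ 'n \<Rightarrow> real" and D\<phi>
  where "\<And>j \<Omega>. cbox a b \<subseteq> \<Omega> \<Longrightarrow> test_function \<Omega> (\<phi> j) (D\<phi> j)"
    and "\<And>j x. 0 \<le> \<phi> j x" "\<And>j x. \<phi> j x \<le> 1" "\<And>j x. x \<notin> box a b \<Longrightarrow> \<phi> j x = 0"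
    and "\<And>x. (\<lambda>j. \<phi> j x) \<longlonglongrightarrow> indicator (box a b) x"
proof -
  define q where "q = (\<lambda>i s. (max 0 (s - a $ i))\<^sup>2 * (max 0 (b $ i - s))\<^sup>2)"
  define q' where "q' = (\<lambda>i s. 2 * max 0 (s - a $ i) * (max 0 (b $ i - s))\<^sup>2
      - (max 0 (s - a $ i))\<^sup>2 * (2 * max 0 (b $ i - s)))"
  define \<psi> where "\<psi> = (\<lambda>x::real^'n. \<Prod>i\<in>UNIV. q i (x $ i))"
  define G where "G = (\<lambda>x::real^'n. \<chi> i. q' i (x $ i) * (\<Prod>j\<in>UNIV - {i}. q j (x $ j)))"
  have q0: "q i s \<ge> 0" for i s by (simp add: q_def)
  have \<psi>0: "\<psi> x \<ge> 0" for x unfolding \<psi>_def by (intro prod_nonneg q0 ballI)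
  have dq: "(q i has_real_derivative q' i s) (at s)" for i s
  proof -
    have 1: "((\<lambda>s. (max 0 (s - a $ i))\<^sup>2) has_real_derivative 2 * max 0 (s - a $ i) * 1) (at s)"
      by (rule DERIV_chain2[OF DERIV_pos_part_square]) (auto intro!: derivative_eq_intros)
    have 2: "((\<lambda>s. (max 0 (b $ i - s))\<^sup>2) has_real_derivative 2 * max 0 (b $ i - s) * (-1)) (at s)"
      by (rule DERIV_chain2[OF DERIV_pos_part_square]) (auto intro!: derivative_eq_intros)
    show ?thesis
      unfolding q_def q'_def by (rule DERIV_cong[OF DERIV_mult[OF 1 2]]) simp
  qed
  have d\<psi>: "(\<psi> has_derivative (\<lambda>h. G x \<bullet> h)) (at x)" for x
  proof -
    have "((\<lambda>x. q i (x $ i)) has_derivative (\<lambda>h. q' i (x $ i) * h $ i)) (at x)" for i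
      by (rule has_derivative_compose[OF bounded_linear_imp_has_derivative[OF bounded_linear_vec_nth]
        dq[unfolded has_field_derivative_def]])
    then have "(\<psi> has_derivative (\<lambda>h. \<Sum>i\<in>UNIV. (q' i (x $ i) * h $ i) * (\<Prod>j\<in>UNIV - {i}. q j (x $ j)))) (at x)"
      unfolding \<psi>_def by (rule has_derivative_prod)
    then show ?thesis
      by (rule has_derivative_eq_rhs) (auto simp: G_def inner_vec_def fun_eq_iff intro!: sum.cong)
  qed
  have c\<psi>: "continuous_on UNIV \<psi>"
    by (intro continuous_at_imp_continuous_on ballI has_derivative_continuous[OF d\<psi>])
  have cG: "continuous_on UNIV G"
    unfolding G_def q_def q'_def by (intro continuous_intros)
  have supp: "\<psi> x > 0 \<longleftrightarrow> x \<in> box a b" for x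
  proof
    assume "\<psi> x > 0"
    then have "q i (x $ i) \<noteq> 0" for i
      unfolding \<psi>_def by (metis UNIV_I finite less_irrefl prod_zero)
    then show "x \<in> box a b" unfolding mem_box_cart q_def by (auto simp: max_def split: if_splits) (smt (verit))+
  next
    assume "x \<in> box a b"
    then have "0 < q i (x $ i)" for i
      unfolding q_def mem_box_cart by (intro mult_pos_pos zero_less_power) (simp_all add: less_max_iff_disj)
    then show "\<psi> x > 0" unfolding \<psi>_def by (intro prod_pos ballI)
  qed
  define \<phi> where "\<phi> = (\<lambda>j x. real j * \<psi> x / (1 + real j * \<psi> x))"
  define D\<phi> where "D\<phi> = (\<lambda>j x. (real j / (1 + real j * \<psi> x)\<^sup>2) *\<^sub>R G x)"
  have pos: "1 + real j * \<psi> x > 0" for j x using \<psi>0[of x] by (intro add_pos_nonneg) auto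
  have z: "\<phi> j x = 0" if "x \<notin> box a b" for j x
    using that supp[of x] \<psi>0[of x] by (simp add: \<phi>_def)
  show ?thesis
  proof
    fix j
    show "0 \<le> \<phi> j x" for x unfolding \<phi>_def using \<psi>0[of x] by (intro divide_nonneg_nonneg) auto
    show "\<phi> j x \<le> 1" for x unfolding \<phi>_def using pos[of j x] by (simp add: field_simps)
    show "\<phi> j x = 0" if "x \<notin> box a b" for x by (rule z[OF that])
    fix \<Omega> assume \<Omega>: "cbox a b \<subseteq> \<Omega>"
    have "closure {x. \<phi> j x \<noteq> 0} \<subseteq> cbox a b"
      using z box_subset_cbox[of a b] by (intro closure_minimal closed_cbox) blast
    moreover have "(\<phi> j has_derivative (\<lambda>h. D\<phi> j x \<bullet> h)) (at x)" for x
    proof -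
      have "((\<lambda>s. real j * s / (1 + real j * s)) has_real_derivative (real j / (1 + real j * \<psi> x)\<^sup>2)) (at (\<psi> x))"
        using pos[of j x]
        by (auto intro!: derivative_eq_intros simp: power2_eq_square field_simps)
      from has_derivative_compose[OF d\<psi> this[unfolded has_field_derivative_def]]
      show ?thesis by (simp add: \<phi>_def D\<phi>_def)
    qed
    moreover have "continuous_on UNIV (D\<phi> j)"
    proof -
      have "(1 + real j * \<psi> x)\<^sup>2 \<noteq> 0" for x using pos[of j x] by simp
      then show ?thesis unfolding D\<phi>_def by (intro continuous_intros c\<psi> cG) auto
    qed
    moreover from calculation(1) have "compact (closure {x. \<phi> j x \<noteq> 0})"
      unfolding compact_eq_bounded_closed by (intro conjI bounded_subset[OF bounded_cbox]) auto
    ultimately show "test_function \<Omega> (\<phi> j) (D\<phi> j)"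
      unfolding test_function_def using \<Omega> by blast
  next
    fix x
    show "(\<lambda>j. \<phi> j x) \<longlonglongrightarrow> indicator (box a b) x"
    proof (cases "x \<in> box a b")
      case True
      then have p: "\<psi> x > 0" using supp by simp
      have "(\<lambda>j. 1 / (1 + real j * \<psi> x)) \<longlonglongrightarrow> 0"
        by (intro real_tendsto_divide_at_top[OF tendsto_const] filterlim_tendsto_add_at_top[OF tendsto_const]
            filterlim_at_top_mult_tendsto_pos[OF tendsto_const p] filterlim_real_sequentially)
      then have "(\<lambda>j. 1 - 1 / (1 + real j * \<psi> x)) \<longlonglongrightarrow> 1 - 0" by (intro tendsto_intros)
      moreover have "1 - 1 / (1 + real j * \<psi> x) = \<phi> j x" for j
        unfolding \<phi>_def using pos[of j x] by (simp add: field_simps)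
      ultimately show ?thesis using True by simp
    qed (simp add: z)
  qed
qed

lemma AE_open_from_boxes:
  fixes \<Omega> :: "'a::euclidean_space set"
  assumes "open \<Omega>"
    and box: "\<And>a b. cbox a b \<subseteq> \<Omega> \<Longrightarrow> AE x in lebesgue. x \<in> box a b \<longrightarrow> P x"
  shows "AE x in lebesgue. x \<in> \<Omega> \<longrightarrow> P x"
proof -
  obtain D where D: "countable D" "D \<subseteq> Pow \<Omega>" "\<And>X. X \<in> D \<Longrightarrow> \<exists>a b. X = cbox a b" "\<Union>D = \<Omega>"
    using open_countable_Union_open_cbox[OF assms(1)] by metis
  have piece: "AE x in lebesgue. x \<in> X \<longrightarrow> P x" if XD: "X \<in> D" for X
  proof -
    obtain a b where X: "X = cbox a b" using D(3)[OF XD] by blast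
    have "cbox a b \<subseteq> \<Omega>" using XD D(2) X by blast
    moreover have "AE x in lebesgue. x \<notin> cbox a b - box a b"
      using negligible_frontier_interval[of a b] by (intro AE_not_in) (simp flip: negligible_iff_null_sets)
    ultimately show ?thesis using box[of a b] by (auto simp: X elim: eventually_elim2)
  qed
  have "AE x in lebesgue. \<forall>X\<in>D. x \<in> X \<longrightarrow> P x"
    unfolding AE_ball_countable[OF D(1)] by (intro ballI piece)
  then show ?thesis by eventually_elim (use D(4) in blast)
qed

text \<open>At almost every point the value is the limit of averages over small cubes.\<close>

lemma AE_nonpos_if_integral_boxes_nonpos:
  fixes h :: "'a::euclidean_space \<Rightarrow> real"
  assumes int: "h absolutely_integrable_on cbox A B"
    and nonpos: "\<And>a b. cbox a b \<subseteq> cbox A B \<Longrightarrow> integral (cbox a b) h \<le> 0"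
  shows "AE x in lebesgue. x \<in> box A B \<longrightarrow> h x \<le> 0"
proof -
  define H where "H = (\<lambda>x. if x \<in> cbox A B then h x else 0)"
  have "h integrable_on cbox A B" using int by (rule set_lebesgue_integral_eq_integral)
  then have "H integrable_on UNIV" by (simp add: H_def integrable_restrict_UNIV)
  then have "H integrable_on cbox a b" for a b by (rule integrable_on_subcbox) simp
  then obtain N where N: "negligible N"
    and lim: "\<And>x e. \<lbrakk>x \<notin> N; 0 < e\<rbrakk> \<Longrightarrow> \<exists>d>0. \<forall>r. 0 < r \<and> r < d \<longrightarrow>
        norm (integral (cbox x (x + r *\<^sub>R One)) H /\<^sub>R r ^ DIM('a) - H x) < e"
    using integrable_ccontinuous_explicit[of H] by blast
  have "h x \<le> 0" if x: "x \<notin> N" "x \<in> box A B" for x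
  proof (rule ccontr)
    assume "\<not> h x \<le> 0"
    then have hx: "H x > 0" using x(2) box_subset_cbox[of A B] by (auto simp: H_def)
    then obtain d where d: "d > 0" "\<And>r. 0 < r \<Longrightarrow> r < d \<Longrightarrow>
        norm (integral (cbox x (x + r *\<^sub>R One)) H /\<^sub>R r ^ DIM('a) - H x) < H x"
      using lim[OF x(1) hx] by blast
    have cont: "((\<lambda>r. x + r *\<^sub>R One) \<longlongrightarrow> x + 0 *\<^sub>R One) (at_right (0::real))"
      by (intro tendsto_intros)
    have "\<forall>\<^sub>F r in at_right (0::real). x + r *\<^sub>R One \<in> box A B"
      using cont x(2) by (intro topological_tendstoD[where l = x] open_box) simp_all
    moreover have "\<forall>\<^sub>F r in at_right (0::real). r < d"
      using d(1) by (rule eventually_at_right_real[THEN eventually_mono]) auto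
    moreover have "\<forall>\<^sub>F r in at_right (0::real). r > 0" by (rule eventually_at_right_less)
    ultimately have "\<forall>\<^sub>F r in at_right (0::real). x + r *\<^sub>R One \<in> box A B \<and> r < d \<and> r > 0"
      by eventually_elim simp
    then have "\<exists>r. x + r *\<^sub>R One \<in> box A B \<and> r < d \<and> r > 0"
      by (rule eventually_happens'[OF trivial_limit_at_right_real])
    then obtain r where r: "x + r *\<^sub>R One \<in> box A B" "r < d" "r > 0" by blast
    have sub: "cbox x (x + r *\<^sub>R One) \<subseteq> cbox A B"
      using x(2) r(1) unfolding subset_box mem_box by (auto intro: less_imp_le)
    have "integral (cbox x (x + r *\<^sub>R One)) H = integral (cbox x (x + r *\<^sub>R One)) h"
      by (rule integral_cong) (use sub in \<open>auto simp: H_def\<close>)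
    also have "\<dots> \<le> 0" by (rule nonpos[OF sub])
    finally have "integral (cbox x (x + r *\<^sub>R One)) H /\<^sub>R r ^ DIM('a) \<le> 0"
      using r(3) by (simp add: mult_nonneg_nonpos)
    then show False using d(2)[OF r(3,2)] by simp
  qed
  moreover have "AE x in lebesgue. x \<notin> N"
    using N by (simp add: AE_not_in negligible_iff_null_sets)
  ultimately show ?thesis by (auto elim: eventually_mono)
qed

text \<open>Testing with functions that approximate the indicator of a box shows that the integrals over boxes
  are nonpositive. The one-sided form is what the lower semicontinuity argument needs.\<close>

lemma fundamental_lemma_nonpos:
  fixes h :: "real ^ 'n \<Rightarrow> real"
  assumes "open \<Omega>" and h: "locally_integrable \<Omega> h"
    and weak: "\<And>\<phi> D\<phi>. test_function \<Omega> \<phi> D\<phi> \<Longrightarrow> (\<And>x. 0 \<le> \<phi> x) \<Longrightarrow> (LINT x|lebesgue_on \<Omega>. \<phi> x * h x) \<le> 0"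
  shows "AE x in lebesgue. x \<in> \<Omega> \<longrightarrow> h x \<le> 0"
proof (rule AE_open_from_boxes[OF assms(1)])
  fix A B assume AB: "cbox A B \<subseteq> \<Omega>"
  have int: "h absolutely_integrable_on cbox a b" if "cbox a b \<subseteq> \<Omega>" for a b
    using h that by (simp add: locally_integrable_def)
  show "AE x in lebesgue. x \<in> box A B \<longrightarrow> h x \<le> 0"
  proof (rule AE_nonpos_if_integral_boxes_nonpos[OF int[OF AB]])
    fix a b assume "cbox a b \<subseteq> cbox A B"
    then have ab: "cbox a b \<subseteq> \<Omega>" using AB by blast
    have "\<exists>\<phi> D\<phi>. (\<forall>j. test_function \<Omega> (\<phi> j) (D\<phi> j)) \<and> (\<forall>j x. 0 \<le> \<phi> j x) \<and> (\<forall>j x. \<phi> j x \<le> 1) \<and>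
      (\<forall>j x. x \<notin> box a b \<longrightarrow> \<phi> j x = 0) \<and> (\<forall>x. (\<lambda>j. \<phi> j x) \<longlonglongrightarrow> indicator (box a b) x)"
      by (rule test_functions_approximating_box[of a b]) (use ab in blast)
    then obtain \<phi> D\<phi> where \<phi>: "\<And>j. test_function \<Omega> (\<phi> j) (D\<phi> j)" "\<And>j x. 0 \<le> \<phi> j x" "\<And>j x. \<phi> j x \<le> 1"
      "\<And>j x. x \<notin> box a b \<Longrightarrow> \<phi> j x = 0" "\<And>x. (\<lambda>j. \<phi> j x) \<longlonglongrightarrow> indicator (box a b) x"
      by blast
    have ib: "set_integrable lebesgue (box a b) h"
      using int[OF ab] by (rule set_integrable_subset) (auto simp: box_subset_cbox)
    have ind: "indicator \<Omega> x *\<^sub>R (\<phi> j x * h x) = \<phi> j x * (indicator (box a b) x *\<^sub>R h x)" for j x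
      using \<phi>(4)[of x j] ab box_subset_cbox[of a b] by (auto simp: indicator_def)
    let ?h = "\<lambda>x. indicator (box a b) x *\<^sub>R h x"
    have "(\<lambda>j. LINT x|lebesgue. \<phi> j x * ?h x) \<longlonglongrightarrow>
        (LINT x|lebesgue. indicator (box a b) x * ?h x)"
    proof (rule integral_dominated_convergence[where w = "\<lambda>x. norm (?h x)"])
      show "integrable lebesgue (\<lambda>x. norm (?h x))"
        using ib unfolding set_integrable_def by (rule integrable_norm)
      have m: "(\<lambda>x. indicator (box a b) x *\<^sub>R h x) \<in> borel_measurable lebesgue"
        using ib unfolding set_integrable_def by (rule borel_measurable_integrable)
      show "(\<lambda>x. indicator (box a b) x * ?h x) \<in> borel_measurable lebesgue"
        by (intro borel_measurable_times[OF _ m] borel_measurable_indicator) simp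
      show "(\<lambda>x. \<phi> j x * ?h x) \<in> borel_measurable lebesgue" for j
        using borel_measurable_continuous_onI[OF test_function_continuous[OF \<phi>(1)[of j]]]
        by (intro borel_measurable_times[OF _ m] measurable_completion) simp
      show "AE x in lebesgue. (\<lambda>j. \<phi> j x * ?h x) \<longlonglongrightarrow> indicator (box a b) x * ?h x"
        by (intro AE_I2 tendsto_mult \<phi>(5) tendsto_const)
      show "AE x in lebesgue. norm (\<phi> j x * ?h x) \<le> norm (?h x)" for j
        using \<phi>(2,3)[of j] by (intro AE_I2) (simp add: abs_mult mult_left_le_one_le)
    qed
    moreover have "(LINT x|lebesgue. \<phi> j x * ?h x) \<le> 0" for j
    proof -
      have "\<Omega> \<inter> space lebesgue \<in> sets lebesgue" using assms(1) by simp
      from integral_restrict_space[OF this, of "\<lambda>x. \<phi> j x * h x"]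
      show ?thesis using weak[OF \<phi>(1)[of j] \<phi>(2)] by (simp only: ind)
    qed
    ultimately have "(LINT x|lebesgue. indicator (box a b) x * ?h x) \<le> 0"
      using LIMSEQ_le_const2 by blast
    also have "(\<lambda>x. indicator (box a b) x * ?h x) = (\<lambda>x. indicator (box a b) x *\<^sub>R h x)"
      by (auto simp: indicator_def)
    finally have "set_lebesgue_integral lebesgue (box a b) h \<le> 0"
      by (simp add: set_lebesgue_integral_def)
    then show "integral (cbox a b) h \<le> 0"
      using set_lebesgue_integral_eq_integral(2)[OF ib] by (simp add: integral_open_interval)
  qed
qed

lemma locally_integrable_uminus:
  "locally_integrable \<Omega> h \<Longrightarrow> locally_integrable \<Omega> (\<lambda>x. - h x :: real)"
  unfolding locally_integrable_def set_integrable_def by auto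

lemma fundamental_lemma_zero:
  fixes h :: "real ^ 'n \<Rightarrow> real"
  assumes "open \<Omega>" and h: "locally_integrable \<Omega> h"
    and weak: "\<And>\<phi> D\<phi>. test_function \<Omega> \<phi> D\<phi> \<Longrightarrow> (LINT x|lebesgue_on \<Omega>. \<phi> x * h x) = 0"
  shows "AE x in lebesgue. x \<in> \<Omega> \<longrightarrow> h x = 0"
proof -
  have "AE x in lebesgue. x \<in> \<Omega> \<longrightarrow> h x \<le> 0"
    by (rule fundamental_lemma_nonpos[OF assms(1) h]) (simp add: weak)
  moreover have "AE x in lebesgue. x \<in> \<Omega> \<longrightarrow> - h x \<le> 0"
    by (rule fundamental_lemma_nonpos[OF assms(1) locally_integrable_uminus[OF h]]) (simp add: weak)
  ultimately show ?thesis by eventually_elim auto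
qed

lemma test_function_times_integrable:
  fixes G :: "real ^ 'n \<Rightarrow> 'b::euclidean_space"
  assumes "open \<Omega>" "test_function \<Omega> \<phi> D\<phi>" and G: "locally_integrable \<Omega> G"
  shows "integrable (lebesgue_on \<Omega>) (\<lambda>x. \<phi> x *\<^sub>R G x)"
proof -
  let ?K = "closure {x. \<phi> x \<noteq> 0}"
  have K: "compact ?K" "?K \<subseteq> \<Omega>" using assms(2) by (auto simp: test_function_def)
  have i: "integrable lebesgue (\<lambda>x. indicator ?K x *\<^sub>R G x)"
    using G K by (simp add: locally_integrable_def set_integrable_def)
  obtain B where B: "\<And>x. \<bar>\<phi> x\<bar> \<le> B" using test_function_bounded[OF assms(2)] by blast
  have "integrable lebesgue (\<lambda>x. \<phi> x *\<^sub>R (indicator ?K x *\<^sub>R G x))"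
  proof (rule Bochner_Integration.integrable_bound)
    show "integrable lebesgue (\<lambda>x. B *\<^sub>R (indicator ?K x *\<^sub>R G x))" using i by (rule integrable_scaleR_right)
    have "\<phi> \<in> borel_measurable lebesgue"
      using borel_measurable_continuous_onI[OF test_function_continuous[OF assms(2)]]
      by (intro measurable_completion) simp
    then show "(\<lambda>x. \<phi> x *\<^sub>R (indicator ?K x *\<^sub>R G x)) \<in> borel_measurable lebesgue"
      by (intro borel_measurable_scaleR borel_measurable_integrable[OF i])
    show "AE x in lebesgue. norm (\<phi> x *\<^sub>R (indicator ?K x *\<^sub>R G x)) \<le> norm (B *\<^sub>R (indicator ?K x *\<^sub>R G x))"
      by (intro AE_I2) (simp only: norm_scaleR, intro mult_right_mono order_trans[OF B abs_ge_self] mult_nonneg_nonneg, auto)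
  qed
  moreover have "(\<lambda>x. \<phi> x *\<^sub>R (indicator ?K x *\<^sub>R G x)) = (\<lambda>x. indicator \<Omega> x *\<^sub>R (\<phi> x *\<^sub>R G x))"
  proof
    fix x show "\<phi> x *\<^sub>R (indicator ?K x *\<^sub>R G x) = indicator \<Omega> x *\<^sub>R (\<phi> x *\<^sub>R G x)"
  proof (cases "x \<in> ?K")
    case False
    have "\<phi> x = 0" by (rule test_function_zero[OF assms(2) False])
    then show ?thesis by simp
  next
    case True
    then have "x \<in> \<Omega>" using K by blast
    then show ?thesis using True by simp
  qed
  qed
  ultimately show ?thesis
    using assms(1) by (subst integrable_restrict_space) simp_all
qed

lemma locally_integrable_vec_nth:
  fixes G :: "real ^ 'n \<Rightarrow> real ^ 'm"
  assumes "locally_integrable \<Omega> G"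
  shows "locally_integrable \<Omega> (\<lambda>x. G x $ i)"
  unfolding locally_integrable_def set_integrable_def
proof safe
  fix K assume "compact K" "K \<subseteq> \<Omega>"
  then have "integrable lebesgue (\<lambda>x. indicator K x *\<^sub>R G x)"
    using assms by (simp add: locally_integrable_def set_integrable_def)
  from integrable_bounded_linear[OF bounded_linear_vec_nth this, of i]
  show "integrable lebesgue (\<lambda>x. indicator K x *\<^sub>R G x $ i)" by simp
qed

lemma locally_integrable_diff:
  fixes h k :: "real ^ 'n \<Rightarrow> real"
  shows "locally_integrable \<Omega> h \<Longrightarrow> locally_integrable \<Omega> k \<Longrightarrow> locally_integrable \<Omega> (\<lambda>x. h x - k x)"
  unfolding locally_integrable_def by (auto intro!: set_integral_diff)

lemma weak_gradient_unique:
  fixes u :: "real ^ 'n \<Rightarrow> real"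
  assumes "open \<Omega>" and G: "has_weak_gradient u G \<Omega>" "has_weak_gradient u G' \<Omega>"
  shows "AE x in lebesgue. x \<in> \<Omega> \<longrightarrow> G x = G' x"
proof -
  have "AE x in lebesgue. x \<in> \<Omega> \<longrightarrow> G x $ i - G' x $ i = 0" for i
  proof (rule fundamental_lemma_zero[OF assms(1)])
    have li: "locally_integrable \<Omega> G" "locally_integrable \<Omega> G'"
      using G by (auto simp: has_weak_gradient_def)
    show "locally_integrable \<Omega> (\<lambda>x. G x $ i - G' x $ i)"
      by (intro locally_integrable_diff locally_integrable_vec_nth li)
    fix \<phi> D\<phi> assume \<phi>: "test_function \<Omega> \<phi> D\<phi>"
    have "(LINT x|lebesgue_on \<Omega>. u x *\<^sub>R D\<phi> x) = - (LINT x|lebesgue_on \<Omega>. \<phi> x *\<^sub>R G x)"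
      using G(1) \<phi> unfolding has_weak_gradient_def by blast
    moreover have "(LINT x|lebesgue_on \<Omega>. u x *\<^sub>R D\<phi> x) = - (LINT x|lebesgue_on \<Omega>. \<phi> x *\<^sub>R G' x)"
      using G(2) \<phi> unfolding has_weak_gradient_def by blast
    ultimately have eq: "(LINT x|lebesgue_on \<Omega>. \<phi> x *\<^sub>R G x) = (LINT x|lebesgue_on \<Omega>. \<phi> x *\<^sub>R G' x)"
      by simp
    note i = test_function_times_integrable[OF assms(1) \<phi> li(1)] test_function_times_integrable[OF assms(1) \<phi> li(2)]
    have c: "(LINT x|lebesgue_on \<Omega>. \<phi> x * H x $ i) = (LINT x|lebesgue_on \<Omega>. \<phi> x *\<^sub>R H x) $ i"
      "integrable (lebesgue_on \<Omega>) (\<lambda>x. \<phi> x * H x $ i)"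
      if "integrable (lebesgue_on \<Omega>) (\<lambda>x. \<phi> x *\<^sub>R H x)" for H :: "real ^ 'n \<Rightarrow> real ^ 'n"
      using integral_bounded_linear[OF bounded_linear_vec_nth that, of i]
        integrable_bounded_linear[OF bounded_linear_vec_nth that, of i] by simp_all
    show "(LINT x|lebesgue_on \<Omega>. \<phi> x * (G x $ i - G' x $ i)) = 0"
      using c[OF i(1)] c[OF i(2)] eq by (simp add: right_diff_distrib)
  qed
  then have "AE x in lebesgue. \<forall>i. x \<in> \<Omega> \<longrightarrow> G x $ i - G' x $ i = 0"
    by (rule eventually_all_finite)
  then show ?thesis by eventually_elim (simp add: vec_eq_iff)
qed

lemma weak_grad_eq_pgrad:
  fixes u :: "real ^ 'n \<Rightarrow> real"
  assumes "open \<Omega>" "locally_Lipschitz_on \<Omega> u"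
  shows "AE x in lebesgue. x \<in> \<Omega> \<longrightarrow> weak_grad \<Omega> u x = pgrad u x"
proof (rule weak_gradient_unique[OF assms(1)])
  show "has_weak_gradient u (weak_grad \<Omega> u) \<Omega>"
    unfolding weak_grad_def by (rule someI[where P = "\<lambda>G. has_weak_gradient u G \<Omega>", OF locally_Lipschitz_has_weak_gradient[OF assms]])
qed (rule locally_Lipschitz_has_weak_gradient[OF assms])

section \<open>Weak limits of gradients and level sets\<close>

lemma locally_integrable_bounded:
  fixes h :: "real ^ 'n \<Rightarrow> real"
  assumes h: "h \<in> borel_measurable borel" "\<And>x. \<bar>h x\<bar> \<le> B"
  shows "locally_integrable UNIV h"
  unfolding locally_integrable_def set_integrable_def
proof safe
  fix K :: "(real ^ 'n) set" assume K: "compact K"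
  then have [measurable]: "K \<in> sets borel" by (rule borel_compact)
  note [measurable] = h(1)
  have "integrable lborel (\<lambda>x. indicator K x *\<^sub>R h x)"
    by (rule integrable_compact_support[OF _ K, where M = B]) (use h(2) in auto)
  then show "integrable lebesgue (\<lambda>x. indicator K x *\<^sub>R h x)"
    by (subst integrable_completion) auto
qed

lemma test_function_times_bounded_integrable:
  fixes h :: "real ^ 'n \<Rightarrow> real"
  assumes \<phi>: "test_function \<Omega> \<phi> D\<phi>" and h: "h \<in> borel_measurable borel" "\<And>x. \<bar>h x\<bar> \<le> B"
  shows "integrable lborel (\<lambda>x. \<phi> x * h x)"
proof -
  have [measurable]: "\<phi> \<in> borel_measurable borel" "h \<in> borel_measurable borel"
    using test_function_continuous[OF \<phi>] h(1) by (auto intro: borel_measurable_continuous_onI)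
  have "integrable (lebesgue_on UNIV) (\<lambda>x. \<phi> x *\<^sub>R h x)"
    by (rule test_function_times_integrable[OF open_UNIV test_function_mono[OF \<phi>] locally_integrable_bounded[OF h]])
  then show ?thesis by (simp add: integrable_restrict_space integrable_completion)
qed

text \<open>The tail suprema \<open>H j\<close> dominate \<open>hs k\<close> for \<open>k \<ge> j\<close>, so in the limit \<open>h\<close> is dominated by \<open>H j\<close> in the
  weak sense, hence almost everywhere.\<close>

lemma weak_limit_le_tail_supremum:
  fixes h :: "real ^ 'n \<Rightarrow> real"
  assumes m: "h \<in> borel_measurable borel" "\<And>k::nat. hs k \<in> borel_measurable borel"
    and b: "\<And>x. \<bar>h x\<bar> \<le> B" "\<And>k x. \<bar>hs k x\<bar> \<le> B"
    and weak: "\<And>\<phi> D\<phi>. test_function UNIV \<phi> D\<phi> \<Longrightarrow>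
      (\<lambda>k. LINT x|lborel. \<phi> x * hs k x) \<longlonglongrightarrow> (LINT x|lborel. \<phi> x * h x)"
  shows "AE x in lebesgue. \<forall>j e. 0 < e \<longrightarrow> (\<exists>k\<ge>j. h x - e < hs k x)"
proof -
  define H where "H = (\<lambda>j x. SUP k\<in>{j..}. hs k x)"
  have bdd: "bdd_above ((\<lambda>k. hs k x) ` {j..})" for j x
    using b(2) by (intro bdd_aboveI2[where M = B]) (meson abs_le_D1)
  have upper: "hs k x \<le> H j x" if "j \<le> k" for k j x
    unfolding H_def using that by (intro cSUP_upper bdd) auto
  have HB: "\<bar>H j x\<bar> \<le> B" for j x
  proof (rule abs_leI)
    show "H j x \<le> B" unfolding H_def using b(2) by (intro cSUP_least) (auto simp: abs_le_iff)
    show "- H j x \<le> B" using upper[of j j x] b(2)[of j x] by linarith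
  qed
  have Hm: "H j \<in> borel_measurable borel" for j
    unfolding H_def by (rule borel_measurable_cSUP) (use m(2) bdd in auto)
  have "AE x in lebesgue. x \<in> UNIV \<longrightarrow> h x - H j x \<le> 0" for j
  proof (rule fundamental_lemma_nonpos[OF open_UNIV])
    show "locally_integrable UNIV (\<lambda>x. h x - H j x)"
      by (intro locally_integrable_diff locally_integrable_bounded[where B = B] m Hm b HB)
    fix \<phi> D\<phi> assume \<phi>: "test_function (UNIV :: (real ^ 'n) set) \<phi> D\<phi>" "\<And>x. 0 \<le> \<phi> x"
    have iH: "integrable lborel (\<lambda>x. \<phi> x * H j x)"
      by (rule test_function_times_bounded_integrable[OF \<phi>(1) Hm HB])
    have ih: "integrable lborel (\<lambda>x. \<phi> x * h x)"
      by (rule test_function_times_bounded_integrable[OF \<phi>(1) m(1) b(1)])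
    have "(LINT x|lborel. \<phi> x * h x) \<le> (LINT x|lborel. \<phi> x * H j x)"
    proof (rule LIMSEQ_le_const2[OF weak[OF \<phi>(1)]], intro exI allI impI)
      fix k assume "j \<le> k"
      then show "(LINT x|lborel. \<phi> x * hs k x) \<le> (LINT x|lborel. \<phi> x * H j x)"
        by (intro integral_mono iH mult_left_mono \<phi>(2) upper
            test_function_times_bounded_integrable[OF \<phi>(1) m(2) b(2)])
    qed
    then have "(LINT x|lborel. \<phi> x * (h x - H j x)) \<le> 0"
      using iH ih by (simp add: right_diff_distrib)
    moreover have "(\<lambda>x. \<phi> x * (h x - H j x)) \<in> borel_measurable borel"
      using borel_measurable_continuous_onI[OF test_function_continuous[OF \<phi>(1)]] m(1) Hm[of j] by measurable
    ultimately show "(LINT x|lebesgue_on UNIV. \<phi> x * (h x - H j x)) \<le> 0"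
      by (simp add: integral_restrict_space integral_completion)
  qed
  then have "AE x in lebesgue. \<forall>j. x \<in> UNIV \<longrightarrow> h x - H j x \<le> 0"
    by (subst AE_all_countable) blast
  then show ?thesis
  proof eventually_elim
    case (elim x)
    show ?case
    proof (intro allI impI)
      fix j and e :: real assume "0 < e"
      then have "h x - e < H j x" using elim by (smt (verit) UNIV_I)
      then show "\<exists>k\<ge>j. h x - e < hs k x"
        unfolding H_def using less_cSUP_iff[OF _ bdd, of j "h x - e" x] by auto
    qed
  qed
qed

lemma lipschitz_pointwise_limit:
  fixes z :: "nat \<Rightarrow> 'a::metric_space \<Rightarrow> real"
  assumes "\<And>k. M-lipschitz_on UNIV (z k)" "\<And>x. (\<lambda>k. z k x) \<longlonglongrightarrow> w x"
  shows "M-lipschitz_on UNIV w"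
proof (rule lipschitz_onI)
  show "0 \<le> M" using assms(1) lipschitz_on_nonneg by blast
  fix x y
  show "dist (w x) (w y) \<le> M * dist x y"
    by (rule LIMSEQ_le_const2[OF tendsto_dist[OF assms(2) assms(2)]])
      (use lipschitz_onD[OF assms(1)] in auto)
qed

text \<open>Integration by parts moves the gradient to the test function, where pointwise convergence of the
  functions suffices; so the gradients converge weakly.\<close>

lemma pgrad_lower_limit:
  fixes z :: "nat \<Rightarrow> real ^ 'n \<Rightarrow> real"
  assumes z: "\<And>k. M-lipschitz_on UNIV (z k)" and lim: "\<And>x. (\<lambda>k. z k x) \<longlonglongrightarrow> w x"
  shows "AE x in lebesgue. \<forall>j e. 0 < e \<longrightarrow> (\<exists>k\<ge>j. \<xi> \<bullet> pgrad w x - e < \<xi> \<bullet> pgrad (z k) x)"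
proof -
  have w: "M-lipschitz_on UNIV w" by (rule lipschitz_pointwise_limit[OF z lim])
  have M0: "M \<ge> 0" using w by (rule lipschitz_on_nonneg)
  have [measurable]: "w \<in> borel_measurable borel" "z k \<in> borel_measurable borel" for k
    using lipschitz_borel_measurable[OF w] lipschitz_borel_measurable[OF z] by auto
  define B where "B = norm \<xi> * (M * CARD('n))"
  have B0: "B \<ge> 0" using M0 by (simp add: B_def)
  \<comment> \<open>The inner products with \<open>\<xi>\<close> are bounded by \<open>B\<close> almost everywhere; clipping makes this hold everywhere.\<close>
  define clip where "clip = (\<lambda>t. max (- B) (min B t))"
  have clipB: "\<bar>clip t\<bar> \<le> B" for t using B0 by (auto simp: clip_def)
  have clip_eq: "AE x in lborel. clip (\<xi> \<bullet> pgrad y x) = \<xi> \<bullet> pgrad y x" if y: "M-lipschitz_on UNIV y" for y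
    using lipschitz_quotients_converge[OF y]
  proof eventually_elim
    case (elim x)
    have "\<bar>\<xi> \<bullet> pgrad y x\<bar> \<le> norm \<xi> * norm (pgrad y x)" by (rule Cauchy_Schwarz_ineq2)
    also have "\<dots> \<le> B" unfolding B_def by (intro mult_left_mono norm_pgrad_bound(2)[OF y elim]) simp
    finally show ?case by (auto simp: clip_def)
  qed
  have inner_eq: "(LINT x|lborel. \<phi> x * clip (\<xi> \<bullet> pgrad y x)) = (\<Sum>i\<in>UNIV. \<xi> $ i * - (LINT x|lborel. y x * D\<phi> x $ i))"
    if y: "M-lipschitz_on UNIV y" and \<phi>: "test_function UNIV \<phi> D\<phi>" for y \<phi> D\<phi>
  proof -
    have [measurable]: "y \<in> borel_measurable borel" "\<phi> \<in> borel_measurable borel"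
      using lipschitz_borel_measurable[OF y] borel_measurable_continuous_onI[OF test_function_continuous[OF \<phi>]] by auto
    have "(LINT x|lborel. \<phi> x * clip (\<xi> \<bullet> pgrad y x)) = (LINT x|lborel. (\<Sum>i\<in>UNIV. \<xi> $ i * (\<phi> x * pgrad y x $ i)))"
    proof (rule integral_cong_AE)
      show "AE x in lborel. \<phi> x * clip (\<xi> \<bullet> pgrad y x) = (\<Sum>i\<in>UNIV. \<xi> $ i * (\<phi> x * pgrad y x $ i))"
        using clip_eq[OF y]
        by eventually_elim (simp add: inner_vec_def sum_distrib_left algebra_simps)
    qed (unfold clip_def, measurable)
    also have "\<dots> = (\<Sum>i\<in>UNIV. \<xi> $ i * (LINT x|lborel. \<phi> x * pgrad y x $ i))"
      using lipschitz_integration_by_parts(2)[OF y \<phi>]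
      by (subst Bochner_Integration.integral_sum) auto
    finally show ?thesis using lipschitz_integration_by_parts(3)[OF y \<phi>] by simp
  qed
  have "AE x in lebesgue. \<forall>j e. 0 < e \<longrightarrow> (\<exists>k\<ge>j. clip (\<xi> \<bullet> pgrad w x) - e < clip (\<xi> \<bullet> pgrad (z k) x))"
  proof (rule weak_limit_le_tail_supremum[where B = B])
    show "(\<lambda>x. clip (\<xi> \<bullet> pgrad w x)) \<in> borel_measurable borel"
      "(\<lambda>x. clip (\<xi> \<bullet> pgrad (z k) x)) \<in> borel_measurable borel" for k
      unfolding clip_def by measurable
    fix \<phi> D\<phi> assume \<phi>: "test_function (UNIV :: (real ^ 'n) set) \<phi> D\<phi>"
    let ?S = "closure {x. \<phi> x \<noteq> 0}"
    have "compact ?S" using \<phi> by (simp add: test_function_def)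
    then have "bounded ?S" by (rule compact_imp_bounded)
    then obtain r where r: "\<And>x. x \<in> ?S \<Longrightarrow> norm x \<le> r" unfolding bounded_iff by blast
    have "Bseq (\<lambda>k. z k 0)" using convergentI[OF lim] convergent_imp_Bseq by blast
    then obtain C where C: "\<And>k. \<bar>z k 0\<bar> \<le> C" unfolding Bseq_def by auto
    have bound: "\<bar>z k x\<bar> \<le> C + M * r" if "x \<in> ?S" for k x
    proof -
      have "\<bar>z k x - z k 0\<bar> \<le> M * norm x"
        using lipschitz_onD[OF z, of x 0 k] by (simp add: dist_real_def)
      also have "\<dots> \<le> M * r" using r[OF that] M0 by (rule mult_left_mono)
      finally show ?thesis using C[of k] by linarith
    qed
    have [measurable]: "D\<phi> \<in> borel_measurable borel"
      by (rule borel_measurable_continuous_onI[OF test_function_gradient_continuous[OF \<phi>]])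
    have "(\<lambda>k. LINT x|lborel. z k x * D\<phi> x $ i) \<longlonglongrightarrow> (LINT x|lborel. w x * D\<phi> x $ i)" for i
    proof (rule integral_dominated_convergence[where w = "\<lambda>x. (C + M * r) * norm (D\<phi> x $ i)"])
      have "integrable lborel (\<lambda>x. 1 * D\<phi> x $ i)"
        by (rule lipschitz_integration_by_parts(1)[OF lipschitz_on_constant \<phi>])
      then show "integrable lborel (\<lambda>x. (C + M * r) * norm (D\<phi> x $ i))" by simp
      show "AE x in lborel. (\<lambda>k. z k x * D\<phi> x $ i) \<longlonglongrightarrow> w x * D\<phi> x $ i"
        by (intro AE_I2 tendsto_intros lim)
      show "AE x in lborel. norm (z k x * D\<phi> x $ i) \<le> (C + M * r) * norm (D\<phi> x $ i)" for k
      proof (rule AE_I2)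
        fix x show "norm (z k x * D\<phi> x $ i) \<le> (C + M * r) * norm (D\<phi> x $ i)"
        proof (cases "x \<in> ?S")
          case True
          then show ?thesis unfolding real_norm_def abs_mult by (intro mult_right_mono bound) auto
        next
          case False
          have "D\<phi> x = 0" by (rule test_function_gradient_zero[OF \<phi> False])
          then show ?thesis by simp
        qed
      qed
    qed auto
    then show "(\<lambda>k. LINT x|lborel. \<phi> x * clip (\<xi> \<bullet> pgrad (z k) x)) \<longlonglongrightarrow> (LINT x|lborel. \<phi> x * clip (\<xi> \<bullet> pgrad w x))"
      unfolding inner_eq[OF w \<phi>] inner_eq[OF z \<phi>] by (intro tendsto_intros)
  qed (rule clipB)+
  moreover have "AE x in lebesgue. \<forall>k. clip (\<xi> \<bullet> pgrad (z k) x) = \<xi> \<bullet> pgrad (z k) x"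
    by (subst AE_all_countable) (use AE_completion[OF clip_eq[OF z]] in blast)
  ultimately show ?thesis
    using AE_completion[OF clip_eq[OF w]] by eventually_elim simp
qed

text \<open>Soft thresholding moves every value towards zero by at most \<open>\<epsilon>\<close> and is 1-Lipschitz. It turns a
  function with zero boundary values into one with compact support, and it removes a neighbourhood of
  the zero set.\<close>

definition soft_threshold :: "real \<Rightarrow> real \<Rightarrow> real"
  where "soft_threshold \<epsilon> s = max (s - \<epsilon>) 0 + min (s + \<epsilon>) 0"

lemma soft_threshold:
  assumes "\<epsilon> > 0"
  shows "\<bar>soft_threshold \<epsilon> s - soft_threshold \<epsilon> t\<bar> \<le> \<bar>s - t\<bar>"
    and "\<bar>soft_threshold \<epsilon> s - s\<bar> \<le> \<epsilon>" and "\<bar>s\<bar> < \<epsilon> \<Longrightarrow> soft_threshold \<epsilon> s = 0"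
    and "\<bar>soft_threshold \<epsilon> s\<bar> \<le> \<bar>s\<bar>"
  using assms unfolding soft_threshold_def by linarith+

text \<open>Soft thresholding at the levels \<open>1 / k\<close> gives functions that converge to \<open>z\<close> and vanish near every
  point of \<open>{z = 0}\<close>. Their gradients are zero there, and so is the weak limit of the gradients.\<close>

lemma pgrad_zero_on_zero_set:
  fixes z :: "real ^ 'n \<Rightarrow> real"
  assumes z: "L-lipschitz_on UNIV z"
  shows "AE x in lebesgue. z x = 0 \<longrightarrow> pgrad z x = 0"
proof -
  let ?w = "\<lambda>k x. soft_threshold (1 / real (Suc k)) (z x)"
  have st: "0 < 1 / real (Suc k)" for k by simp
  have lip: "L-lipschitz_on UNIV (?w k)" for k
  proof (rule lipschitz_onI)
    fix x y
    have "dist (?w k x) (?w k y) \<le> dist (z x) (z y)"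
      using soft_threshold(1)[OF st] by (simp only: dist_real_def)
    also have "\<dots> \<le> L * dist x y" by (rule lipschitz_onD[OF z]) auto
    finally show "dist (?w k x) (?w k y) \<le> L * dist x y" .
  qed (rule lipschitz_on_nonneg[OF z])
  have lim: "(\<lambda>k. ?w k x) \<longlonglongrightarrow> z x" for x
  proof (rule LIM_zero_cancel, rule Lim_null_comparison)
    show "\<forall>\<^sub>F k in sequentially. norm (?w k x - z x) \<le> 1 / real (Suc k)"
      by (intro always_eventually allI) (simp only: real_norm_def soft_threshold(2)[OF st])
  qed (rule LIMSEQ_Suc[OF lim_1_over_n])
  have flat: "pgrad (?w k) x = 0" if x: "z x = 0" for k x
  proof -
    have "open {y. \<bar>z y\<bar> < 1 / real (Suc k)}"
      by (intro open_Collect_less continuous_intros lipschitz_on_continuous_on[OF z])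
    moreover have "x \<in> {y. \<bar>z y\<bar> < 1 / real (Suc k)}" using x by simp
    moreover have "?w k y = (\<lambda>_. 0) y" if "y \<in> {y. \<bar>z y\<bar> < 1 / real (Suc k)}" for y
      using that by (intro soft_threshold(3)[OF st]) simp
    ultimately have "pgrad (?w k) x = pgrad (\<lambda>_. 0) x" by (rule pgrad_cong_open(1))
    then show ?thesis by (simp add: pgrad_def difference_quotient_def vec_eq_iff)
  qed
  have half: "AE x in lebesgue. z x = 0 \<longrightarrow> \<xi> \<bullet> pgrad z x \<le> 0" for \<xi>
    using pgrad_lower_limit[OF lip lim, of \<xi>]
  proof eventually_elim
    case (elim x)
    show ?case
    proof
      assume "z x = 0"
      have small: "\<xi> \<bullet> pgrad z x - e < 0" if e: "e > 0" for e
      proof -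
        obtain k where "\<xi> \<bullet> pgrad z x - e < \<xi> \<bullet> pgrad (?w k) x" using elim e by blast
        then show ?thesis by (simp only: flat[OF \<open>z x = 0\<close>] inner_zero_right)
      qed
      show "\<xi> \<bullet> pgrad z x \<le> 0"
      proof (rule field_le_epsilon)
        fix e :: real assume "e > 0"
        from small[OF this] show "\<xi> \<bullet> pgrad z x \<le> 0 + e" by simp
      qed
    qed
  qed
  have "AE x in lebesgue. z x = 0 \<longrightarrow> pgrad z x $ i = 0" for i
    using half[of "axis i 1"] half[of "- axis i 1"] by eventually_elim (auto simp: inner_axis')
  then have "AE x in lebesgue. \<forall>i. z x = 0 \<longrightarrow> pgrad z x $ i = 0" by (rule eventually_all_finite)
  then show ?thesis by eventually_elim (simp add: vec_eq_iff)
qed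

lemma pgrad_diff:
  assumes "quotients_converge u x" "quotients_converge v x"
  shows "quotients_converge (\<lambda>y. u y - v y) x \<and> pgrad (\<lambda>y. u y - v y) x = pgrad u x - pgrad v x"
proof (rule pgradI)
  fix i
  have "difference_quotient i (\<lambda>y. u y - v y) k x = difference_quotient i u k x - difference_quotient i v k x" for k
    by (simp add: difference_quotient_def algebra_simps)
  then show "(\<lambda>k. difference_quotient i (\<lambda>y. u y - v y) k x) \<longlonglongrightarrow> (pgrad u x - pgrad v x) $ i"
    by (simp add: tendsto_diff[OF difference_quotient_tendsto_pgrad[OF assms(1)] difference_quotient_tendsto_pgrad[OF assms(2)]])
qed

lemma locally_Lipschitz_quotients_converge:
  fixes u :: "real ^ 'n \<Rightarrow> real"
  assumes "open \<Omega>" "locally_Lipschitz_on \<Omega> u"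
  shows "AE x in lebesgue. x \<in> \<Omega> \<longrightarrow> quotients_converge u x"
proof (rule AE_open_from_boxes[OF assms(1)])
  fix a b assume ab: "cbox a b \<subseteq> \<Omega>"
  obtain L w U where w: "L-lipschitz_on UNIV w" "open U" "cbox a b \<subseteq> U" "\<And>x. x \<in> U \<Longrightarrow> w x = u x"
    using locally_Lipschitz_on_near_compact[OF assms compact_cbox ab] by metis
  show "AE x in lebesgue. x \<in> box a b \<longrightarrow> quotients_converge u x"
    using AE_completion[OF lipschitz_quotients_converge[OF w(1)]]
  proof eventually_elim
    case (elim x)
    show ?case
    proof
      assume "x \<in> box a b"
      then have "x \<in> U" using w(3) box_subset_cbox by blast
      then show "quotients_converge u x" using elim pgrad_cong_open(2)[OF w(2) \<open>x \<in> U\<close> w(4)] by simp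
    qed
  qed
qed

text \<open>This is what allows functions to be glued together: on the coincidence set, whose measure may be
  positive even if it is a boundary, the gradients agree.\<close>

lemma pgrad_eq_on_coincidence_set:
  fixes u v :: "real ^ 'n \<Rightarrow> real"
  assumes "open \<Omega>" "locally_Lipschitz_on \<Omega> u" "locally_Lipschitz_on \<Omega> v"
    and "L-lipschitz_on UNIV (\<lambda>x. u x - v x)"
  shows "AE x in lebesgue. x \<in> \<Omega> \<longrightarrow> u x = v x \<longrightarrow> pgrad u x = pgrad v x"
  using locally_Lipschitz_quotients_converge[OF assms(1,2)]
    locally_Lipschitz_quotients_converge[OF assms(1,3)] pgrad_zero_on_zero_set[OF assms(4)]
proof eventually_elim
  case (elim x)
  then show ?case using pgrad_diff[of u x v] by auto
qed

section \<open>Sobolev functions and extension by zero\<close>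

lemma locally_Lipschitz_on_continuous_on:
  assumes "open \<Omega>" "locally_Lipschitz_on \<Omega> u"
  shows "continuous_on \<Omega> u"
proof (rule continuous_at_imp_continuous_on, rule ballI)
  fix x assume x: "x \<in> \<Omega>"
  obtain r L where r: "r > 0" "L-lipschitz_on (cball x r \<inter> \<Omega>) u"
    using assms(2) x unfolding locally_Lipschitz_on_def by blast
  have "continuous_on (ball x r \<inter> \<Omega>) u"
    by (rule continuous_on_subset[OF lipschitz_on_continuous_on[OF r(2)]]) auto
  then show "isCont u x"
    using r(1) x assms(1) by (subst (asm) continuous_on_eq_continuous_at) auto
qed

lemma locally_Lipschitz_on_diff:
  fixes u v :: "'a::metric_space \<Rightarrow> real"
  assumes "locally_Lipschitz_on \<Omega> u" "locally_Lipschitz_on \<Omega> v"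
  shows "locally_Lipschitz_on \<Omega> (\<lambda>x. u x - v x)"
  unfolding locally_Lipschitz_on_def
proof
  fix x assume x: "x \<in> \<Omega>"
  obtain r L where r: "r > 0" "L-lipschitz_on (cball x r \<inter> \<Omega>) u"
    using assms(1) x unfolding locally_Lipschitz_on_def by blast
  obtain s M where s: "s > 0" "M-lipschitz_on (cball x s \<inter> \<Omega>) v"
    using assms(2) x unfolding locally_Lipschitz_on_def by blast
  have "(L + M)-lipschitz_on (cball x (min r s) \<inter> \<Omega>) (\<lambda>x. u x - v x)"
    by (intro lipschitz_on_diff lipschitz_on_subset[OF r(2)] lipschitz_on_subset[OF s(2)]) auto
  then show "\<exists>r>0. \<exists>L. L-lipschitz_on (cball x r \<inter> \<Omega>) (\<lambda>x. u x - v x)"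
    using r(1) s(1) by (intro exI[of _ "min r s"]) auto
qed

lemma lipschitz_imp_locally_Lipschitz_on:
  "L-lipschitz_on UNIV u \<Longrightarrow> locally_Lipschitz_on \<Omega> u"
  unfolding locally_Lipschitz_on_def by (meson lipschitz_on_subset subset_UNIV zero_less_one)

lemma borel_measurable_lebesgue_on_locally_Lipschitz:
  fixes u :: "real ^ 'n \<Rightarrow> real"
  assumes "open \<Omega>" "locally_Lipschitz_on \<Omega> u"
  shows "u \<in> borel_measurable (lebesgue_on \<Omega>)" "pgrad u \<in> borel_measurable (lebesgue_on \<Omega>)"
proof -
  have cont: "continuous_on \<Omega> u" by (rule locally_Lipschitz_on_continuous_on[OF assms])
  then show "u \<in> borel_measurable (lebesgue_on \<Omega>)"
    using assms(1) by (intro continuous_imp_measurable_on_sets_lebesgue) auto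
  define u0 where "u0 = (\<lambda>x. indicator \<Omega> x *\<^sub>R u x)"
  have "u0 \<in> borel_measurable borel"
    unfolding u0_def using cont assms(1) by (intro borel_measurable_continuous_on_indicator) auto
  then have "pgrad u0 \<in> borel_measurable borel" by (rule borel_measurable_pgrad)
  then have "pgrad u0 \<in> borel_measurable (lebesgue_on \<Omega>)"
    by (intro measurable_restrict_space1 measurable_completion) simp
  moreover have "pgrad u0 x = pgrad u x" if "x \<in> \<Omega>" for x
    by (rule pgrad_cong_open(1)[OF assms(1) that]) (simp add: u0_def)
  ultimately show "pgrad u \<in> borel_measurable (lebesgue_on \<Omega>)"
    by (subst measurable_cong[of _ _ "pgrad u0"]) auto
qed

abbreviation gradient_le :: "(real ^ 'n \<Rightarrow> real) \<Rightarrow> (real ^ 'n) set \<Rightarrow> real \<Rightarrow> bool"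
  where "gradient_le u A L \<equiv> AE x in lebesgue. x \<in> A \<longrightarrow> norm (pgrad u x) \<le> L"

lemma AE_lebesgue_on_open:
  "open V \<Longrightarrow> (AE x in lebesgue_on V. P x) \<longleftrightarrow> (AE x in lebesgue. x \<in> V \<longrightarrow> P x)"
  by (rule AE_restrict_space_iff) simp

text \<open>For a locally Lipschitz function membership only asks for bounds, because the weak gradient exists
  and is given pointwise.\<close>

lemma W1inf_iff:
  fixes u :: "real ^ 'n \<Rightarrow> real"
  assumes V: "open V"
  shows "u \<in> W1inf V \<longleftrightarrow> locally_Lipschitz_on V u \<and>
    (\<exists>C. AE x in lebesgue. x \<in> V \<longrightarrow> \<bar>u x\<bar> \<le> C) \<and>
    (\<exists>L. gradient_le u V L)"
proof (intro iffI conjI)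
  assume u: "u \<in> W1inf V"
  then show lip: "locally_Lipschitz_on V u" by (simp add: W1inf_def)
  show "\<exists>C. AE x in lebesgue. x \<in> V \<longrightarrow> \<bar>u x\<bar> \<le> C"
    using u by (simp add: W1inf_def Linf_def AE_lebesgue_on_open[OF V])
  obtain G L where G: "has_weak_gradient u G V" "AE x in lebesgue. x \<in> V \<longrightarrow> norm (G x) \<le> L"
    using u by (auto simp: W1inf_def Linf_def AE_lebesgue_on_open[OF V])
  have "gradient_le u V L"
    using weak_gradient_unique[OF V G(1) locally_Lipschitz_has_weak_gradient[OF V lip]] G(2)
    by eventually_elim auto
  then show "\<exists>L. gradient_le u V L" by blast
next
  assume u: "locally_Lipschitz_on V u \<and>
    (\<exists>C. AE x in lebesgue. x \<in> V \<longrightarrow> \<bar>u x\<bar> \<le> C) \<and>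
    (\<exists>L. gradient_le u V L)"
  then have "pgrad u \<in> Linf V" "u \<in> Linf V"
    using borel_measurable_lebesgue_on_locally_Lipschitz[OF V]
    by (auto simp: Linf_def AE_lebesgue_on_open[OF V])
  then show "u \<in> W1inf V"
    using u locally_Lipschitz_has_weak_gradient[OF V] by (auto simp: W1inf_def)
qed

lemma pgrad_diff_bound:
  fixes u v :: "real ^ 'n \<Rightarrow> real"
  assumes V: "open V" and lip: "locally_Lipschitz_on V u" "locally_Lipschitz_on V v"
    and "gradient_le u V L"
    and "gradient_le v V M"
  shows "gradient_le (\<lambda>y. u y - v y) V (L + M)"
  using locally_Lipschitz_quotients_converge[OF V lip(1)] locally_Lipschitz_quotients_converge[OF V lip(2)] assms(4,5)
proof eventually_elim
  case (elim x)
  show ?case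
  proof
    assume "x \<in> V"
    then have eq: "pgrad (\<lambda>y. u y - v y) x = pgrad u x - pgrad v x"
      and bounds: "norm (pgrad u x) \<le> L" "norm (pgrad v x) \<le> M"
      using elim pgrad_diff[of u x v] by auto
    show "norm (pgrad (\<lambda>y. u y - v y) x) \<le> L + M"
      unfolding eq using bounds norm_triangle_ineq4[of "pgrad u x" "pgrad v x"] by linarith
  qed
qed

lemma W1inf_diff:
  fixes u v :: "real ^ 'n \<Rightarrow> real"
  assumes V: "open V" and u: "u \<in> W1inf V" and v: "v \<in> W1inf V"
  shows "(\<lambda>x. u x - v x) \<in> W1inf V"
proof -
  obtain C L where C: "AE x in lebesgue. x \<in> V \<longrightarrow> \<bar>u x\<bar> \<le> C"
    and L: "gradient_le u V L" and lu: "locally_Lipschitz_on V u"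
    using u by (auto simp: W1inf_iff[OF V])
  obtain D M where D: "AE x in lebesgue. x \<in> V \<longrightarrow> \<bar>v x\<bar> \<le> D"
    and M: "gradient_le v V M" and lv: "locally_Lipschitz_on V v"
    using v by (auto simp: W1inf_iff[OF V])
  have "AE x in lebesgue. x \<in> V \<longrightarrow> \<bar>u x - v x\<bar> \<le> C + D"
    using C D by eventually_elim auto
  then show ?thesis
    using locally_Lipschitz_on_diff[OF lu lv] pgrad_diff_bound[OF V lu lv L M]
    by (auto simp: W1inf_iff[OF V])
qed

lemma lipschitz_in_W1inf:
  fixes u :: "real ^ 'n \<Rightarrow> real"
  assumes u: "L-lipschitz_on UNIV u" and V: "open V" "bounded V"
  shows "u \<in> W1inf V"
  unfolding W1inf_iff[OF V(1)]
proof (intro conjI)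
  show "locally_Lipschitz_on V u" using u by (rule lipschitz_imp_locally_Lipschitz_on)
  have cV: "compact (closure V)" using V(2) by simp
  obtain C where "\<forall>x\<in>closure V. norm (u x) \<le> C"
    using compact_norm_bound[OF cV continuous_on_subset[OF lipschitz_on_continuous_on[OF u] subset_UNIV]] by blast
  then have "\<bar>u x\<bar> \<le> C" if "x \<in> V" for x using that closure_subset[of V] by (auto simp: subset_eq)
  then show "\<exists>C. AE x in lebesgue. x \<in> V \<longrightarrow> \<bar>u x\<bar> \<le> C" by auto
  have "AE x in lebesgue. x \<in> V \<longrightarrow> norm (pgrad u x) \<le> L * CARD('n)"
    using AE_completion[OF lipschitz_quotients_converge[OF u]]
    by eventually_elim (simp add: norm_pgrad_bound[OF u])
  then show "\<exists>L. gradient_le u V L" by blast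
qed

text \<open>The thresholded function vanishes outside the compact set \<open>K\<close> on which the values are at least \<open>\<epsilon>\<close> in
  modulus. It is Lipschitz near \<open>K\<close>, and a point of \<open>K\<close> has a positive distance \<open>\<delta>\<close> from the complement
  of that neighbourhood, so that there the quotient is bounded by \<open>B / \<delta>\<close>.\<close>

lemma soft_threshold_zero_extension_lipschitz:
  fixes z :: "real ^ 'n \<Rightarrow> real"
  assumes V: "open V" "bounded V" and z: "locally_Lipschitz_on V z"
    and cont: "continuous_on (closure V) (\<lambda>x. if x \<in> V then z x else 0)" and "\<epsilon> > 0"
  shows "\<exists>L. L-lipschitz_on UNIV (\<lambda>x. soft_threshold \<epsilon> (if x \<in> V then z x else 0))"
proof -
  define z0 where "z0 = (\<lambda>x. if x \<in> V then z x else 0)"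
  note st = soft_threshold[OF \<open>\<epsilon> > 0\<close>]
  have cV: "compact (closure V)" using V(2) by simp
  have cont': "continuous_on (closure V) z0" using cont by (simp add: z0_def)
  define K where "K = closure V \<inter> (\<lambda>x. \<bar>z0 x\<bar>) -` {\<epsilon>..}"
  have "closed K" unfolding K_def
    by (intro continuous_closed_preimage continuous_on_rabs cont') auto
  then have K: "compact K"
    using compact_Int_closed[OF cV, of K] by (simp add: K_def Int_absorb1)
  have KV: "K \<subseteq> V" using \<open>\<epsilon> > 0\<close> by (auto simp: K_def z0_def split: if_splits)
  have out: "soft_threshold \<epsilon> (z0 x) = 0" if "x \<notin> K" for x
  proof (rule st(3))
    show "\<bar>z0 x\<bar> < \<epsilon>"
      using that closure_subset[of V] \<open>\<epsilon> > 0\<close> by (auto simp: K_def z0_def)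
  qed
  obtain M w U where w: "M-lipschitz_on UNIV w" "open U" "K \<subseteq> U" "U \<subseteq> V" "\<And>x. x \<in> U \<Longrightarrow> w x = z x"
    using locally_Lipschitz_on_near_compact[OF V(1) z K KV] by metis
  have "\<exists>\<delta>>0. \<forall>x\<in>K. \<forall>y\<in>- U. \<delta> \<le> dist x y"
    by (rule separate_compact_closed[OF K]) (use w(2,3) in auto)
  then obtain \<delta> where \<delta>: "\<delta> > 0" "\<And>x y. x \<in> K \<Longrightarrow> y \<in> - U \<Longrightarrow> \<delta> \<le> dist x y"
    by blast
  have "K \<subseteq> closure V" by (simp add: K_def)
  then obtain B where "B \<ge> 0" and B: "\<And>x. x \<in> K \<Longrightarrow> norm (z0 x) \<le> B"
    using compact_norm_bound[OF K continuous_on_subset[OF cont']] by blast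
  have M0: "M \<ge> 0" using w(1) by (rule lipschitz_on_nonneg)
  define L where "L = max M (\<bar>B\<bar> / \<delta>)"
  \<comment> \<open>A point outside \<open>U\<close> either has distance at least \<open>\<delta>\<close> from \<open>x\<close>, or both values vanish.\<close>
  have far: "\<bar>soft_threshold \<epsilon> (z0 x)\<bar> \<le> L * dist x y" if y: "y \<notin> U" for x y
  proof (cases "x \<in> K")
    case True
    have "norm (z0 x) \<le> B" by (rule B[OF True])
    then have "\<bar>soft_threshold \<epsilon> (z0 x)\<bar> \<le> \<bar>B\<bar>" using st(4)[of "z0 x"] by simp
    also have "\<bar>B\<bar> = \<bar>B\<bar> / \<delta> * \<delta>" using \<delta>(1) by simp
    also have "\<dots> \<le> L * dist x y"
      by (intro mult_mono \<delta>(2)[OF True]) (use y \<delta>(1) M0 in \<open>auto simp: L_def\<close>)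
    finally show ?thesis .
  next
    case False
    then show ?thesis using out[OF False] M0 by (simp add: L_def le_max_iff_disj)
  qed
  have "L-lipschitz_on UNIV (\<lambda>x. soft_threshold \<epsilon> (z0 x))"
  proof (rule lipschitz_onI)
    show "0 \<le> L" using M0 by (simp add: L_def)
    fix x y
    have zero: "soft_threshold \<epsilon> (z0 x) = 0" if "x \<notin> U" for x
      using that w(3) by (intro out) blast
    show "dist (soft_threshold \<epsilon> (z0 x)) (soft_threshold \<epsilon> (z0 y)) \<le> L * dist x y"
    proof (cases "x \<in> U \<and> y \<in> U")
      case True
      then have "z0 x = w x" "z0 y = w y" using w(4,5) by (auto simp: z0_def)
      then have "dist (soft_threshold \<epsilon> (z0 x)) (soft_threshold \<epsilon> (z0 y)) \<le> dist (w x) (w y)"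
        using st(1) by (simp add: dist_real_def)
      also have "\<dots> \<le> M * dist x y" by (rule lipschitz_onD[OF w(1)]) auto
      also have "\<dots> \<le> L * dist x y" by (intro mult_right_mono) (auto simp: L_def)
      finally show ?thesis .
    next
      case False
      then show ?thesis
        using far[of x y] far[of y x] zero[of x] zero[of y]
        by (auto simp: dist_real_def dist_commute)
    qed
  qed
  then show ?thesis unfolding z0_def by blast
qed

text \<open>Soft thresholding first makes the extension globally Lipschitz, with a constant that may depend on
  \<open>\<epsilon>\<close>. Since the gradient is still bounded by \<open>L\<close>, the constant improves to one determined by \<open>L\<close>, and
  \<open>\<epsilon>\<close> tends to zero.\<close>

lemma lipschitz_extension_by_zero:
  fixes z :: "real ^ 'n \<Rightarrow> real"
  assumes V: "open V" "bounded V" and z: "locally_Lipschitz_on V z"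
    and cont: "continuous_on (closure V) (\<lambda>x. if x \<in> V then z x else 0)"
    and L: "gradient_le z V L" "L \<ge> 0"
  shows "(L * CARD('n))-lipschitz_on UNIV (\<lambda>x. if x \<in> V then z x else 0)"
proof -
  define z0 where "z0 = (\<lambda>x. if x \<in> V then z x else 0)"
  have approx: "(L * CARD('n))-lipschitz_on UNIV (\<lambda>x. soft_threshold \<epsilon> (z0 x))" if eps: "\<epsilon> > 0" for \<epsilon>
  proof -
    note st = soft_threshold[OF eps]
    define y where "y = (\<lambda>x. soft_threshold \<epsilon> (z0 x))"
    obtain M where M: "M-lipschitz_on UNIV y"
      using soft_threshold_zero_extension_lipschitz[OF V z cont eps] by (auto simp: y_def z0_def)
    have "AE x in lebesgue. norm (pgrad y x) \<le> L"
      using AE_completion[OF lipschitz_quotients_converge[OF M]] pgrad_zero_on_zero_set[OF M]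
        locally_Lipschitz_quotients_converge[OF V(1) z] L(1)
    proof eventually_elim
      case (elim x)
      show ?case
      proof (cases "x \<in> V")
        case False
        then have "y x = 0" using st(3)[of 0] eps by (simp add: y_def z0_def)
        then show ?thesis using elim(2) L(2) by simp
      next
        case True
        \<comment> \<open>Thresholding need not be differentiable at \<open>z x\<close>, but it does not increase difference quotients.\<close>
        have "\<bar>pgrad y x $ i\<bar> \<le> \<bar>pgrad z x $ i\<bar>" for i
        proof (rule tendsto_le[OF sequentially_bot])
          show "(\<lambda>k. \<bar>difference_quotient i y k x\<bar>) \<longlonglongrightarrow> \<bar>pgrad y x $ i\<bar>"
            by (intro tendsto_rabs difference_quotient_tendsto_pgrad elim(1))
          have "quotients_converge z x" using elim(3) True by blast
          then have "(\<lambda>k. \<bar>difference_quotient i z k x\<bar>) \<longlonglongrightarrow> \<bar>pgrad z x $ i\<bar>"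
            by (intro tendsto_rabs difference_quotient_tendsto_pgrad)
          moreover have "\<forall>\<^sub>F k in sequentially. difference_quotient i z k x = difference_quotient i z0 k x"
            by (rule difference_quotient_eventually_cong[OF V(1) True]) (simp add: z0_def)
          then have "\<forall>\<^sub>F k in sequentially. \<bar>difference_quotient i z k x\<bar> = \<bar>difference_quotient i z0 k x\<bar>"
            by (rule eventually_mono) simp
          ultimately show "(\<lambda>k. \<bar>difference_quotient i z0 k x\<bar>) \<longlonglongrightarrow> \<bar>pgrad z x $ i\<bar>"
            by (rule Lim_transform_eventually)
          have "\<bar>difference_quotient i y k x\<bar> \<le> \<bar>difference_quotient i z0 k x\<bar>" for k
            unfolding difference_quotient_def abs_mult y_def by (intro mult_left_mono st(1)) auto
          then show "\<forall>\<^sub>F k in sequentially. \<bar>difference_quotient i y k x\<bar> \<le> \<bar>difference_quotient i z0 k x\<bar>"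
            by simp
        qed
        then have "norm (pgrad y x) \<le> norm (pgrad z x)"
          by (intro norm_le_componentwise_cart) simp
        then show ?thesis using elim(4) True by auto
      qed
    qed
    then have "AE x in lborel. norm (pgrad y x) \<le> L" by (simp add: AE_completion_iff)
    from lipschitz_from_pgrad_bound[OF M this L(2)] show ?thesis by (simp add: y_def)
  qed
  have "(L * CARD('n))-lipschitz_on UNIV z0"
  proof (rule lipschitz_onI)
    show "0 \<le> L * real CARD('n)" using L(2) by simp
    fix x y
    show "dist (z0 x) (z0 y) \<le> L * real CARD('n) * dist x y"
    proof (rule field_le_epsilon)
      fix e :: real assume "e > 0"
      then have e: "e / 2 > 0" by simp
      have "dist (soft_threshold (e/2) (z0 x)) (soft_threshold (e/2) (z0 y)) \<le> L * real CARD('n) * dist x y"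
        by (rule lipschitz_onD[OF approx[OF e]]) auto
      then show "dist (z0 x) (z0 y) \<le> L * real CARD('n) * dist x y + e"
        using soft_threshold(2)[OF e, of "z0 x"] soft_threshold(2)[OF e, of "z0 y"]
        unfolding dist_real_def by linarith
    qed
  qed
  then show ?thesis by (simp add: z0_def)
qed

section \<open>Energy bounds\<close>

definition energy_le ::
  "(real ^ 'n \<Rightarrow> real \<Rightarrow> real ^ 'n \<Rightarrow> real) \<Rightarrow> real \<Rightarrow> (real ^ 'n \<Rightarrow> real) \<Rightarrow> (real ^ 'n) set \<Rightarrow> bool"
  where "energy_le f c u A \<longleftrightarrow> (AE x in lebesgue. x \<in> A \<longrightarrow> f x (u x) (pgrad u x) \<le> c)"

text \<open>Measurability matters because the essential supremum of a non-measurable function is \<open>\<infinity>\<close> by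
  definition.\<close>

lemma measurable_supremand_compose:
  assumes f: "measurable_supremand \<Omega> f" and "V \<subseteq> \<Omega>"
    and [measurable]: "u \<in> borel_measurable (lebesgue_on V)" "G \<in> borel_measurable (lebesgue_on V)"
  shows "(\<lambda>x. f x (u x) (G x)) \<in> borel_measurable (lebesgue_on V)"
proof -
  have [measurable]: "(\<lambda>x. x) \<in> lebesgue_on V \<rightarrow>\<^sub>M lebesgue_on \<Omega>"
    using assms(2) by (intro measurable_restrict_space2 measurable_restrict_space1) (auto simp: space_restrict_space)
  have "(\<lambda>x. (x, u x, G x)) \<in> lebesgue_on V \<rightarrow>\<^sub>M lebesgue_on \<Omega> \<Otimes>\<^sub>M borel" by measurable
  from measurable_compose[OF this f[unfolded measurable_supremand_def]] show ?thesis by simp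
qed

lemma supremal_functional_le_iff:
  fixes u :: "real ^ 'n \<Rightarrow> real"
  assumes f: "measurable_supremand \<Omega> f" and V: "open V" "V \<subseteq> \<Omega>" and u: "locally_Lipschitz_on V u"
  shows "supremal_functional f u V \<le> ereal c \<longleftrightarrow> energy_le f c u V"
proof -
  note m = borel_measurable_lebesgue_on_locally_Lipschitz[OF V(1) u]
  have eq: "AE x in lebesgue. x \<in> V \<longrightarrow> weak_grad V u x = pgrad u x"
    by (rule weak_grad_eq_pgrad[OF V(1) u])
  have V': "V \<inter> space lebesgue \<in> sets lebesgue" using V(1) by simp
  have "(\<lambda>x. indicator V x *\<^sub>R weak_grad V u x) \<in> borel_measurable lebesgue"
  proof (rule borel_measurable_AE)
    show "(\<lambda>x. indicator V x *\<^sub>R pgrad u x) \<in> borel_measurable lebesgue"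
      using m(2) unfolding borel_measurable_restrict_space_iff[OF V'] .
    show "AE x in lebesgue. indicator V x *\<^sub>R pgrad u x = indicator V x *\<^sub>R weak_grad V u x"
      using eq by eventually_elim (auto simp: indicator_def)
  qed
  then have "weak_grad V u \<in> borel_measurable (lebesgue_on V)"
    unfolding borel_measurable_restrict_space_iff[OF V'] .
  then have meas: "(\<lambda>x. ereal (f x (u x) (weak_grad V u x))) \<in> borel_measurable (lebesgue_on V)"
    by (intro borel_measurable_ereal measurable_supremand_compose[OF f V(2) m(1)])
  have "supremal_functional f u V \<le> ereal c \<longleftrightarrow>
      (AE x in lebesgue_on V. ereal (f x (u x) (weak_grad V u x)) \<le> ereal c)"
  proof
    assume le: "supremal_functional f u V \<le> ereal c"
    show "AE x in lebesgue_on V. ereal (f x (u x) (weak_grad V u x)) \<le> ereal c"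
      by (rule eventually_mono[OF esssup_AE]) (erule order_trans[OF _ le[unfolded supremal_functional_def]])
  qed (unfold supremal_functional_def, rule esssup_I[OF meas])
  also have "\<dots> \<longleftrightarrow> (AE x in lebesgue. x \<in> V \<longrightarrow> f x (u x) (weak_grad V u x) \<le> c)"
    by (simp add: AE_lebesgue_on_open[OF V(1)])
  also have "\<dots> \<longleftrightarrow> energy_le f c u V"
    unfolding energy_le_def using eq by (intro eventually_cong) auto
  finally show ?thesis .
qed

lemma energy_le_mono:
  "energy_le f c u A \<Longrightarrow> c \<le> d \<Longrightarrow> B \<subseteq> A \<Longrightarrow> energy_le f d u B"
  unfolding energy_le_def by (auto elim: eventually_mono)

lemma energy_le_countable_UN:
  fixes A :: "nat \<Rightarrow> (real ^ 'n) set"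
  assumes "\<And>k. energy_le f c u (A k)"
  shows "energy_le f c u (\<Union>k. A k)"
proof -
  have "AE x in lebesgue. \<forall>k. x \<in> A k \<longrightarrow> f x (u x) (pgrad u x) \<le> c"
    by (subst AE_all_countable) (use assms in \<open>simp add: energy_le_def\<close>)
  then show ?thesis unfolding energy_le_def by eventually_elim auto
qed

section \<open>Limits in quasiconvex sublevel sets\<close>

lemma lower_semicont_sequentially:
  assumes "lower_semicont h" "z \<longlonglongrightarrow> l" "\<And>k::nat. h (z k) \<le> c"
  shows "h l \<le> c"
proof (rule ccontr)
  assume "\<not> h l \<le> c"
  then have "eventually (\<lambda>w. c < h w) (nhds l)"
    using assms(1) by (simp add: lower_semicont_def)
  then have "\<forall>\<^sub>F k in sequentially. c < h (z k)"
    using assms(2) by (rule eventually_compose_filterlim)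
  then have "\<forall>\<^sub>F k in sequentially. False" by eventually_elim (use assms(3) leD in blast)
  then show False by simp
qed

text \<open>The hypothesis on \<open>P\<close> says that in every direction \<open>\<xi>\<close>, up to \<open>e\<close>, some late \<open>p k\<close> reaches as far as
  \<open>P\<close>. If \<open>P\<close> were outside the closed convex sublevel set, a hyperplane would separate it; a limit
  point of the \<open>p k\<close> that reach as far as \<open>P\<close> in almost the normal direction belongs to the sublevel
  set by semicontinuity and lies on the wrong side.\<close>

lemma quasiconvex_sublevel_limit:
  fixes F :: "real \<Rightarrow> 'a::euclidean_space \<Rightarrow> real"
  assumes lsc: "lower_semicont (\<lambda>(s, p). F s p)" and qc: "quasiconvex (F s)"
    and bnd: "\<And>k::nat. norm (p k) \<le> R" and \<sigma>: "\<sigma> \<longlonglongrightarrow> s" and le: "\<And>k. F (\<sigma> k) (p k) \<le> c"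
    and dense: "\<And>U. open U \<Longrightarrow> U \<noteq> {} \<Longrightarrow> \<exists>\<xi>\<in>Q. \<xi> \<in> U"
    and tail: "\<And>\<xi> e j. \<xi> \<in> Q \<Longrightarrow> e > 0 \<Longrightarrow> \<exists>k\<ge>j. \<xi> \<bullet> P - e < \<xi> \<bullet> p k"
  shows "F s P \<le> c"
proof (rule ccontr)
  assume not: "\<not> F s P \<le> c"
  define S where "S = {q. F s q \<le> c}"
  have lim: "F s q \<le> c" if "t \<longlonglongrightarrow> s" "r \<longlonglongrightarrow> q" "\<And>k::nat. F (t k) (r k) \<le> c" for t r q
  proof -
    have "(\<lambda>k. (t k, r k)) \<longlonglongrightarrow> (s, q)" by (rule tendsto_Pair[OF that(1,2)])
    from lower_semicont_sequentially[OF lsc this, of c] that(3) show ?thesis by simp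
  qed
  have "convex S"
  proof (rule convexI)
    fix x y and u v :: real
    assume xy: "x \<in> S" "y \<in> S" and uv: "0 \<le> u" "0 \<le> v" "u + v = 1"
    have "F s (u *\<^sub>R x + (1 - u) *\<^sub>R y) \<le> max (F s x) (F s y)"
      using qc uv unfolding quasiconvex_def by simp
    moreover have "1 - u = v" using uv by simp
    ultimately show "u *\<^sub>R x + v *\<^sub>R y \<in> S" using xy by (auto simp: S_def)
  qed
  moreover have "closed S"
    unfolding closed_sequential_limits S_def using lim[OF tendsto_const] by blast
  moreover have "P \<notin> S" using not by (simp add: S_def)
  ultimately obtain a b where ab: "a \<bullet> P < b" "\<And>q. q \<in> S \<Longrightarrow> b < a \<bullet> q"
    using separating_hyperplane_closed_point[of S P] by blast
  define \<delta> where "\<delta> = b - a \<bullet> P"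
  have \<delta>: "\<delta> > 0" using ab(1) by (simp add: \<delta>_def)
  have R0: "R \<ge> 0" using bnd[of 0] norm_ge_zero order_trans by blast
  define N where "N = R + norm P + 1"
  have N: "N > 0" using R0 by (simp add: N_def add_nonneg_pos)
  have "\<delta> / (2 * N) > 0" using \<delta> N by simp
  then have "ball (- a) (\<delta> / (2 * N)) \<noteq> {}" by (simp add: not_le)
  then obtain \<xi> where \<xi>: "\<xi> \<in> Q" "\<xi> \<in> ball (- a) (\<delta> / (2 * N))"
    using dense[OF open_ball] by blast
  have "\<forall>j. \<exists>k\<ge>j. \<xi> \<bullet> P - \<delta> / 2 < \<xi> \<bullet> p k" using tail[OF \<xi>(1)] \<delta> by simp
  then obtain \<kappa> where \<kappa>: "\<And>j. j \<le> \<kappa> j" "\<And>j. \<xi> \<bullet> P - \<delta> / 2 < \<xi> \<bullet> p (\<kappa> j)" by metis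
  have "\<forall>j. p (\<kappa> j) \<in> cball 0 R" using bnd by simp
  then obtain q r where q: "q \<in> cball 0 R" "strict_mono r" "((\<lambda>j. p (\<kappa> j)) \<circ> r) \<longlonglongrightarrow> q"
    using compact_cball[of "0::'a" R] unfolding compact_def by metis
  have "filterlim (\<lambda>j. \<kappa> (r j)) at_top sequentially"
  proof (rule filterlim_at_top_mono[OF filterlim_subseq[OF q(2)]])
    show "\<forall>\<^sub>F j in sequentially. r j \<le> \<kappa> (r j)" using \<kappa>(1) by simp
  qed
  then have "(\<lambda>j. \<sigma> (\<kappa> (r j))) \<longlonglongrightarrow> s" by (rule filterlim_compose[OF \<sigma>])
  then have "F s q \<le> c" using q(3) le by (intro lim[of "\<lambda>j. \<sigma> (\<kappa> (r j))" "\<lambda>j. p (\<kappa> (r j))"]) (auto simp: o_def)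
  then have aq: "b < a \<bullet> q" by (intro ab(2)) (simp add: S_def)
  have "(\<lambda>j. \<xi> \<bullet> p (\<kappa> (r j))) \<longlonglongrightarrow> \<xi> \<bullet> q" using q(3) by (intro tendsto_intros) (simp add: o_def)
  then have xq: "\<xi> \<bullet> P - \<delta> / 2 \<le> \<xi> \<bullet> q"
    by (rule LIMSEQ_le_const) (use \<kappa>(2) less_imp_le in blast)
  have "(\<xi> + a) \<bullet> (q - P) = (\<xi> \<bullet> q - \<xi> \<bullet> P) + (a \<bullet> q - a \<bullet> P)"
    by (simp add: inner_simps)
  moreover have "- (\<delta> / 2) \<le> \<xi> \<bullet> q - \<xi> \<bullet> P" using xq by linarith
  moreover have "\<delta> < a \<bullet> q - a \<bullet> P" using aq by (simp add: \<delta>_def)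
  ultimately have "\<delta> / 2 < (\<xi> + a) \<bullet> (q - P)" by linarith
  also have "\<dots> \<le> norm (\<xi> + a) * norm (q - P)" by (rule norm_cauchy_schwarz)
  also have "\<dots> \<le> (\<delta> / (2 * N)) * N"
  proof (rule mult_mono)
    have "norm (\<xi> + a) = dist (- a) \<xi>" by (simp add: dist_norm norm_minus_commute add.commute)
    then show "norm (\<xi> + a) \<le> \<delta> / (2 * N)" using \<xi>(2) by simp
    show "norm (q - P) \<le> N" using norm_triangle_ineq4[of q P] q(1) by (simp add: N_def)
  qed (use \<delta> N in auto)
  also have "\<dots> = \<delta> / 2" using N by simp
  finally show False by simp
qed

section \<open>Directed families of functions\<close>

text \<open>On a countable dense set the supremum is approached by countably many members; their successive
  maxima increase to a function that is maximal on the dense set, and so everywhere by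
  equicontinuity.\<close>

lemma directed_family_supremum:
  fixes \<F> :: "('a::euclidean_space \<Rightarrow> real) set"
  assumes "\<F> \<noteq> {}"
    and lip: "\<And>u. u \<in> \<F> \<Longrightarrow> M-lipschitz_on UNIV (\<lambda>x. u x - h x)"
    and max: "\<And>u v. u \<in> \<F> \<Longrightarrow> v \<in> \<F> \<Longrightarrow> (\<lambda>x. max (u x) (v x)) \<in> \<F>"
    and bdd: "\<And>x. bdd_above ((\<lambda>u. u x) ` \<F>)"
  obtains b s where "\<And>k::nat. b k \<in> \<F>" "\<And>k x. b k x \<le> b (Suc k) x" "\<And>x. (\<lambda>k. b k x) \<longlonglongrightarrow> s x"
    "\<And>u x. u \<in> \<F> \<Longrightarrow> u x \<le> s x"
proof -
  obtain Q :: "'a set" where Q: "countable Q" "\<And>U. open U \<Longrightarrow> U \<noteq> {} \<Longrightarrow> \<exists>q\<in>Q. q \<in> U"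
    using countable_dense_setE by metis
  have Qne: "Q \<noteq> {}" using Q(2)[OF open_UNIV] by blast
  define S where "S = (\<lambda>x. SUP u\<in>\<F>. u x)"
  have upper: "u x \<le> S x" if "u \<in> \<F>" for u x unfolding S_def using that by (intro cSUP_upper bdd)
  have "\<exists>u\<in>\<F>. S x - 1 / real (Suc m) < u x" for x m
    using less_cSUP_iff[OF \<open>\<F> \<noteq> {}\<close> bdd, of "S x - 1 / real (Suc m)" x] by (simp add: S_def)
  then obtain W where W: "\<And>x m. W x m \<in> \<F>" "\<And>x m. S x - 1 / real (Suc m) < W x m x" by metis
  \<comment> \<open>An enumeration of all pairs of a dense point and a precision \<open>1 / (m + 1)\<close>.\<close>
  define e where "e = from_nat_into (Q \<times> (UNIV :: nat set))"
  have e: "range e = Q \<times> UNIV"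
    unfolding e_def using Q(1) Qne by (intro range_from_nat_into) auto
  define a where "a = (\<lambda>k. W (fst (e k)) (snd (e k)))"
  define b where "b = rec_nat (a 0) (\<lambda>k v x. max (v x) (a (Suc k) x))"
  have b0: "b 0 = a 0" and bS: "b (Suc k) = (\<lambda>x. max (b k x) (a (Suc k) x))" for k
    by (simp_all add: b_def)
  have bF: "b k \<in> \<F>" for k
    by (induction k) (auto simp: b0 bS a_def intro!: max W)
  have ab: "a k x \<le> b k x" for k x by (cases k) (simp_all add: b0 bS)
  have mono: "b k x \<le> b (Suc k) x" for k x by (simp add: bS)
  have inc: "incseq (\<lambda>k. b k x)" for x by (rule incseq_SucI) (rule mono)
  have bddb: "bdd_above (range (\<lambda>k. b k x))" for x
    using upper[OF bF] by (intro bdd_aboveI2) 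
  define s where "s = (\<lambda>x. SUP k. b k x)"
  have lim: "(\<lambda>k. b k x) \<longlonglongrightarrow> s x" for x
    unfolding s_def by (rule LIMSEQ_incseq_SUP[OF bddb inc])
  have slip: "M-lipschitz_on UNIV (\<lambda>x. s x - h x)"
    by (rule lipschitz_pointwise_limit[of M "\<lambda>k x. b k x - h x"]) (auto intro!: lip bF tendsto_intros lim)
  have ge: "u x \<le> s x" if u: "u \<in> \<F>" for u x
  proof -
    have atQ: "u q \<le> s q" if q: "q \<in> Q" for q
    proof (rule field_le_epsilon)
      fix \<epsilon> :: real assume "\<epsilon> > 0"
      then obtain m where m: "1 / real (Suc m) < \<epsilon>" using nat_approx_posE by blast
      obtain k where k: "e k = (q, m)" using e q by (metis SigmaI UNIV_I rangeE)
      have "u q \<le> S q" by (rule upper[OF u])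
      also have "S q < a k q + 1 / real (Suc m)" using W(2)[of q m] by (simp add: a_def k)
      also have "a k q \<le> s q" using ab[of k q] cSUP_upper[OF _ bddb, of k q] by (simp add: s_def)
      finally show "u q \<le> s q + \<epsilon>" using m by linarith
    qed
    have "closed {x. u x - h x \<le> s x - h x}"
      by (intro closed_Collect_le lipschitz_on_continuous_on[OF slip] lipschitz_on_continuous_on[OF lip[OF u]])
    then have "open (- {x. u x - h x \<le> s x - h x})" by (rule open_Compl)
    then have "- {x. u x - h x \<le> s x - h x} = {}" using Q(2) atQ by fastforce
    then show ?thesis by auto
  qed
  show ?thesis using that[of b s] bF mono lim ge by blast
qed

section \<open>Competitors\<close>

text \<open>All functions of the Perron argument differ from the datum by a globally Lipschitz function. This
  is an equivalence relation stable under maxima and minima, and it avoids any mention of boundaries.\<close>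

definition lipschitz_close :: "('a::metric_space \<Rightarrow> real) \<Rightarrow> ('a \<Rightarrow> real) \<Rightarrow> bool"
  where "lipschitz_close u v \<longleftrightarrow> (\<exists>M. M-lipschitz_on UNIV (\<lambda>x. u x - v x))"

lemma lipschitz_close_refl [simp]: "lipschitz_close u u"
  unfolding lipschitz_close_def by (auto intro!: exI[of _ 0] lipschitz_on_constant)

lemma lipschitz_close_sym:
  assumes "lipschitz_close u v" shows "lipschitz_close v u"
proof -
  obtain M where "M-lipschitz_on UNIV (\<lambda>x. u x - v x)"
    using assms unfolding lipschitz_close_def by blast
  then have "M-lipschitz_on UNIV (\<lambda>x. - (u x - v x))" by (rule lipschitz_on_minus)
  then show ?thesis unfolding lipschitz_close_def by auto
qed

lemma lipschitz_close_trans: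
  assumes "lipschitz_close u v" "lipschitz_close v w"
  shows "lipschitz_close u w"
proof -
  obtain M N where "M-lipschitz_on UNIV (\<lambda>x. u x - v x)" "N-lipschitz_on UNIV (\<lambda>x. v x - w x)"
    using assms unfolding lipschitz_close_def by blast
  from lipschitz_on_add[OF this] show ?thesis unfolding lipschitz_close_def by auto
qed

lemma lipschitz_close_max_min:
  assumes u: "lipschitz_close u h" and v: "lipschitz_close v h"
  shows "lipschitz_close (\<lambda>x. max (u x) (v x)) h" "lipschitz_close (\<lambda>x. min (u x) (v x)) h"
proof -
  obtain M N where M: "M-lipschitz_on UNIV (\<lambda>x. u x - h x)" and N: "N-lipschitz_on UNIV (\<lambda>x. v x - h x)"
    using u v unfolding lipschitz_close_def by blast
  have bound: "\<bar>(u x - h x) - (u y - h y)\<bar> \<le> max M N * dist x y"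
    "\<bar>(v x - h x) - (v y - h y)\<bar> \<le> max M N * dist x y" for x y
    using lipschitz_onD[OF lipschitz_on_mono[OF M, of UNIV "max M N"], of x y]
      lipschitz_onD[OF lipschitz_on_mono[OF N, of UNIV "max M N"], of x y]
    by (auto simp: dist_real_def)
  have pos: "0 \<le> max M N" using lipschitz_on_nonneg[OF M] by simp
  have "dist (max (u x) (v x) - h x) (max (u y) (v y) - h y) \<le> max M N * dist x y"
    "dist (min (u x) (v x) - h x) (min (u y) (v y) - h y) \<le> max M N * dist x y" for x y
    using bound[of x y] unfolding dist_real_def by linarith+
  then show "lipschitz_close (\<lambda>x. max (u x) (v x)) h" "lipschitz_close (\<lambda>x. min (u x) (v x)) h"
    unfolding lipschitz_close_def using pos by (auto intro!: exI[of _ "max M N"] lipschitz_onI)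
qed

lemma lipschitz_close_continuous: "lipschitz_close u v \<Longrightarrow> continuous_on UNIV (\<lambda>x. u x - v x)"
  unfolding lipschitz_close_def using lipschitz_on_continuous_on by blast

lemma open_less_if_lipschitz_close:
  assumes "lipschitz_close u v" shows "open {x. u x < v x}"
proof -
  have "open {x. u x - v x < 0}"
    by (intro open_Collect_less lipschitz_close_continuous[OF assms] continuous_on_const)
  then show ?thesis by simp
qed

lemma energy_le_Un:
  assumes "energy_le f c u A" "energy_le f c u B"
  shows "energy_le f c u (A \<union> B)"
  using assms unfolding energy_le_def by eventually_elim auto

locale supremal_problem =
  fixes \<Omega> :: "(real ^ 'n) set"
    and f :: "real ^ 'n \<Rightarrow> real \<Rightarrow> real ^ 'n \<Rightarrow> real"
    and g :: "real ^ 'n \<Rightarrow> real"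
  assumes open_domain: "open \<Omega>" and bounded_domain: "bounded \<Omega>"
    and H1: "H1 \<Omega> f" and H2: "H2 \<Omega> f" and boundary_datum: "g \<in> W1inf \<Omega>"
begin

lemma locally_Lipschitz_if_close: "lipschitz_close u g \<Longrightarrow> locally_Lipschitz_on \<Omega> u"
proof -
  assume "lipschitz_close u g"
  then obtain M where "M-lipschitz_on UNIV (\<lambda>x. g x - u x)"
    using lipschitz_close_sym unfolding lipschitz_close_def by blast
  then have "locally_Lipschitz_on \<Omega> (\<lambda>x. g x - (g x - u x))"
    using boundary_datum
    by (intro locally_Lipschitz_on_diff[OF _ lipschitz_imp_locally_Lipschitz_on]) (simp_all add: W1inf_def)
  then show ?thesis by simp
qed

lemma pgrad_eq_AE_if_close:
  assumes "lipschitz_close u g" "lipschitz_close v g"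
  shows "AE x in lebesgue. x \<in> \<Omega> \<longrightarrow> u x = v x \<longrightarrow> pgrad u x = pgrad v x"
proof -
  have "lipschitz_close u v" using assms lipschitz_close_sym lipschitz_close_trans by blast
  then obtain M where "M-lipschitz_on UNIV (\<lambda>x. u x - v x)" unfolding lipschitz_close_def by blast
  then show ?thesis
    by (intro pgrad_eq_on_coincidence_set open_domain locally_Lipschitz_if_close assms)
qed

lemma energy_le_coincide:
  assumes u: "energy_le f c u A" and "lipschitz_close u g" "lipschitz_close v g" and A: "A \<subseteq> \<Omega>"
    and eq: "\<And>x. x \<in> A \<Longrightarrow> v x = u x"
  shows "energy_le f c v A"
  using u pgrad_eq_AE_if_close[OF assms(2,3)] unfolding energy_le_def
proof eventually_elim
  case (elim x)
  then show ?case using A eq[of x] by auto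
qed

lemma energy_le_gradient_bound:
  "\<exists>R\<ge>0. \<forall>u A. energy_le f c u A \<longrightarrow> A \<subseteq> \<Omega> \<longrightarrow> (gradient_le u A R)"
proof -
  obtain R where R: "R \<ge> 0" "\<And>x s. x \<in> \<Omega> \<Longrightarrow> {p. f x s p \<le> c} \<subseteq> ball 0 R"
    using H2 unfolding H2_def by blast
  have bound: "norm p \<le> R" if "x \<in> \<Omega>" "f x s p \<le> c" for x s p
  proof -
    have "p \<in> ball 0 R" using R(2)[OF that(1)] that(2) by blast
    then show ?thesis by simp
  qed
  have "gradient_le u A R" if en: "energy_le f c u A" and A: "A \<subseteq> \<Omega>" for u A
    using en unfolding energy_le_def
  proof eventually_elim
    case (elim x)
    then show ?case using bound A by blast
  qed
  then show ?thesis using R(1) by blast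
qed

text \<open>Lower semicontinuity. At almost every point the gradients of the sequence lie in the sublevel sets
  of \<open>f x (us k x)\<close>, they are bounded by \<open>H2\<close>, and in each direction of a countable dense set the
  gradient of the limit does not exceed their tail suprema.\<close>

lemma energy_le_pointwise_limit:
  assumes V: "open V" "V \<subseteq> \<Omega>"
    and lip: "\<And>k::nat. M-lipschitz_on UNIV (\<lambda>x. us k x - g x)" and lim: "\<And>x. (\<lambda>k. us k x) \<longlonglongrightarrow> u x"
    and en: "\<And>k. energy_le f c (us k) V"
  shows "energy_le f c u V"
proof -
  obtain R where R: "\<And>u A. energy_le f c u A \<Longrightarrow> A \<subseteq> \<Omega> \<Longrightarrow> gradient_le u A R"
    using energy_le_gradient_bound[of c] by blast
  obtain Q :: "(real ^ 'n) set" where Q: "countable Q" "\<And>U. open U \<Longrightarrow> U \<noteq> {} \<Longrightarrow> \<exists>q\<in>Q. q \<in> U"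
    using countable_dense_setE by metis
  let ?z = "\<lambda>k x. us k x - g x" and ?w = "\<lambda>x. u x - g x"
  have limz: "(\<lambda>k. ?z k x) \<longlonglongrightarrow> ?w x" for x by (intro tendsto_intros lim)
  have wlip: "M-lipschitz_on UNIV ?w" by (rule lipschitz_pointwise_limit[OF lip limz])
  have close: "lipschitz_close (us k) g" "lipschitz_close u g" for k
    using lip wlip unfolding lipschitz_close_def by blast+
  have cq: "AE x in lebesgue. x \<in> \<Omega> \<longrightarrow> quotients_converge y x" if "lipschitz_close y g" for y
    by (rule locally_Lipschitz_quotients_converge[OF open_domain locally_Lipschitz_if_close[OF that]])
  have all_conv: "AE x in lebesgue. \<forall>k. x \<in> \<Omega> \<longrightarrow> quotients_converge (us k) x"
    by (subst AE_all_countable) (use cq[OF close(1)] in blast)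
  have all_bound: "AE x in lebesgue. \<forall>k. x \<in> V \<longrightarrow> norm (pgrad (us k) x) \<le> R"
    by (subst AE_all_countable) (use R[OF en V(2)] in blast)
  have all_en: "AE x in lebesgue. \<forall>k. x \<in> V \<longrightarrow> f x (us k x) (pgrad (us k) x) \<le> c"
    by (subst AE_all_countable) (use en in \<open>simp add: energy_le_def\<close>)
  have all_tail: "AE x in lebesgue. \<forall>\<xi>\<in>Q. \<forall>j e. 0 < e \<longrightarrow> (\<exists>k\<ge>j. \<xi> \<bullet> pgrad ?w x - e < \<xi> \<bullet> pgrad (?z k) x)"
    unfolding AE_ball_countable[OF Q(1)] by (intro ballI pgrad_lower_limit[OF lip limz])
  have lsc: "AE x in lebesgue. x \<in> \<Omega> \<longrightarrow> lower_semicont (\<lambda>(s, p). f x s p)"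
    using H1 by (simp add: H1_def AE_lebesgue_on_open[OF open_domain])
  show ?thesis
    unfolding energy_le_def
    using all_conv all_bound all_en all_tail lsc cq[OF lipschitz_close_refl] cq[OF close(2)]
  proof eventually_elim
    case (elim x)
    show ?case
    proof
      assume x: "x \<in> V"
      then have x\<Omega>: "x \<in> \<Omega>" using V(2) by blast
      have gz: "pgrad (?z k) x = pgrad (us k) x - pgrad g x" for k
        using pgrad_diff[of "us k" x g] elim(1,6) x\<Omega> by blast
      have gw: "pgrad ?w x = pgrad u x - pgrad g x"
        using pgrad_diff[of u x g] elim(6,7) x\<Omega> by blast
      show "f x (u x) (pgrad u x) \<le> c"
      proof (rule quasiconvex_sublevel_limit[where F = "f x" and p = "\<lambda>k. pgrad (us k) x" and \<sigma> = "\<lambda>k. us k x" and Q = Q])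
        show "lower_semicont (\<lambda>(s, p). f x s p)" using elim(5) x\<Omega> by blast
        show "quasiconvex (f x (u x))" using H1 x\<Omega> by (simp add: H1_def)
        show "norm (pgrad (us k) x) \<le> R" for k using elim(2) x by blast
        show "(\<lambda>k. us k x) \<longlonglongrightarrow> u x" by (rule lim)
        show "f x (us k x) (pgrad (us k) x) \<le> c" for k using elim(3) x by blast
        show "\<exists>\<xi>\<in>Q. \<xi> \<in> U" if "open U" "U \<noteq> {}" for U using Q(2) that by blast
        fix \<xi> :: "real ^ 'n" and e :: real and j :: nat
        assume "\<xi> \<in> Q" "e > 0"
        then obtain k where k: "k \<ge> j" "\<xi> \<bullet> pgrad ?w x - e < \<xi> \<bullet> pgrad (?z k) x"
          using elim(4) by blast
        have "\<xi> \<bullet> pgrad u x - e < \<xi> \<bullet> pgrad (us k) x"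
          using k(2) unfolding gz gw inner_diff_right by linarith
        then show "\<exists>k\<ge>j. \<xi> \<bullet> pgrad u x - e < \<xi> \<bullet> pgrad (us k) x" using k(1) by blast
      qed
    qed
  qed
qed

text \<open>Two cases occur: \<open>h\<close> is the datum \<open>g\<close> and \<open>V\<close> the whole domain, or \<open>h\<close> is a candidate for the absolute
  minimizer and \<open>V\<close> a set on which it is modified. Prescribing \<open>u = h\<close> off \<open>V\<close> encodes the boundary
  condition.\<close>

definition competitors :: "(real ^ 'n \<Rightarrow> real) \<Rightarrow> (real ^ 'n) set \<Rightarrow> real \<Rightarrow> (real ^ 'n \<Rightarrow> real) set"
  where "competitors h V c = {u. lipschitz_close u h \<and> (\<forall>x. x \<notin> V \<longrightarrow> u x = h x) \<and> energy_le f c u V}"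

definition admissible_base :: "(real ^ 'n \<Rightarrow> real) \<Rightarrow> (real ^ 'n) set \<Rightarrow> bool"
  where "admissible_base h V \<longleftrightarrow> open V \<and> V \<subseteq> \<Omega> \<and> lipschitz_close h g \<and>
    (\<exists>L. gradient_le h V L)"

lemma competitors_close:
  assumes "admissible_base h V" "u \<in> competitors h V c"
  shows "lipschitz_close u g"
  using assms lipschitz_close_trans unfolding admissible_base_def competitors_def by blast

text \<open>On \<open>V\<close> the gradient of \<open>u - h\<close> is bounded in terms of \<open>c\<close> and \<open>h\<close>, and off \<open>V\<close> it vanishes almost
  everywhere because \<open>u - h\<close> does.\<close>

lemma competitors_equi_lipschitz:
  assumes h: "admissible_base h V"
  shows "\<exists>M. \<forall>u\<in>competitors h V c. M-lipschitz_on UNIV (\<lambda>x. u x - h x)"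
proof -
  obtain L0 where L0: "gradient_le h V L0"
    using h unfolding admissible_base_def by blast
  obtain R where R: "R \<ge> 0" "\<And>u A. energy_le f c u A \<Longrightarrow> A \<subseteq> \<Omega> \<Longrightarrow> gradient_le u A R"
    using energy_le_gradient_bound[of c] by blast
  define L where "L = R + max L0 0"
  have V: "open V" "V \<subseteq> \<Omega>" and hg: "lipschitz_close h g" using h by (auto simp: admissible_base_def)
  have "(L * CARD('n))-lipschitz_on UNIV (\<lambda>x. u x - h x)" if u: "u \<in> competitors h V c" for u
  proof -
    have ug: "lipschitz_close u g" by (rule competitors_close[OF h u])
    obtain M where M: "M-lipschitz_on UNIV (\<lambda>x. u x - h x)"
      using u unfolding competitors_def lipschitz_close_def by blast
    have h0: "gradient_le h V (max L0 0)"
      using L0 by eventually_elim auto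
    have Ru: "gradient_le u V R"
      using u V(2) by (intro R(2)) (auto simp: competitors_def)
    have "gradient_le (\<lambda>y. u y - h y) V L"
      unfolding L_def
      by (intro pgrad_diff_bound[OF V(1) _ _ Ru h0] locally_Lipschitz_on_subset[OF locally_Lipschitz_if_close V(2)] ug hg)
    then have "AE x in lebesgue. norm (pgrad (\<lambda>y. u y - h y) x) \<le> L"
      using pgrad_zero_on_zero_set[OF M]
    proof eventually_elim
      case (elim x)
      show ?case
      proof (cases "x \<in> V")
        case False
        then have "u x - h x = 0" using u by (simp add: competitors_def)
        then show ?thesis using elim(2) R(1) by (simp add: L_def)
      qed (use elim(1) in blast)
    qed
    then have "AE x in lborel. norm (pgrad (\<lambda>y. u y - h y) x) \<le> L" by (simp add: AE_completion_iff)
    then show ?thesis by (rule lipschitz_from_pgrad_bound[OF M]) (use R(1) in \<open>simp add: L_def\<close>)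
  qed
  then show ?thesis by blast
qed

lemma competitors_bounded:
  assumes h: "admissible_base h V"
  shows "\<exists>B. \<forall>u\<in>competitors h V c. \<bar>u x\<bar> \<le> B"
proof -
  obtain M where M: "\<And>u. u \<in> competitors h V c \<Longrightarrow> M-lipschitz_on UNIV (\<lambda>x. u x - h x)"
    using competitors_equi_lipschitz[OF h] by blast
  have "bounded V" using h bounded_domain bounded_subset by (auto simp: admissible_base_def)
  then have "V \<noteq> UNIV" using not_bounded_UNIV by metis
  \<comment> \<open>All competitors agree at a point outside the bounded set \<open>V\<close>, which makes them locally bounded.\<close>
  then obtain x0 where x0: "x0 \<notin> V" by blast
  have "\<bar>u x\<bar> \<le> \<bar>h x\<bar> + M * dist x x0" if u: "u \<in> competitors h V c" for u
    using lipschitz_onD[OF M[OF u], of x x0] u x0 by (simp add: competitors_def dist_real_def)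
  then show ?thesis by blast
qed

lemma competitors_max_min:
  assumes h: "admissible_base h V" and u: "u \<in> competitors h V c" and v: "v \<in> competitors h V c"
  shows "(\<lambda>x. max (u x) (v x)) \<in> competitors h V c" "(\<lambda>x. min (u x) (v x)) \<in> competitors h V c"
proof -
  have V: "V \<subseteq> \<Omega>" and hg: "lipschitz_close h g" using h by (auto simp: admissible_base_def)
  have close: "lipschitz_close u h" "lipschitz_close v h" using u v by (auto simp: competitors_def)
  note cg = competitors_close[OF h u] competitors_close[OF h v]
  have en: "energy_le f c w V" if w: "lipschitz_close w h" "\<And>x. w x = u x \<or> w x = v x" for w
  proof -
    have wg: "lipschitz_close w g" using w(1) hg by (rule lipschitz_close_trans)
    have 1: "energy_le f c w {x \<in> V. w x = u x}"
    proof (rule energy_le_coincide[OF _ cg(1) wg])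
      show "energy_le f c u {x \<in> V. w x = u x}"
        by (rule energy_le_mono[of f c u V]) (use u in \<open>auto simp: competitors_def\<close>)
    qed (use V in auto)
    have 2: "energy_le f c w {x \<in> V. w x = v x}"
    proof (rule energy_le_coincide[OF _ cg(2) wg])
      show "energy_le f c v {x \<in> V. w x = v x}"
        by (rule energy_le_mono[of f c v V]) (use v in \<open>auto simp: competitors_def\<close>)
    qed (use V in auto)
    have "{x \<in> V. w x = u x} \<union> {x \<in> V. w x = v x} = V" using w(2) by blast
    then show ?thesis using energy_le_Un[OF 1 2] by simp
  qed
  show "(\<lambda>x. max (u x) (v x)) \<in> competitors h V c"
    using lipschitz_close_max_min(1)[OF close] u v
    by (auto simp: competitors_def intro!: en split: split_max)
  show "(\<lambda>x. min (u x) (v x)) \<in> competitors h V c"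
    using lipschitz_close_max_min(2)[OF close] u v
    by (auto simp: competitors_def intro!: en split: split_min)
qed

lemma competitors_limit:
  assumes h: "admissible_base h V" and us: "\<And>k::nat. us k \<in> competitors h V c"
    and lim: "\<And>x. (\<lambda>k. us k x) \<longlonglongrightarrow> u x"
  shows "u \<in> competitors h V c"
proof -
  obtain M where M: "\<And>u. u \<in> competitors h V c \<Longrightarrow> M-lipschitz_on UNIV (\<lambda>x. u x - h x)"
    using competitors_equi_lipschitz[OF h] by blast
  have V: "open V" "V \<subseteq> \<Omega>" using h by (auto simp: admissible_base_def)
  obtain N where N: "N-lipschitz_on UNIV (\<lambda>x. h x - g x)"
    using h unfolding admissible_base_def lipschitz_close_def by blast
  have "M-lipschitz_on UNIV (\<lambda>x. u x - h x)"
    by (rule lipschitz_pointwise_limit[where z = "\<lambda>k x. us k x - h x"]) (intro M us tendsto_intros lim)+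
  moreover have "u x = h x" if "x \<notin> V" for x
    using LIMSEQ_unique[OF lim[of x], of "h x"] us that by (simp add: competitors_def)
  moreover have "energy_le f c u V"
  proof (rule energy_le_pointwise_limit[OF V _ lim])
    show "(M + N)-lipschitz_on UNIV (\<lambda>x. us k x - g x)" for k
      using lipschitz_on_add[OF M[OF us] N] by simp
    show "energy_le f c (us k) V" for k using us by (simp add: competitors_def)
  qed
  ultimately show ?thesis by (auto simp: competitors_def lipschitz_close_def)
qed

lemma greatest_competitor:
  assumes h: "admissible_base h V" and S: "S \<subseteq> competitors h V c" "S \<noteq> {}"
    and max: "\<And>u v. u \<in> S \<Longrightarrow> v \<in> S \<Longrightarrow> (\<lambda>x. max (u x) (v x)) \<in> S"
    and lim: "\<And>us u. (\<And>k::nat. us k \<in> S) \<Longrightarrow> (\<And>k x. us k x \<le> us (Suc k) x) \<Longrightarrow>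
      (\<And>x. (\<lambda>k. us k x) \<longlonglongrightarrow> u x) \<Longrightarrow> u \<in> S"
  obtains s where "s \<in> S" "\<And>u x. u \<in> S \<Longrightarrow> u x \<le> s x"
proof -
  obtain M where M: "\<And>u. u \<in> competitors h V c \<Longrightarrow> M-lipschitz_on UNIV (\<lambda>x. u x - h x)"
    using competitors_equi_lipschitz[OF h] by blast
  have bdd: "bdd_above ((\<lambda>u. u x) ` S)" for x
  proof -
    obtain B where "\<And>u. u \<in> competitors h V c \<Longrightarrow> \<bar>u x\<bar> \<le> B" using competitors_bounded[OF h] by blast
    then show ?thesis using S(1) by (intro bdd_aboveI2[where M = B]) (meson abs_le_D1 subsetD)
  qed
  have "\<exists>b s. (\<forall>k. b k \<in> S) \<and> (\<forall>k x. b k x \<le> b (Suc k) x) \<and> (\<forall>x. (\<lambda>k. b k x) \<longlonglongrightarrow> s x) \<and> (\<forall>u\<in>S. \<forall>x. u x \<le> s x)"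
  proof (rule directed_family_supremum[of S M h])
    show "S \<noteq> {}" by (rule S(2))
    show "M-lipschitz_on UNIV (\<lambda>x. u x - h x)" if "u \<in> S" for u using that S(1) by (intro M) blast
    show "(\<lambda>x. max (u x) (v x)) \<in> S" if "u \<in> S" "v \<in> S" for u v by (rule max[OF that])
    show "bdd_above ((\<lambda>u. u x) ` S)" for x by (rule bdd)
  qed blast
  then obtain b s where "\<And>k. b k \<in> S" "\<And>k x. b k x \<le> b (Suc k) x" "\<And>x. (\<lambda>k. b k x) \<longlonglongrightarrow> s x"
    "\<And>u x. u \<in> S \<Longrightarrow> u x \<le> s x" by blast
  with lim[of b s] that show ?thesis by blast
qed

lemma least_competitor:
  assumes h: "admissible_base h V" and S: "S \<subseteq> competitors h V c" "S \<noteq> {}"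
    and min: "\<And>u v. u \<in> S \<Longrightarrow> v \<in> S \<Longrightarrow> (\<lambda>x. min (u x) (v x)) \<in> S"
    and lim: "\<And>us u. (\<And>k::nat. us k \<in> S) \<Longrightarrow> (\<And>x. (\<lambda>k. us k x) \<longlonglongrightarrow> u x) \<Longrightarrow> u \<in> S"
  obtains s where "s \<in> S" "\<And>u x. u \<in> S \<Longrightarrow> s x \<le> u x"
proof -
  obtain M where M: "\<And>u. u \<in> competitors h V c \<Longrightarrow> M-lipschitz_on UNIV (\<lambda>x. u x - h x)"
    using competitors_equi_lipschitz[OF h] by blast
  let ?neg = "\<lambda>u x. - u x :: real"
  have bdd: "bdd_above ((\<lambda>u. u x) ` ?neg ` S)" for x
  proof -
    obtain B where "\<And>u. u \<in> competitors h V c \<Longrightarrow> \<bar>u x\<bar> \<le> B" using competitors_bounded[OF h] by blast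
    then have "- u x \<le> B" if "u \<in> S" for u using S(1) that by (meson abs_le_D2 subsetD)
    then show ?thesis by (auto intro!: bdd_aboveI[where M = B])
  qed
  have "\<exists>b s. (\<forall>k. b k \<in> ?neg ` S) \<and> (\<forall>x. (\<lambda>k. b k x) \<longlonglongrightarrow> s x) \<and> (\<forall>u\<in>?neg ` S. \<forall>x. u x \<le> s x)"
  proof (rule directed_family_supremum[of "?neg ` S" M "?neg h"])
    show "?neg ` S \<noteq> {}" using S(2) by simp
    show "M-lipschitz_on UNIV (\<lambda>x. u x - - h x)" if u: "u \<in> ?neg ` S" for u
    proof -
      obtain v where v: "v \<in> S" "u = ?neg v" using u by blast
      have "M-lipschitz_on UNIV (\<lambda>x. - (v x - h x))"
        using v(1) S(1) by (intro lipschitz_on_minus M) blast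
      then show ?thesis by (simp add: v(2))
    qed
    show "(\<lambda>x. max (u x) (v x)) \<in> ?neg ` S" if u: "u \<in> ?neg ` S" and v: "v \<in> ?neg ` S" for u v
    proof -
      obtain u' v' where uv: "u' \<in> S" "u = ?neg u'" "v' \<in> S" "v = ?neg v'" using u v by blast
      have "(\<lambda>x. max (u x) (v x)) = ?neg (\<lambda>x. min (u' x) (v' x))" by (auto simp: uv)
      then show ?thesis using imageI[OF min[OF uv(1,3)], of ?neg] by simp
    qed
    show "bdd_above ((\<lambda>u. u x) ` ?neg ` S)" for x by (rule bdd)
  qed blast
  then obtain b s where "\<forall>k. b k \<in> ?neg ` S" "\<forall>x. (\<lambda>k. b k x) \<longlonglongrightarrow> s x"
    "\<forall>u\<in>?neg ` S. \<forall>x. u x \<le> s x" by (elim exE conjE) (rule that)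
  note b = this[rule_format]
  have "?neg (b k) \<in> S" for k
  proof -
    obtain u where "u \<in> S" "b k = ?neg u" using b(1)[of k] by (elim imageE) (rule that)
    then show ?thesis by simp
  qed
  moreover have "(\<lambda>k. ?neg (b k) x) \<longlonglongrightarrow> ?neg s x" for x by (intro tendsto_intros b)
  ultimately have "?neg s \<in> S" by (rule lim)
  moreover have "?neg s x \<le> u x" if "u \<in> S" for u x
    using b(3)[OF imageI[OF that], of x] by simp
  ultimately show ?thesis using that by blast
qed

section \<open>Perron argument\<close>

text \<open>The subminimizing property in terms of functions on the whole space. A comparison set together with
  boundary values on it is encoded by the single function \<open>v\<close>, the set being \<open>{v < u}\<close>.\<close>

definition subminimal :: "(real ^ 'n \<Rightarrow> real) \<Rightarrow> bool"
  where "subminimal u \<longleftrightarrow> (\<forall>v c. lipschitz_close v u \<longrightarrow> (\<forall>x. v x \<le> u x) \<longrightarrow>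
    closure {x. v x < u x} \<subseteq> \<Omega> \<longrightarrow> energy_le f c v {x. v x < u x} \<longrightarrow> energy_le f c u {x. v x < u x})"

definition superminimal :: "(real ^ 'n \<Rightarrow> real) \<Rightarrow> bool"
  where "superminimal u \<longleftrightarrow> (\<forall>v c. lipschitz_close v u \<longrightarrow> (\<forall>x. u x \<le> v x) \<longrightarrow>
    closure {x. u x < v x} \<subseteq> \<Omega> \<longrightarrow> energy_le f c v {x. u x < v x} \<longrightarrow> energy_le f c u {x. u x < v x})"

text \<open>The comparison function may exceed \<open>u\<close> in places: only its part below \<open>u\<close> is compared.\<close>

lemma subminimalD:
  assumes "subminimal u" "lipschitz_close v u" "closure A \<subseteq> \<Omega>" "{x. v x < u x} \<subseteq> A"
    and "lipschitz_close u g" and "energy_le f c v {x. v x < u x}"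
  shows "energy_le f c u {x. v x < u x}"
proof -
  let ?m = "\<lambda>x. min (v x) (u x)"
  have set: "{x. ?m x < u x} = {x. v x < u x}" by auto
  have vg: "lipschitz_close v g" using assms(2,5) by (rule lipschitz_close_trans)
  have mu: "lipschitz_close ?m u" using assms(2) by (intro lipschitz_close_max_min) simp_all
  have sub: "closure {x. v x < u x} \<subseteq> \<Omega>" using closure_mono[OF assms(4)] assms(3) by blast
  have "energy_le f c ?m {x. v x < u x}"
  proof (rule energy_le_coincide[OF assms(6) vg])
    show "lipschitz_close ?m g" using mu assms(5) by (rule lipschitz_close_trans)
    show "{x. v x < u x} \<subseteq> \<Omega>" by (rule order_trans[OF closure_subset sub])
  qed auto
  then show ?thesis
    using assms(1)[unfolded subminimal_def, rule_format, of ?m c] mu sub by (simp add: set)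
qed

text \<open>If \<open>v\<close> is a comparison function for the maximum, its parts below \<open>u\<close> and below \<open>w\<close> are comparison
  functions for \<open>u\<close> and \<open>w\<close>, and the two comparison sets cover the original one.\<close>

lemma subminimal_max:
  assumes u: "subminimal u" "lipschitz_close u g" and w: "subminimal w" "lipschitz_close w g"
  shows "subminimal (\<lambda>x. max (u x) (w x))"
  unfolding subminimal_def
proof (intro allI impI)
  let ?m = "\<lambda>x. max (u x) (w x)"
  fix v c
  assume v: "lipschitz_close v ?m" "\<forall>x. v x \<le> ?m x" "closure {x. v x < ?m x} \<subseteq> \<Omega>"
    and en: "energy_le f c v {x. v x < ?m x}"
  have mg: "lipschitz_close ?m g" using u(2) w(2) by (rule lipschitz_close_max_min)
  have vg: "lipschitz_close v g" using v(1) mg by (rule lipschitz_close_trans)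
  have sub: "{x. v x < ?m x} \<subseteq> \<Omega>" by (rule order_trans[OF closure_subset v(3)])
  have part: "energy_le f c ?m {x. v x < y x \<and> ?m x = y x}"
    if y: "subminimal y" "lipschitz_close y g" "\<And>x. y x \<le> ?m x" for y
  proof -
    have subset: "{x. v x < y x} \<subseteq> {x. v x < ?m x}" using y(3) less_le_trans by blast
    have "energy_le f c y {x. v x < y x}"
    proof (rule subminimalD[OF y(1) _ v(3) subset y(2)])
      show "lipschitz_close v y" using vg y(2) lipschitz_close_sym lipschitz_close_trans by blast
      show "energy_le f c v {x. v x < y x}" by (rule energy_le_mono[OF en order_refl subset])
    qed
    then have "energy_le f c y {x. v x < y x \<and> ?m x = y x}" by (rule energy_le_mono) auto
    then show ?thesis by (rule energy_le_coincide[OF _ y(2) mg]) (use subset sub in auto)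
  qed
  have "energy_le f c ?m ({x. v x < u x \<and> ?m x = u x} \<union> {x. v x < w x \<and> ?m x = w x})"
    by (intro energy_le_Un part u w) auto
  then show "energy_le f c ?m {x. v x < ?m x}"
    by (rule energy_le_mono) (auto simp: max_def)
qed

text \<open>A comparison function \<open>v\<close> for the limit is one for each \<open>us k\<close> on \<open>{v < us k}\<close>. These open sets
  exhaust \<open>{v < u}\<close>, and on each of them the energy bound holds for all later members, hence for the
  limit.\<close>

lemma subminimal_increasing_limit:
  assumes h: "admissible_base h V" and us: "\<And>k::nat. us k \<in> competitors h V d" "\<And>k. subminimal (us k)"
    and inc: "\<And>k x. us k x \<le> us (Suc k) x" and lim: "\<And>x. (\<lambda>k. us k x) \<longlonglongrightarrow> u x"
  shows "subminimal u"
  unfolding subminimal_def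
proof (intro allI impI)
  fix v c
  assume v: "lipschitz_close v u" "\<forall>x. v x \<le> u x" "closure {x. v x < u x} \<subseteq> \<Omega>"
    and en: "energy_le f c v {x. v x < u x}"
  have uc: "u \<in> competitors h V d" by (rule competitors_limit[OF h us(1) lim])
  have ug: "lipschitz_close u g" by (rule competitors_close[OF h uc])
  have usg: "lipschitz_close (us k) g" for k by (rule competitors_close[OF h us(1)])
  have vg: "lipschitz_close v g" using v(1) ug by (rule lipschitz_close_trans)
  have vus: "lipschitz_close v (us k)" for k
    using vg usg[of k] lipschitz_close_sym lipschitz_close_trans by blast
  obtain M where M: "\<forall>u\<in>competitors h V d. M-lipschitz_on UNIV (\<lambda>x. u x - h x)"
    using competitors_equi_lipschitz[OF h] by blast
  obtain N where N: "N-lipschitz_on UNIV (\<lambda>x. h x - g x)"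
    using h unfolding admissible_base_def lipschitz_close_def by blast
  have lip: "(M + N)-lipschitz_on UNIV (\<lambda>x. us k x - g x)" for k
    using lipschitz_on_add[OF M[rule_format, OF us(1)] N] by simp
  have incseq: "incseq (\<lambda>k. us k x)" for x by (rule incseq_SucI) (rule inc)
  have le: "us k x \<le> u x" for k x by (rule incseq_le[OF incseq lim])
  let ?A = "\<lambda>k. {x. v x < us k x}"
  have sub: "?A k \<subseteq> {x. v x < u x}" for k using le less_le_trans by blast
  have enk: "energy_le f c (us k) (?A k)" for k
  proof (rule subminimalD[OF us(2) vus v(3) sub usg])
    show "energy_le f c v (?A k)" by (rule energy_le_mono[OF en order_refl sub])
  qed
  have "energy_le f c u (?A k)" for k
  proof (rule energy_le_pointwise_limit)
    show "open (?A k)" by (rule open_less_if_lipschitz_close[OF vus])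
    show "?A k \<subseteq> \<Omega>" using sub[of k] v(3) closure_subset by blast
    show "(M + N)-lipschitz_on UNIV (\<lambda>x. us (j + k) x - g x)" for j by (rule lip)
    show "(\<lambda>j. us (j + k) x) \<longlonglongrightarrow> u x" for x by (rule LIMSEQ_ignore_initial_segment[OF lim])
    show "energy_le f c (us (j + k)) (?A k)" for j
    proof (rule energy_le_mono[OF enk order_refl])
      show "?A k \<subseteq> ?A (j + k)"
      proof
        fix x assume "x \<in> ?A k"
        then show "x \<in> ?A (j + k)" using incseqD[OF incseq[of x], of k "j + k"] by simp
      qed
    qed
  qed
  then have "energy_le f c u (\<Union>k. ?A k)" by (rule energy_le_countable_UN)
  moreover have "{x. v x < u x} \<subseteq> (\<Union>k. ?A k)"
  proof
    fix x assume "x \<in> {x. v x < u x}"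
    then have "\<forall>\<^sub>F k in sequentially. v x < us k x" using order_tendstoD(1)[OF lim] by simp
    then show "x \<in> (\<Union>k. ?A k)" by (auto simp: eventually_sequentially)
  qed
  ultimately show "energy_le f c u {x. v x < u x}" by (rule energy_le_mono[OF _ order_refl])
qed

lemma admissible_base_g: "admissible_base g \<Omega>"
  unfolding admissible_base_def
  using open_domain boundary_datum by (simp add: W1inf_iff[OF open_domain])

text \<open>The least competitor is subminimal: a comparison function with energy bound \<open>c < c\<^sub>0\<close> below it is
  again a competitor, so it cannot be strictly smaller anywhere. For \<open>c \<ge> c\<^sub>0\<close> the bound is inherited
  from the whole domain.\<close>

lemma exists_subminimal_competitor:
  assumes ne: "competitors g \<Omega> c\<^sub>0 \<noteq> {}"
  obtains u where "u \<in> competitors g \<Omega> c\<^sub>0" "subminimal u"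
proof -
  note h = admissible_base_g
  have "\<exists>s\<in>competitors g \<Omega> c\<^sub>0. \<forall>u\<in>competitors g \<Omega> c\<^sub>0. \<forall>x. s x \<le> u x"
  proof (rule least_competitor[OF h order_refl ne])
    show "(\<lambda>x. min (u x) (v x)) \<in> competitors g \<Omega> c\<^sub>0"
      if "u \<in> competitors g \<Omega> c\<^sub>0" "v \<in> competitors g \<Omega> c\<^sub>0" for u v
      by (rule competitors_max_min(2)[OF h that])
    show "u \<in> competitors g \<Omega> c\<^sub>0"
      if "\<And>k::nat. us k \<in> competitors g \<Omega> c\<^sub>0" "\<And>x. (\<lambda>k. us k x) \<longlonglongrightarrow> u x" for us u
      by (rule competitors_limit[OF h that])
  qed blast
  then obtain u where u: "u \<in> competitors g \<Omega> c\<^sub>0" "\<And>w x. w \<in> competitors g \<Omega> c\<^sub>0 \<Longrightarrow> u x \<le> w x" by blast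
  have ug: "lipschitz_close u g" and u0: "\<And>x. x \<notin> \<Omega> \<Longrightarrow> u x = g x" and enu: "energy_le f c\<^sub>0 u \<Omega>"
    using u(1) by (auto simp: competitors_def)
  have "subminimal u"
    unfolding subminimal_def
  proof (intro allI impI)
    fix v c
    let ?V = "{x. v x < u x}"
    assume v: "lipschitz_close v u" "\<forall>x. v x \<le> u x" "closure ?V \<subseteq> \<Omega>" and en: "energy_le f c v ?V"
    have sub: "?V \<subseteq> \<Omega>" by (rule order_trans[OF closure_subset v(3)])
    show "energy_le f c u ?V"
    proof (cases "c\<^sub>0 \<le> c")
      case True
      then show ?thesis by (rule energy_le_mono[OF enu _ sub])
    next
      case False
      have vg: "lipschitz_close v g" using v(1) ug by (rule lipschitz_close_trans)
      have "energy_le f c\<^sub>0 v ?V" by (rule energy_le_mono[OF en]) (use False in auto)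
      moreover have "energy_le f c\<^sub>0 v (\<Omega> - ?V)"
      proof (rule energy_le_coincide[OF _ ug vg])
        show "energy_le f c\<^sub>0 u (\<Omega> - ?V)" by (rule energy_le_mono[OF enu order_refl]) auto
        show "v x = u x" if "x \<in> \<Omega> - ?V" for x using that v(2)[rule_format, of x] by auto
      qed auto
      ultimately have "energy_le f c\<^sub>0 v (?V \<union> (\<Omega> - ?V))" by (rule energy_le_Un)
      then have "energy_le f c\<^sub>0 v \<Omega>" by (rule energy_le_mono) auto
      moreover have "v x = g x" if "x \<notin> \<Omega>" for x
        using that sub u0[OF that] v(2)[rule_format, of x] by force
      ultimately have "v \<in> competitors g \<Omega> c\<^sub>0" using vg by (simp add: competitors_def)
      \<comment> \<open>Leastness leaves no point with \<open>v < u\<close>.\<close>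
      then have "?V = {}" using u(2) by (auto simp: not_less)
      then show ?thesis by (simp add: energy_le_def)
    qed
  qed
  with u(1) show ?thesis using that by blast
qed

text \<open>Let \<open>b\<close> be the least function above \<open>s\<close> that agrees with \<open>s\<close> off \<open>{s < v}\<close> and has energy at most \<open>c\<close>
  there. The point is that \<open>b\<close> is subminimal, which forces \<open>b = s\<close>. For a comparison function \<open>w\<close> below
  \<open>b\<close>, the part of \<open>{w < b}\<close> where \<open>w < s\<close> is controlled by the subminimality of \<open>s\<close>. On the rest a
  bound \<open>d < c\<close> would make \<open>max w s\<close> admissible in the definition of \<open>b\<close>, and leastness shows that then
  \<open>b = s\<close> on \<open>{w < b}\<close>, so that there is no rest.\<close>

lemma greatest_subminimal_is_superminimal:
  assumes s: "s \<in> competitors g \<Omega> c\<^sub>0" "subminimal s"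
    and greatest: "\<And>u x. u \<in> competitors g \<Omega> c\<^sub>0 \<Longrightarrow> subminimal u \<Longrightarrow> u x \<le> s x"
  shows "superminimal s"
  unfolding superminimal_def
proof (intro allI impI)
  fix v c
  let ?V = "{x. s x < v x}"
  assume v: "lipschitz_close v s" "\<forall>x. s x \<le> v x" "closure ?V \<subseteq> \<Omega>" and en: "energy_le f c v ?V"
  have sg: "lipschitz_close s g" and s0: "\<And>x. x \<notin> \<Omega> \<Longrightarrow> s x = g x" and ens: "energy_le f c\<^sub>0 s \<Omega>"
    using s(1) by (auto simp: competitors_def)
  have sub: "?V \<subseteq> \<Omega>" by (rule order_trans[OF closure_subset v(3)])
  show "energy_le f c s ?V"
  proof (cases "c\<^sub>0 \<le> c")
    case True
    then show ?thesis by (rule energy_le_mono[OF ens _ sub])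
  next
    case False
    obtain R where "gradient_le s ?V R"
      using energy_le_gradient_bound[of c\<^sub>0] energy_le_mono[OF ens order_refl sub] sub by blast
    then have h: "admissible_base s ?V"
      unfolding admissible_base_def
      using open_less_if_lipschitz_close[OF lipschitz_close_sym[OF v(1)]] sub sg by blast
    let ?S = "{w \<in> competitors s ?V c. \<forall>x. s x \<le> w x}"
    have vS: "v \<in> ?S"
      using v(1,2) en by (auto simp: competitors_def intro: antisym)
    have "\<exists>b\<in>?S. \<forall>w\<in>?S. \<forall>x. b x \<le> w x"
    proof (rule least_competitor[OF h, of ?S])
      show "?S \<subseteq> competitors s ?V c" by blast
      show "?S \<noteq> {}" using vS by blast
      show "(\<lambda>x. min (u x) (w x)) \<in> ?S" if "u \<in> ?S" "w \<in> ?S" for u w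
        using that competitors_max_min(2)[OF h] by auto
      show "u \<in> ?S" if "\<And>k::nat. us k \<in> ?S" "\<And>x. (\<lambda>k. us k x) \<longlonglongrightarrow> u x" for us u
      proof -
        have "us k \<in> competitors s ?V c" for k using that(1) by blast
        then have "u \<in> competitors s ?V c" using that(2) by (rule competitors_limit[OF h])
        moreover have "s x \<le> u x" for x
          by (rule LIMSEQ_le_const[OF that(2)]) (use that(1) in auto)
        ultimately show ?thesis by blast
      qed
    qed blast
    then obtain b where b: "b \<in> competitors s ?V c" "\<And>x. s x \<le> b x"
      and least: "\<And>w x. w \<in> ?S \<Longrightarrow> b x \<le> w x" by blast
    have bs: "lipschitz_close b s" and b0: "\<And>x. x \<notin> ?V \<Longrightarrow> b x = s x" and enb: "energy_le f c b ?V"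
      using b(1) by (auto simp: competitors_def)
    have bg: "lipschitz_close b g" by (rule competitors_close[OF h b(1)])
    have b_outside: "energy_le f d b A" if "energy_le f d s A" "A \<subseteq> \<Omega>" "A \<inter> ?V = {}" for d A
      by (rule energy_le_coincide[OF that(1) sg bg that(2)]) (use that(3) b0 in blast)
    have "b \<in> competitors g \<Omega> c\<^sub>0"
    proof -
      have "energy_le f c\<^sub>0 b ?V" by (rule energy_le_mono[OF enb]) (use False in auto)
      moreover have "energy_le f c\<^sub>0 b (\<Omega> - ?V)"
        by (rule b_outside) (auto intro: energy_le_mono[OF ens order_refl])
      ultimately have "energy_le f c\<^sub>0 b (?V \<union> (\<Omega> - ?V))" by (rule energy_le_Un)
      then have "energy_le f c\<^sub>0 b \<Omega>" by (rule energy_le_mono) auto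
      moreover have "b x = g x" if "x \<notin> \<Omega>" for x
      proof -
        have "x \<notin> ?V" using that sub by blast
        then show ?thesis using b0[of x] s0[OF that] by simp
      qed
      ultimately show ?thesis using bg by (simp add: competitors_def)
    qed
    moreover have "subminimal b"
      unfolding subminimal_def
    proof (intro allI impI)
      fix w d
      let ?W = "{x. w x < b x}"
      assume w: "lipschitz_close w b" "\<forall>x. w x \<le> b x" "closure ?W \<subseteq> \<Omega>" and enw: "energy_le f d w ?W"
      have subW: "?W \<subseteq> \<Omega>" by (rule order_trans[OF closure_subset w(3)])
      have wg: "lipschitz_close w g" using w(1) bg by (rule lipschitz_close_trans)
      have ws: "lipschitz_close w s" using w(1) bs by (rule lipschitz_close_trans)
      let ?W1 = "{x. w x < s x}"
      have W1: "?W1 \<subseteq> ?W" using b(2) less_le_trans by blast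
      have ens1: "energy_le f d s ?W1"
        by (rule subminimalD[OF s(2) ws w(3) W1 sg]) (rule energy_le_mono[OF enw order_refl W1])
      have "?W - ?V \<subseteq> ?W1" using b0 by auto
      then have out: "energy_le f d b (?W - ?V)"
        using subW by (intro b_outside energy_le_mono[OF ens1 order_refl]) auto
      have inside: "energy_le f d b (?W \<inter> ?V)"
      proof (cases "c \<le> d")
        case True
        then show ?thesis by (rule energy_le_mono[OF enb]) auto
      next
        case dc: False
        let ?m = "\<lambda>x. max (w x) (s x)"
        have ms: "lipschitz_close ?m s" using ws by (intro lipschitz_close_max_min) simp_all
        have mg: "lipschitz_close ?m g" using ms sg by (rule lipschitz_close_trans)
        have "energy_le f c ?m (?V - ?W)"
        proof (rule energy_le_coincide[OF _ bg mg])
          show "energy_le f c b (?V - ?W)" by (rule energy_le_mono[OF enb order_refl]) auto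
          show "?m x = b x" if "x \<in> ?V - ?W" for x
            using that w(2)[rule_format, of x] b(2)[of x] by auto
        qed (use sub in auto)
        moreover have "energy_le f c ?m ((?W \<inter> ?V) - ?W1)"
        proof (rule energy_le_coincide[OF _ wg mg])
          show "energy_le f c w ((?W \<inter> ?V) - ?W1)" by (rule energy_le_mono[OF enw]) (use dc in auto)
        qed (use sub in auto)
        moreover have "energy_le f c ?m ?W1"
        proof (rule energy_le_coincide[OF _ sg mg])
          show "energy_le f c s ?W1" by (rule energy_le_mono[OF ens1]) (use dc in auto)
        qed (use W1 subW in auto)
        ultimately have "energy_le f c ?m (((?V - ?W) \<union> ((?W \<inter> ?V) - ?W1)) \<union> ?W1)"
          by (intro energy_le_Un)
        then have "energy_le f c ?m ?V" by (rule energy_le_mono) auto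
        moreover have "?m x = s x" if "x \<notin> ?V" for x
          using w(2)[rule_format, of x] b0[OF that] by auto
        ultimately have "?m \<in> ?S" using ms by (auto simp: competitors_def)
        \<comment> \<open>So \<open>b\<close> cannot exceed \<open>max w s\<close>; where \<open>w < b\<close> this leaves only \<open>b = s\<close>.\<close>
        from least[OF this] have bm: "b x \<le> max (w x) (s x)" for x .
        have "?W \<inter> ?V \<subseteq> ?W1" and eq: "\<And>x. x \<in> ?W \<Longrightarrow> b x = s x"
          using bm b(2) by (smt (verit) Int_iff mem_Collect_eq subsetI)+
        then have "energy_le f d s (?W \<inter> ?V)" by (intro energy_le_mono[OF ens1 order_refl])
        then show ?thesis
        proof (rule energy_le_coincide[OF _ sg bg])
          show "?W \<inter> ?V \<subseteq> \<Omega>" using sub by blast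
          show "b x = s x" if "x \<in> ?W \<inter> ?V" for x using eq that by blast
        qed
      qed
      have "energy_le f d b ((?W \<inter> ?V) \<union> (?W - ?V))" by (rule energy_le_Un[OF inside out])
      then show "energy_le f d b ?W" by (rule energy_le_mono) auto
    qed
    ultimately have "b x \<le> s x" for x by (rule greatest)
    then have "s x = b x" for x using b(2) antisym by blast
    then show ?thesis by (intro energy_le_coincide[OF enb bg sg sub])
  qed
qed

lemma exists_sub_and_superminimal_competitor:
  assumes ne: "competitors g \<Omega> c\<^sub>0 \<noteq> {}"
  obtains u where "u \<in> competitors g \<Omega> c\<^sub>0" "subminimal u" "superminimal u"
proof -
  note h = admissible_base_g
  let ?S = "{u \<in> competitors g \<Omega> c\<^sub>0. subminimal u}"
  have "\<exists>s\<in>?S. \<forall>u\<in>?S. \<forall>x. u x \<le> s x"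
  proof (rule greatest_competitor[OF h, of ?S c\<^sub>0])
    show "?S \<noteq> {}" using exists_subminimal_competitor[OF ne] by blast
    show "(\<lambda>x. max (u x) (v x)) \<in> ?S" if "u \<in> ?S" "v \<in> ?S" for u v
      using that competitors_max_min(1)[OF h] subminimal_max competitors_close[OF h] by blast
    show "u \<in> ?S" if us: "\<And>k::nat. us k \<in> ?S" and "\<And>k x. us k x \<le> us (Suc k) x"
      "\<And>x. (\<lambda>k. us k x) \<longlonglongrightarrow> u x" for us u
    proof -
      have c: "us k \<in> competitors g \<Omega> c\<^sub>0" "subminimal (us k)" for k using us[of k] by auto
      show ?thesis
        using competitors_limit[OF h c(1) that(3)] subminimal_increasing_limit[OF h c that(2,3)] by blast
    qed
  qed blast+
  then obtain s where s: "s \<in> competitors g \<Omega> c\<^sub>0" "subminimal s"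
    and greatest: "\<And>u x. u \<in> competitors g \<Omega> c\<^sub>0 \<Longrightarrow> subminimal u \<Longrightarrow> u x \<le> s x" by blast
  have "superminimal s"
    by (rule greatest_subminimal_is_superminimal[OF s]) (rule greatest)
  with s show ?thesis by (rule that)
qed

end

section \<open>Absolute minimizers\<close>

lemma locally_Lipschitz_on_cong:
  assumes "\<And>x. x \<in> \<Omega> \<Longrightarrow> u x = v x" "locally_Lipschitz_on \<Omega> u"
  shows "locally_Lipschitz_on \<Omega> v"
  unfolding locally_Lipschitz_on_def
proof
  fix x assume "x \<in> \<Omega>"
  then obtain r L where r: "r > 0" "L-lipschitz_on (cball x r \<inter> \<Omega>) u"
    using assms(2) unfolding locally_Lipschitz_on_def by blast
  have "L-lipschitz_on (cball x r \<inter> \<Omega>) v"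
    by (rule lipschitz_on_transform[OF r(2)]) (use assms(1) in auto)
  then show "\<exists>r>0. \<exists>L. L-lipschitz_on (cball x r \<inter> \<Omega>) v" using r(1) by blast
qed

lemma energy_le_cong_open:
  assumes "open V" "\<And>x. x \<in> V \<Longrightarrow> u x = v x" "energy_le f c u V"
  shows "energy_le f c v V"
  using assms(3) unfolding energy_le_def
proof eventually_elim
  case (elim x)
  then show ?case using pgrad_cong_open(1)[OF assms(1) _ assms(2)] assms(2) by auto
qed

lemma W1inf_subset:
  fixes u :: "real ^ 'n \<Rightarrow> real"
  assumes "u \<in> W1inf \<Omega>" "open \<Omega>" "open V" "V \<subseteq> \<Omega>"
  shows "u \<in> W1inf V"
proof -
  obtain C L where C: "AE x in lebesgue. x \<in> \<Omega> \<longrightarrow> \<bar>u x\<bar> \<le> C"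
    and L: "gradient_le u \<Omega> L" and lu: "locally_Lipschitz_on \<Omega> u"
    using assms(1) by (auto simp: W1inf_iff[OF assms(2)])
  have "AE x in lebesgue. x \<in> V \<longrightarrow> \<bar>u x\<bar> \<le> C"
    using C by (rule eventually_mono) (use assms(4) in blast)
  moreover have "gradient_le u V L"
    using L by (rule eventually_mono) (use assms(4) in blast)
  ultimately show ?thesis
    using locally_Lipschitz_on_subset[OF lu assms(4)] by (auto simp: W1inf_iff[OF assms(3)])
qed

lemma W1inf_zero_extension_lipschitz:
  fixes z :: "real ^ 'n \<Rightarrow> real"
  assumes "open V" "bounded V" "z \<in> W1inf V" "continuous_on (closure V) (\<lambda>x. if x \<in> V then z x else 0)"
  obtains M where "M-lipschitz_on UNIV (\<lambda>x. if x \<in> V then z x else 0)"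
proof -
  obtain L where L: "gradient_le z V L" and z: "locally_Lipschitz_on V z"
    using assms(3) by (auto simp: W1inf_iff[OF assms(1)])
  have "gradient_le z V (max L 0)"
    using L by eventually_elim auto
  from lipschitz_extension_by_zero[OF assms(1,2) z assms(4) this] that show ?thesis by simp
qed

context supremal_problem
begin

lemma W1inf_if_close:
  assumes "lipschitz_close u g" "open V" "V \<subseteq> \<Omega>"
  shows "u \<in> W1inf V"
proof -
  obtain M where "M-lipschitz_on UNIV (\<lambda>x. g x - u x)"
    using lipschitz_close_sym[OF assms(1)] unfolding lipschitz_close_def by blast
  moreover have "bounded V" using bounded_domain assms(3) bounded_subset by blast
  ultimately have "(\<lambda>x. g x - u x) \<in> W1inf V" using assms(2) by (intro lipschitz_in_W1inf)
  from W1inf_diff[OF assms(2) W1inf_subset[OF boundary_datum open_domain assms(2,3)] this]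
  show ?thesis by simp
qed

lemma exists_competitor:
  assumes f: "measurable_supremand \<Omega> f"
    and w: "w \<in> W1inf_bdry \<Omega> g" "supremal_functional f w \<Omega> \<le> ereal c"
  shows "competitors g \<Omega> c \<noteq> {}"
proof -
  let ?z = "\<lambda>x. if x \<in> \<Omega> then w x - g x else 0"
  obtain M where M: "M-lipschitz_on UNIV ?z"
    by (rule W1inf_zero_extension_lipschitz[OF open_domain bounded_domain])
      (use w(1) in \<open>auto simp: W1inf_bdry_def C0_def\<close>)
  define u where "u = (\<lambda>x. g x + ?z x)"
  have close: "lipschitz_close u g" using M unfolding lipschitz_close_def u_def by auto
  have uw: "u x = w x" if "x \<in> \<Omega>" for x using that by (simp add: u_def)
  have "locally_Lipschitz_on \<Omega> w"
    by (rule locally_Lipschitz_on_cong[OF uw locally_Lipschitz_if_close[OF close]])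
  then have "energy_le f c w \<Omega>"
    using w(2) supremal_functional_le_iff[OF f open_domain order_refl] by blast
  then have "energy_le f c u \<Omega>" by (rule energy_le_cong_open[OF open_domain, rotated]) (simp add: uw)
  then have "u \<in> competitors g \<Omega> c" using close by (simp add: competitors_def u_def)
  then show ?thesis by blast
qed

text \<open>A comparison function on \<open>V\<close> with the boundary values of \<open>u\<close> becomes one on the whole space, because
  the difference extends by zero.\<close>

lemma comparison_function_extension:
  assumes u: "lipschitz_close u g" and V: "V \<subset>\<subset> \<Omega>" and v: "v \<in> W1inf V" "continuous_on (closure V) v"
    and eq: "\<And>x. x \<in> frontier V \<Longrightarrow> v x = u x"
  shows "\<exists>v'. lipschitz_close v' u \<and> (\<forall>x\<in>V. v' x = v x) \<and> (\<forall>x. x \<notin> V \<longrightarrow> v' x = u x)"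
proof -
  have oV: "open V" and cV: "closure V \<subseteq> \<Omega>" using V by (auto simp: compactly_inside_def)
  have sub: "V \<subseteq> \<Omega>" by (rule order_trans[OF closure_subset cV])
  have bV: "bounded V" by (rule bounded_subset[OF bounded_domain sub])
  let ?z = "\<lambda>x. if x \<in> V then v x - u x else 0"
  have "continuous_on (closure V) (\<lambda>x. v x - u x)"
    using v(2) continuous_on_subset[OF locally_Lipschitz_on_continuous_on[OF open_domain locally_Lipschitz_if_close[OF u]] cV]
    by (rule continuous_on_diff)
  moreover have "v x - u x = ?z x" if "x \<in> closure V" for x
    using that eq[of x] oV by (auto simp: frontier_def interior_open)
  ultimately have cont: "continuous_on (closure V) ?z" by (simp cong: continuous_on_cong)
  obtain M where M: "M-lipschitz_on UNIV ?z"
    by (rule W1inf_zero_extension_lipschitz[OF oV bV W1inf_diff[OF oV v(1) W1inf_if_close[OF u oV sub]] cont])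
  show ?thesis
  proof (intro exI[of _ "\<lambda>x. u x + ?z x"] conjI)
    show "lipschitz_close (\<lambda>x. u x + ?z x) u" using M unfolding lipschitz_close_def by auto
  qed auto
qed

lemma supremal_functional_leI:
  assumes f: "measurable_supremand \<Omega> f" and V: "open V" "V \<subseteq> \<Omega>"
    and u: "locally_Lipschitz_on V u" and v: "locally_Lipschitz_on V v"
    and imp: "\<And>c. energy_le f c v V \<Longrightarrow> energy_le f c u V"
  shows "supremal_functional f u V \<le> supremal_functional f v V"
proof (rule ereal_le_real)
  fix c assume "supremal_functional f v V \<le> ereal c"
  then show "supremal_functional f u V \<le> ereal c"
    unfolding supremal_functional_le_iff[OF f V u] supremal_functional_le_iff[OF f V v] by (rule imp)
qed

text \<open>Every comparison function on an open set \<open>V\<close> compactly inside the domain extends by \<open>u\<close>, and then \<open>V\<close> is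
  exactly the set where the extension differs from \<open>u\<close>.\<close>

lemma absolute_minimizer_if_sub_and_superminimal:
  assumes f: "measurable_supremand \<Omega> f" and u: "lipschitz_close u g" "subminimal u" "superminimal u"
  shows "absolute_minimizer (supremal_functional f) \<Omega> u"
proof -
  have loc: "u \<in> W1inf_loc \<Omega>"
    unfolding W1inf_loc_def
  proof safe
    show "locally_Lipschitz_on \<Omega> u" by (rule locally_Lipschitz_if_close[OF u(1)])
    fix V assume V: "V \<subset>\<subset> \<Omega>"
    then have "open V" "V \<subseteq> \<Omega>" using closure_subset[of V] by (auto simp: compactly_inside_def)
    then show "u \<in> W1inf V" by (rule W1inf_if_close[OF u(1)])
  qed
  have compare: "supremal_functional f u V \<le> supremal_functional f v V"
    if V: "V \<subset>\<subset> \<Omega>" and v: "v \<in> W1inf V" "continuous_on (closure V) v" "\<And>x. x \<in> frontier V \<Longrightarrow> v x = u x"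
      and sign: "(\<forall>x\<in>V. v x < u x) \<or> (\<forall>x\<in>V. u x < v x)" for V v
  proof -
    have oV: "open V" and cV: "closure V \<subseteq> \<Omega>" using V by (auto simp: compactly_inside_def)
    have sub: "V \<subseteq> \<Omega>" by (rule order_trans[OF closure_subset cV])
    obtain v' where v': "lipschitz_close v' u" "\<And>x. x \<in> V \<Longrightarrow> v' x = v x" "\<And>x. x \<notin> V \<Longrightarrow> v' x = u x"
      using comparison_function_extension[OF u(1) V v] by blast
    show ?thesis
    proof (rule supremal_functional_leI[OF f oV sub])
      show "locally_Lipschitz_on V u"
        by (rule locally_Lipschitz_on_subset[OF locally_Lipschitz_if_close[OF u(1)] sub])
      show "locally_Lipschitz_on V v" using v(1) by (simp add: W1inf_def)
      fix c assume "energy_le f c v V"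
      then have en: "energy_le f c v' V" by (rule energy_le_cong_open[OF oV, rotated]) (simp add: v'(2))
      from sign show "energy_le f c u V"
      proof
        assume less: "\<forall>x\<in>V. v x < u x"
        have set: "{x. v' x < u x} = V" using less v'(2,3) by force
        have "\<forall>x. v' x \<le> u x" using less v'(2,3) by (metis less_imp_le order_refl)
        then show ?thesis
          using u(2)[unfolded subminimal_def, rule_format, of v' c] v'(1) cV en by (simp add: set)
      next
        assume less: "\<forall>x\<in>V. u x < v x"
        have set: "{x. u x < v' x} = V" using less v'(2,3) by force
        have "\<forall>x. u x \<le> v' x" using less v'(2,3) by (metis less_imp_le order_refl)
        then show ?thesis
          using u(3)[unfolded superminimal_def, rule_format, of v' c] v'(1) cV en by (simp add: set)
      qed
    qed
  qed
  show ?thesis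
    unfolding absolute_minimizer_def absolute_superminimizer_def absolute_subminimizer_def
    using loc compare by blast
qed

end

theorem theorem2p4:
  fixes \<Omega> :: "(real ^ 'n) set"
    and f :: "real ^ 'n \<Rightarrow> real \<Rightarrow> real ^ 'n \<Rightarrow> real"
    and g :: "real ^ 'n \<Rightarrow> real"
  assumes "open \<Omega>" and "connected \<Omega>" and "\<Omega> \<noteq> {}" and "bounded \<Omega>"
    and "measurable_supremand \<Omega> f"
    and "H1 \<Omega> f"
    and "H2 \<Omega> f"
    and "g \<in> W1inf \<Omega>"
    and "\<exists>w \<in> W1inf_bdry \<Omega> g. supremal_functional f w \<Omega> < \<infinity>"
  shows "\<exists>u \<in> W1inf_bdry \<Omega> g. absolute_minimizer (supremal_functional f) \<Omega> u"
proof -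
  interpret supremal_problem \<Omega> f g
    using assms by unfold_locales
  obtain w where w: "w \<in> W1inf_bdry \<Omega> g" "supremal_functional f w \<Omega> < \<infinity>"
    using assms(9) by blast
  obtain c where c: "supremal_functional f w \<Omega> \<le> ereal c"
    using w(2) by (cases "supremal_functional f w \<Omega>") auto
  obtain u where u: "u \<in> competitors g \<Omega> c" "subminimal u" "superminimal u"
    using exists_sub_and_superminimal_competitor[OF exists_competitor[OF assms(5) w(1) c]] by blast
  have close: "lipschitz_close u g" and off: "\<And>x. x \<notin> \<Omega> \<Longrightarrow> u x = g x"
    using u(1) by (auto simp: competitors_def)
  then obtain M where M: "M-lipschitz_on UNIV (\<lambda>x. u x - g x)" unfolding lipschitz_close_def by blast
  have eq: "(\<lambda>x. if x \<in> \<Omega> then u x - g x else 0) = (\<lambda>x. u x - g x)" using off by auto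
  have "(\<lambda>x. u x - g x) \<in> C0 \<Omega>"
    unfolding C0_def mem_Collect_eq eq
    by (rule continuous_on_subset[OF lipschitz_on_continuous_on[OF M] subset_UNIV])
  moreover have "(\<lambda>x. u x - g x) \<in> W1inf \<Omega>" by (rule lipschitz_in_W1inf[OF M assms(1,4)])
  ultimately have "u \<in> W1inf_bdry \<Omega> g" by (simp add: W1inf_bdry_def)
  then show ?thesis
    using absolute_minimizer_if_sub_and_superminimal[OF assms(5) close u(2,3)] by blast
qed

end
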